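(* Let $\varphi$ be an increasing concave function on $[0,1]$ such that $\lim_{t\to0^+}\varphi(t)=0$ and $q_\varphi^0<1$. Then the space $C(M_\varphi^0)[0,1]$ has the Dunford–Pettis property.
   Context: Convention: $\varphi(0)=0$, $\varphi>0$ on $(0,1]$. Marcinkiewicz space $M_\varphi$ on $[0,1]$: measurable $f$ with $\|f\|=\sup_{0<t\le1}\frac{\varphi(t)}{t}\int_0^tf^*(s)\,ds<\infty$, $f^*$ the decreasing rearrangement. $M_\varphi^0$ is the subspace of elements with order continuous norm ($\|f\chi_{A_n}\|\to0$ whenever $A_n$ decrease with $m(\bigcap A_n)=0$), with the norm of $M_\varphi$. With $Cf(x)=\frac1x\int_0^xf(t)\,dt$, $C(M_\varphi^0)[0,1]=\{f:C|f|\in M_\varphi^0\}$, $\|f\|=\|C|f|\|_{M_\varphi}$. Index: $\overline\varphi^0(s)=\sup_{0<t\le\min(1,1/s)}\varphi(st)/\varphi(t)$, $q_\varphi^0=\lim_{s\to\infty}\ln\overline\varphi^0(s)/\ln s$. Dunford–Pettis property: $x_n\to0$ weakly and $x_n^*\to0$ weakly in the dual imply $x_n^*(x_n)\to0$. *)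

theory Defs
  imports "HOL-Analysis.Analysis"
begin

text \<open>Functions on [0,1] are represented by real-valued functions on the reals; only
their values on [0,1] matter. Measure: Lebesgue measure.\<close>

definition on01 :: "(real \<Rightarrow> real) \<Rightarrow> bool" where
  "on01 f \<longleftrightarrow> f \<in> borel_measurable (restrict_space lebesgue {0..1})"

definition rearr :: "(real \<Rightarrow> real) \<Rightarrow> real \<Rightarrow> real" where
  "rearr f s = Inf {c. 0 \<le> c \<and> measure lebesgue {x\<in>{0..1}. c < \<bar>f x\<bar>} \<le> s}"

definition Mnorm :: "(real \<Rightarrow> real) \<Rightarrow> (real \<Rightarrow> real) \<Rightarrow> ennreal" where
  "Mnorm \<phi> f = (SUP t\<in>{0<..1}. ennreal (\<phi> t / t) * (\<integral>\<^sup>+ s\<in>{0..t}. ennreal (rearr f s) \<partial>lebesgue))"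

definition in_M :: "(real \<Rightarrow> real) \<Rightarrow> (real \<Rightarrow> real) \<Rightarrow> bool" where
  "in_M \<phi> f \<longleftrightarrow> on01 f \<and> Mnorm \<phi> f < \<infinity>"

definition in_M0 :: "(real \<Rightarrow> real) \<Rightarrow> (real \<Rightarrow> real) \<Rightarrow> bool" where
  "in_M0 \<phi> f \<longleftrightarrow> in_M \<phi> f \<and>
     (\<forall>A :: nat \<Rightarrow> real set. (\<forall>n. A n \<in> sets lebesgue \<and> A n \<subseteq> {0..1}) \<longrightarrow> decseq A \<longrightarrow>
        emeasure lebesgue (\<Inter>n. A n) = 0 \<longrightarrow>
        ((\<lambda>n. Mnorm \<phi> (\<lambda>x. indicator (A n) x * f x)) \<longlonglongrightarrow> 0))"

definition Ces_abs :: "(real \<Rightarrow> real) \<Rightarrow> real \<Rightarrow> real" where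
  "Ces_abs f x = (if 0 < x \<and> x \<le> 1
     then enn2real (\<integral>\<^sup>+ t\<in>{0..x}. ennreal \<bar>f t\<bar> \<partial>lebesgue) / x else 0)"

definition in_CM0 :: "(real \<Rightarrow> real) \<Rightarrow> (real \<Rightarrow> real) \<Rightarrow> bool" where
  "in_CM0 \<phi> f \<longleftrightarrow> on01 f \<and>
     (\<forall>x\<in>{0<..<1}. (\<integral>\<^sup>+ t\<in>{0..x}. ennreal \<bar>f t\<bar> \<partial>lebesgue) < \<infinity>) \<and>
     in_M0 \<phi> (Ces_abs f)"

definition CM_norm :: "(real \<Rightarrow> real) \<Rightarrow> (real \<Rightarrow> real) \<Rightarrow> real" where
  "CM_norm \<phi> f = enn2real (Mnorm \<phi> (Ces_abs f))"

text \<open>Topological dual of X = C(M_phi^0): bounded linear functionals on X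
  (extended by 0 outside X, so that the dual is a vector space of functions).\<close>
definition CM_dual :: "(real \<Rightarrow> real) \<Rightarrow> ((real \<Rightarrow> real) \<Rightarrow> real) set" where
  "CM_dual \<phi> = {l. (\<forall>f g a b. in_CM0 \<phi> f \<longrightarrow> in_CM0 \<phi> g \<longrightarrow>
                     l (\<lambda>x. a * f x + b * g x) = a * l f + b * l g)
                 \<and> (\<exists>K. \<forall>f. in_CM0 \<phi> f \<longrightarrow> \<bar>l f\<bar> \<le> K * CM_norm \<phi> f)
                 \<and> (\<forall>f. \<not> in_CM0 \<phi> f \<longrightarrow> l f = 0)}"

definition dual_norm :: "(real \<Rightarrow> real) \<Rightarrow> ((real \<Rightarrow> real) \<Rightarrow> real) \<Rightarrow> real" where
  "dual_norm \<phi> l = Inf {K. 0 \<le> K \<and> (\<forall>f. in_CM0 \<phi> f \<longrightarrow> \<bar>l f\<bar> \<le> K * CM_norm \<phi> f)}"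

definition CM_bidual :: "(real \<Rightarrow> real) \<Rightarrow> (((real \<Rightarrow> real) \<Rightarrow> real) \<Rightarrow> real) set" where
  "CM_bidual \<phi> = {L. (\<forall>l1 l2 a b. l1 \<in> CM_dual \<phi> \<longrightarrow> l2 \<in> CM_dual \<phi> \<longrightarrow>
                     L (\<lambda>f. a * l1 f + b * l2 f) = a * L l1 + b * L l2)
                 \<and> (\<exists>K. \<forall>l\<in>CM_dual \<phi>. \<bar>L l\<bar> \<le> K * dual_norm \<phi> l)}"

definition weakly_null :: "(real \<Rightarrow> real) \<Rightarrow> (nat \<Rightarrow> real \<Rightarrow> real) \<Rightarrow> bool" where
  "weakly_null \<phi> x \<longleftrightarrow> (\<forall>n. in_CM0 \<phi> (x n)) \<and>
     (\<forall>l\<in>CM_dual \<phi>. (\<lambda>n. l (x n)) \<longlonglongrightarrow> 0)"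

definition weakly_null_dual :: "(real \<Rightarrow> real) \<Rightarrow> (nat \<Rightarrow> (real \<Rightarrow> real) \<Rightarrow> real) \<Rightarrow> bool" where
  "weakly_null_dual \<phi> y \<longleftrightarrow> (\<forall>n. y n \<in> CM_dual \<phi>) \<and>
     (\<forall>L\<in>CM_bidual \<phi>. (\<lambda>n. L (y n)) \<longlonglongrightarrow> 0)"

definition CM0_Dunford_Pettis :: "(real \<Rightarrow> real) \<Rightarrow> bool" where
  "CM0_Dunford_Pettis \<phi> \<longleftrightarrow>
     (\<forall>x y. weakly_null \<phi> x \<longrightarrow> weakly_null_dual \<phi> y \<longrightarrow> (\<lambda>n. y n (x n)) \<longlonglongrightarrow> 0)"

definition phibar0 :: "(real \<Rightarrow> real) \<Rightarrow> real \<Rightarrow> real" where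
  "phibar0 \<phi> s = (SUP t\<in>{0<..min 1 (1/s)}. \<phi> (s * t) / \<phi> t)"

definition q_index0 :: "(real \<Rightarrow> real) \<Rightarrow> real" where
  "q_index0 \<phi> = Lim at_top (\<lambda>s. ln (phibar0 \<phi> s) / ln s)"

end

theory Submission
  imports Defs
begin

text \<open>
  Put \<open>F x = \<integral>\<^sub>0\<^sup>x \<bar>f\<bar>\<close> (\<open>cum f x\<close> below) and \<open>psi x = min (\<phi> x) (\<phi> (1 - x)) / x\<close>. Because the index is below 1, the norm of
  \<open>f\<close> in \<open>C(M\<^sub>\<phi>\<^sup>0)\<close> is equivalent to \<open>sup psi F\<close>, and \<open>f\<close> belongs to the space iff \<open>psi F\<close> tends to 0 at
  both endpoints. Hence the space looks like a \<open>c\<^sub>0\<close>-sum of \<open>L\<^sup>1\<close>-spaces over intervals that shrink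
  towards 0 and 1, and every bounded functional has a density \<open>G\<close> with \<open>G t = O(1 / t)\<close>.

  Let \<open>x\<^sub>n\<close> and \<open>y\<^sub>n\<close> be weakly null, \<open>G\<^sub>n\<close> the density of \<open>y\<^sub>n\<close>. Then \<open>\<bar>y\<^sub>n x\<^sub>n\<bar> \<le> \<integral> \<bar>x\<^sub>n G\<^sub>n\<bar>\<close> tends to 0 because
  the part of this integral outside \<open>[a, 1 - a]\<close> is small uniformly in \<open>n\<close>, while on \<open>[a, 1 - a]\<close> the
  \<open>G\<^sub>n\<close> tend to 0 in measure and the \<open>x\<^sub>n G\<^sub>n\<close> are uniformly integrable. The first and the last statement are
  gliding hump arguments, in the dual and in the space respectively; both reduce to Schur's lemma that a real
  matrix with summable rows, all of whose partial row sums over sets of columns tend to 0, has a null diagonal.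
\<close>

section \<open>Sequences and matrices of real numbers\<close>

text \<open>\<open>psi\<close> weighs the two ways in which F makes the Cesaro mean large: from a
  point x near 0 on, the mean is at least F x / (2 x) on a stretch of length x; near 1 it is at
  least F x on a stretch of length 1 - x. F may become infinite at 1, so functions of the space need
  not be integrable on [0,1], and all estimates are made on [0,x] with x < 1. The obstacle is that F
  accumulates: mass near 0 is felt at every later point, so blocks with disjoint supports do not
  combine like a maximum. They do so approximately if they are far apart, because \<phi> t and t /
  \<phi> t both tend to 0; the latter is again due to the index. This decides which side carries the
  humps. Blocks of the x_n escaping to the endpoints have bounded signed sums, so they can be summed
  in the bidual and tested by the y_n. On the middle part the space is like L^1, where sums of
  blocks are unbounded in general, but disjoint blocks of bounded densities add up to functionals.
  The bidual itself is never described: series of evaluations and generalised limits of evaluations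
  are the only elements needed.\<close>

lemma generalized_limit:
  "\<exists>\<Lambda>::(nat \<Rightarrow> real) \<Rightarrow> real.
     (\<forall>s t a b. Bseq s \<longrightarrow> Bseq t \<longrightarrow> \<Lambda> (\<lambda>n. a * s n + b * t n) = a * \<Lambda> s + b * \<Lambda> t) \<and>
     (\<forall>s c. Bseq s \<longrightarrow> (\<forall>\<^sub>F n in sequentially. c \<le> s n) \<longrightarrow> c \<le> \<Lambda> s)"
proof -
  have "\<forall>s::nat \<Rightarrow> real. \<exists>K. Bseq s \<longrightarrow> (\<forall>n. \<bar>s n\<bar> \<le> K)"
    by (auto simp: Bseq_def)
  then obtain K :: "(nat \<Rightarrow> real) \<Rightarrow> real" where K: "\<And>s n. Bseq s \<Longrightarrow> \<bar>s n\<bar> \<le> K s"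
    by metis
  \<comment> \<open>\<open>p m\<close> is evaluation at the index \<open>m\<close>, cut to 0 on
    unbounded sequences. All \<open>p m\<close> lie in one product of compact intervals, compact by
    Tychonoff; any cluster point of them is a generalised limit.\<close>
  define p where "p m s = (if Bseq s then s m else 0)" for m and s :: "nat \<Rightarrow> real"
  define U where "U = (PiE UNIV (\<lambda>s. {- \<bar>K s\<bar>..\<bar>K s\<bar>}) :: ((nat \<Rightarrow> real) \<Rightarrow> real) set)"
  have "compactin (product_topology (\<lambda>i. euclidean) UNIV) U"
    unfolding U_def by (auto simp: compactin_PiE)
  then have "compact U"
    by (simp add: euclidean_product_topology)
  have pU: "p m \<in> U" for m
  proof -
    have "\<bar>p m s\<bar> \<le> \<bar>K s\<bar>" for s
      using K[of s m] by (auto simp: p_def)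
    then show ?thesis
      by (auto simp: U_def abs_le_iff) (metis minus_le_iff)
  qed
  let ?F = "filtermap p sequentially"
  have "?F \<noteq> bot" "eventually (\<lambda>x. x \<in> U) ?F"
    using pU by (auto simp: filtermap_bot_iff eventually_filtermap)
  with \<open>compact U\<close> obtain L where L: "inf (nhds L) ?F \<noteq> bot"
    unfolding compact_filter by blast
  \<comment> \<open>A cluster point inherits every closed condition that the evaluations eventually
    satisfy. Linearity and lower bounds are such conditions, each involving finitely many
    coordinates.\<close>
  have in_closed: "L \<in> C" if "closed C" "\<forall>\<^sub>F m in sequentially. p m \<in> C" for C
  proof (rule ccontr)
    assume "L \<notin> C"
    then have "\<forall>\<^sub>F x in nhds L. x \<in> - C"
      using \<open>closed C\<close> by (auto simp: eventually_nhds intro!: exI[of _ "- C"])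
    moreover have "\<forall>\<^sub>F x in ?F. x \<in> C"
      using that by (simp add: eventually_filtermap)
    ultimately have "\<forall>\<^sub>F x in inf (nhds L) ?F. False"
      unfolding eventually_inf by blast
    with L show False
      by (simp add: trivial_limit_def)
  qed
  have cont: "continuous_on UNIV (\<lambda>f::(nat \<Rightarrow> real) \<Rightarrow> real. f s)" for s
    by simp
  have lin: "L (\<lambda>n. a * s n + b * t n) = a * L s + b * L t" if "Bseq s" "Bseq t" for s t a b
  proof -
    have "Bseq (\<lambda>n. a * s n + b * t n)"
    proof -
      obtain K1 where "\<And>n. \<bar>s n\<bar> \<le> K1"
        using \<open>Bseq s\<close> by (auto simp: Bseq_def)
      moreover obtain K2 where "\<And>n. \<bar>t n\<bar> \<le> K2"
        using \<open>Bseq t\<close> by (auto simp: Bseq_def)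
      ultimately have "\<bar>a * s n + b * t n\<bar> \<le> \<bar>a\<bar> * K1 + \<bar>b\<bar> * K2" for n
        by (intro order.trans[OF abs_triangle_ineq]) (simp add: abs_mult add_mono mult_left_mono)
      then show ?thesis
        by (intro BseqI'[of _ "\<bar>a\<bar> * K1 + \<bar>b\<bar> * K2"]) simp
    qed
    then have "L \<in> {f. f (\<lambda>n. a * s n + b * t n) = a * f s + b * f t}"
      by (intro in_closed closed_Collect_eq cont continuous_intros)
        (auto simp: p_def that)
    then show ?thesis by simp
  qed
  have ge: "c \<le> L s" if "Bseq s" "\<forall>\<^sub>F n in sequentially. c \<le> s n" for s c
  proof -
    have "L \<in> {f. c \<le> f s}"
      using that by (intro in_closed closed_Collect_le cont continuous_intros)
        (auto simp: p_def that)
    then show ?thesis by simp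
  qed
  show ?thesis
    using lin ge by blast
qed

text \<open>If the diagonal stays at least \<delta> along some indices, these can be thinned out to
  \<open>r\<close> such that row \<open>r j\<close> has mass at most \<delta> / 4 on the columns up
  to its predecessor (columns tend to 0) and at most \<delta> / 4 from its successor on (rows are
  summable). The partial row sums over the range of \<open>r\<close> then differ from the diagonal
  entry by at most \<delta> / 2, so this single set of columns violates the hypothesis.\<close>

lemma schur_diagonal:
  fixes a :: "nat \<Rightarrow> nat \<Rightarrow> real"
  assumes row: "\<And>n. summable (\<lambda>j. \<bar>a n j\<bar>)"
    and null: "\<And>S. (\<lambda>n. \<Sum>j. if j \<in> S then a n j else 0) \<longlonglongrightarrow> 0"
  shows "(\<lambda>n. a n n) \<longlonglongrightarrow> 0"
proof (rule ccontr)
  assume "\<not> (\<lambda>n. a n n) \<longlonglongrightarrow> 0"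
  then obtain \<delta> where \<delta>: "\<delta> > 0" and big: "\<And>m. \<exists>n\<ge>m. \<delta> \<le> \<bar>a n n\<bar>"
    by (auto simp: LIMSEQ_iff not_less)
  have sumI: "summable (\<lambda>j. \<bar>if j \<in> S then a n j else 0\<bar>)" for n S
    by (rule summable_comparison_test[OF _ row[of n]]) auto
  have col: "(\<lambda>n. a n j) \<longlonglongrightarrow> 0" for j
  proof -
    have "(\<Sum>l. if l \<in> {j} then a n l else 0) = a n j" for n
      using sums_unique[OF sums_single[of j "a n"]] by simp
    then show ?thesis using null[of "{j}"] by simp
  qed
  let ?Q = "\<lambda>n n'. n < n' \<and> (\<Sum>l\<le>n. \<bar>a n' l\<bar>) \<le> \<delta> / 4 \<and> (\<Sum>l. \<bar>a n (l + n')\<bar>) \<le> \<delta> / 4"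
  have "\<exists>r. \<forall>j. \<delta> \<le> \<bar>a (r j) (r j)\<bar> \<and> ?Q (r j) (r (Suc j))"
  proof (rule dependent_nat_choice)
    show "\<exists>n. \<delta> \<le> \<bar>a n n\<bar>" using big by blast
    fix n assume "\<delta> \<le> \<bar>a n n\<bar>"
    have "(\<lambda>n'. \<Sum>l\<le>n. \<bar>a n' l\<bar>) \<longlonglongrightarrow> 0"
      by (rule tendsto_null_sum) (auto intro: tendsto_rabs_zero col)
    then have 1: "\<forall>\<^sub>F n' in sequentially. (\<Sum>l\<le>n. \<bar>a n' l\<bar>) < \<delta> / 4"
      using \<delta> by (intro order_tendstoD) auto
    have "(\<lambda>n'. \<Sum>l. \<bar>a n (l + n')\<bar>) \<longlonglongrightarrow> 0"
      by (rule suminf_exist_split2[OF row])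
    then have 2: "\<forall>\<^sub>F n' in sequentially. (\<Sum>l. \<bar>a n (l + n')\<bar>) < \<delta> / 4"
      using \<delta> by (intro order_tendstoD) auto
    from eventually_conj[OF 1 2] obtain m where
      m: "\<And>n'. n' \<ge> m \<Longrightarrow> (\<Sum>l\<le>n. \<bar>a n' l\<bar>) < \<delta> / 4 \<and> (\<Sum>l. \<bar>a n (l + n')\<bar>) < \<delta> / 4"
      by (auto simp: eventually_sequentially)
    obtain n' where "n' \<ge> max m (Suc n)" "\<delta> \<le> \<bar>a n' n'\<bar>"
      using big by blast
    then show "\<exists>y. \<delta> \<le> \<bar>a y y\<bar> \<and> ?Q n y"
      using m[of n'] by (intro exI[of _ n']) auto
  qed
  then obtain r where rb: "\<And>j. \<delta> \<le> \<bar>a (r j) (r j)\<bar>" and rQ: "\<And>j. ?Q (r j) (r (Suc j))"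
    by blast
  have mono: "strict_mono r"
    using rQ by (simp add: strict_mono_Suc_iff)
  let ?S = "range r"
  let ?t = "\<lambda>n j. if j \<in> ?S then a n j else 0"
  \<comment> \<open>Rows are indexed by \<open>Suc i\<close> because both neighbours of the row in
    the thinned sequence are used.\<close>
  have lower: "\<delta> / 4 \<le> \<bar>\<Sum>l. ?t (r (Suc i)) l\<bar>" for i
  proof -
    let ?n = "r (Suc i)"
    have s: "summable (?t ?n)"
      by (rule summable_rabs_cancel[OF sumI])
    define h where "h l = ?t ?n l - (if l = ?n then a ?n ?n else 0)" for l
    have hsum: "summable (\<lambda>l. \<bar>h l\<bar>)"
      by (rule summable_comparison_test[OF _ row[of ?n]]) (auto simp: h_def)
    have single: "(\<lambda>l. if l = ?n then a ?n ?n else 0) sums a ?n ?n"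
      using sums_single[of ?n "\<lambda>_. a ?n ?n"] by simp
    have eq: "(\<Sum>l. ?t ?n l) = (\<Sum>l. h l) + a ?n ?n"
      unfolding h_def using suminf_diff[OF s sums_summable[OF single]] sums_unique[OF single] by simp
    have hz: "h l = 0" if "r i < l" "l < r (Suc (Suc i))" for l
    proof (cases "l \<in> ?S")
      case True
      then obtain k where "l = r k" by auto
      with that mono have "k = Suc i"
        by (simp add: strict_mono_less)
      with \<open>l = r k\<close> show ?thesis by (simp add: h_def)
    qed (auto simp: h_def)
    have hle: "\<bar>h l\<bar> \<le> \<bar>a ?n l\<bar>" for l
      by (auto simp: h_def)
    have "(\<Sum>l. \<bar>h l\<bar>) = (\<Sum>l. \<bar>h (l + r (Suc (Suc i)))\<bar>) + (\<Sum>l<r (Suc (Suc i)). \<bar>h l\<bar>)"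
      by (rule suminf_split_initial_segment[OF hsum])
    also have "(\<Sum>l<r (Suc (Suc i)). \<bar>h l\<bar>) = (\<Sum>l\<le>r i. \<bar>h l\<bar>)"
    proof (rule sum.mono_neutral_right)
      have "r i < r (Suc (Suc i))" using mono by (simp add: strict_mono_less)
      then show "{..r i} \<subseteq> {..<r (Suc (Suc i))}" by auto
    qed (auto simp: hz)
    also have "\<dots> \<le> (\<Sum>l\<le>r i. \<bar>a ?n l\<bar>)"
      by (intro sum_mono hle)
    also have "\<dots> \<le> \<delta> / 4" using rQ[of i] by simp
    also have "(\<Sum>l. \<bar>h (l + r (Suc (Suc i)))\<bar>) \<le> (\<Sum>l. \<bar>a ?n (l + r (Suc (Suc i)))\<bar>)"
      by (intro suminf_le hle summable_ignore_initial_segment hsum row)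
    also have "\<dots> \<le> \<delta> / 4" using rQ[of "Suc i"] by simp
    finally have "(\<Sum>l. \<bar>h l\<bar>) \<le> \<delta> / 2" by simp
    moreover have "\<bar>\<Sum>l. h l\<bar> \<le> (\<Sum>l. \<bar>h l\<bar>)"
      by (rule summable_rabs[OF hsum])
    ultimately show ?thesis
      using rb[of "Suc i"] \<delta> unfolding eq by linarith
  qed
  have "(\<lambda>i. \<Sum>l. ?t (r (Suc i)) l) \<longlonglongrightarrow> 0"
    using LIMSEQ_subseq_LIMSEQ[OF null[of ?S], of "\<lambda>i. r (Suc i)"] mono
    by (simp add: o_def strict_mono_def)
  then have "\<forall>\<^sub>F i in sequentially. \<bar>\<Sum>l. ?t (r (Suc i)) l\<bar> < \<delta> / 4"
    using \<delta> by (auto dest: tendstoD[of _ _ _ "\<delta>/4"] simp: dist_real_def)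
  then show False
    using lower by (auto simp: eventually_sequentially not_less[symmetric])
qed

text \<open>The elementary proof of the uniform boundedness principle: each sign is chosen so that the new
  term does not cancel the sum of the earlier ones, and the later terms are too small to do so.\<close>
lemma bounded_of_bounded_signed_series:
  fixes b :: "nat \<Rightarrow> nat \<Rightarrow> real"
  assumes le: "\<And>n j. \<bar>b n j\<bar> \<le> P n" and diag: "\<And>n. P n \<le> 2 * \<bar>b n n\<bar>"
    and bdd: "\<And>\<sigma> r. (\<forall>j. \<bar>\<sigma> j\<bar> \<le> 1) \<Longrightarrow> Bseq (\<lambda>n. \<Sum>j. (1/4)^j * \<sigma> j * b n (r j))"
  shows "\<exists>K. \<forall>n. P n \<le> K"
proof (rule ccontr)
  assume "\<not> ?thesis"
  \<comment> \<open>The factor \<open>4 ^ j\<close> compensates the weight \<open>(1/4)^j\<close> of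
    the j-th term, so that the value of the series at row \<open>r j\<close> will grow at least like
    a multiple of j.\<close>
  then have "\<forall>j::nat. \<exists>n. P n > real j * 4 ^ j"
    by (meson not_le)
  then obtain r where r: "\<And>j. P (r j) > real j * 4 ^ j"
    by metis
  let ?s = "\<lambda>\<sigma> j. \<Sum>i<j. (1/4)^i * \<sigma> i * b (r j) (r i)"
  have "\<exists>\<sigma>::nat \<Rightarrow> real. \<forall>j. \<bar>\<sigma> j\<bar> = 1 \<and> 0 \<le> ?s \<sigma> j * (\<sigma> j * b (r j) (r j))"
  proof (rule dependent_wellorder_choice)
    fix \<sigma> \<tau> :: "nat \<Rightarrow> real" and x j
    assume "\<And>y. y < j \<Longrightarrow> \<sigma> y = \<tau> y"
    then have "?s \<sigma> j = ?s \<tau> j" by simp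
    then show "(\<bar>x\<bar> = 1 \<and> 0 \<le> ?s \<sigma> j * (x * b (r j) (r j))) = (\<bar>x\<bar> = 1 \<and> 0 \<le> ?s \<tau> j * (x * b (r j) (r j)))"
      by simp
  next
    fix j and \<sigma> :: "nat \<Rightarrow> real"
    show "\<exists>x. \<bar>x\<bar> = 1 \<and> 0 \<le> ?s \<sigma> j * (x * b (r j) (r j))"
    proof (cases "0 \<le> ?s \<sigma> j * b (r j) (r j)")
      case True
      then show ?thesis by (intro exI[of _ 1]) simp
    next
      case False
      then show ?thesis by (intro exI[of _ "-1"]) simp
    qed
  qed
  then obtain \<sigma> :: "nat \<Rightarrow> real" where \<sigma>1: "\<And>j. \<bar>\<sigma> j\<bar> = 1"
    and \<sigma>2: "\<And>j. 0 \<le> ?s \<sigma> j * (\<sigma> j * b (r j) (r j))"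
    by blast
  let ?f = "\<lambda>j i. (1/4)^i * \<sigma> i * b (r j) (r i)"
  have P0: "0 \<le> P n" for n using le[of n n] by simp
  \<comment> \<open>In units of \<open>(1/4)^j * P (r j)\<close> the diagonal term is at least 1/2
    and the tail at most 1/3, which leaves 1/6. Any ratio below 1/3 in place of 1/4 would leave
    something positive.\<close>
  have lower: "real j / 6 \<le> \<bar>\<Sum>i. ?f j i\<bar>" for j
  proof -
    have fle: "\<bar>?f j i\<bar> \<le> (1/4)^i * P (r j)" for i
      using le[of "r j" "r i"] by (simp add: abs_mult \<sigma>1 mult_left_mono)
    have geo: "summable (\<lambda>i. (1/4)^i * P (r j))"
      by (intro summable_mult2 summable_geometric) simp
    have abs: "summable (\<lambda>i. \<bar>?f j i\<bar>)"
      by (rule summable_comparison_test[OF _ geo]) (use fle in auto)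
    then have sm: "summable (?f j)" by (rule summable_rabs_cancel)
    have split: "(\<Sum>i. ?f j i) = (\<Sum>i. ?f j (i + Suc j)) + (\<Sum>i<Suc j. ?f j i)"
      by (rule suminf_split_initial_segment[OF sm])
    have tail_abs: "summable (\<lambda>i. \<bar>?f j (i + Suc j)\<bar>)"
      using summable_ignore_initial_segment[OF abs, of "Suc j"] by simp
    have "\<bar>\<Sum>i. ?f j (i + Suc j)\<bar> \<le> (\<Sum>i. \<bar>?f j (i + Suc j)\<bar>)"
      by (rule summable_rabs[OF tail_abs])
    also have "\<dots> \<le> (\<Sum>i. (1/4)^(i + Suc j) * P (r j))"
      by (intro suminf_le tail_abs fle) (rule summable_ignore_initial_segment[OF geo])
    also have "\<dots> = (\<Sum>i. (1/4)^i * ((1/4)^Suc j * P (r j)))"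
      by (simp add: power_add mult_ac)
    also have "\<dots> = (\<Sum>i. (1/4)^i) * ((1/4)^Suc j * P (r j))"
      by (rule suminf_mult2[symmetric]) (simp add: summable_geometric)
    also have "\<dots> = (1/4)^j * P (r j) / 3"
      by (subst suminf_geometric) auto
    finally have tail: "\<bar>\<Sum>i. ?f j (i + Suc j)\<bar> \<le> (1/4)^j * P (r j) / 3" .
    have "\<bar>?f j j\<bar> \<le> \<bar>\<Sum>i<Suc j. ?f j i\<bar>"
    proof -
      have "0 \<le> ?s \<sigma> j * ?f j j"
        using mult_nonneg_nonneg[OF _ \<sigma>2[of j], of "(1/4)^j"] by (simp add: mult_ac)
      moreover have "(\<Sum>i<Suc j. ?f j i) = ?s \<sigma> j + ?f j j" by simp
      ultimately show ?thesis
        by (smt (verit) mult_neg_pos mult_pos_neg)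
    qed
    moreover have "\<bar>?f j j\<bar> \<ge> (1/4)^j * P (r j) / 2"
      using diag[of "r j"] by (simp add: abs_mult \<sigma>1)
    ultimately have "\<bar>\<Sum>i. ?f j i\<bar> \<ge> (1/4)^j * P (r j) / 6"
      using tail unfolding split by linarith
    moreover have "(1/4)^j * P (r j) \<ge> real j"
      using r[of j] by (simp add: power_divide field_simps)
    ultimately show ?thesis by linarith
  qed
  obtain K where K: "\<And>n. \<bar>\<Sum>i. (1/4)^i * \<sigma> i * b n (r i)\<bar> \<le> K"
    using bdd[of \<sigma> r] \<sigma>1 by (auto simp: Bseq_def)
  obtain j :: nat where "real j > 6 * K"
    using reals_Archimedean2 by blast
  with lower[of j] K[of "r j"] show False by simp
qed

section \<open>Rearrangements and the Marcinkiewicz norm\<close>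

text \<open>By concavity \<open>phibar0 \<phi> s \<le> s\<close>. If equality held for all \<open>s > 1\<close>, the quotient defining the
  index would be constantly 1; hence the inequality is strict somewhere, and it can be iterated.
  In particular no convergence of that quotient is needed.\<close>
lemma power_bound_of_q_index0:
  fixes \<phi> :: "real \<Rightarrow> real"
  assumes mono: "\<And>s t. 0 \<le> s \<Longrightarrow> s \<le> t \<Longrightarrow> t \<le> 1 \<Longrightarrow> \<phi> s \<le> \<phi> t"
    and pos: "\<And>t. 0 < t \<Longrightarrow> t \<le> 1 \<Longrightarrow> 0 < \<phi> t"
    and quasi: "\<And>s t. 0 < s \<Longrightarrow> s \<le> t \<Longrightarrow> t \<le> 1 \<Longrightarrow> \<phi> t / t \<le> \<phi> s / s"
    and q: "q_index0 \<phi> < 1"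
  obtains D \<alpha> where "0 \<le> \<alpha>" "\<alpha> < 1"
    "\<And>u t. 0 < u \<Longrightarrow> u \<le> t \<Longrightarrow> t \<le> 1 \<Longrightarrow> \<phi> t \<le> D * (t / u) powr \<alpha> * \<phi> u"
proof -
  have ratio: "\<phi> (s * t) / \<phi> t \<le> s" if "1 < s" "0 < t" "t \<le> 1 / s" for s t
  proof -
    have "s * t \<le> 1" using that by (simp add: field_simps)
    moreover have "t \<le> s * t" using that by simp
    moreover have "t \<le> 1" using \<open>s * t \<le> 1\<close> \<open>t \<le> s * t\<close> by linarith
    ultimately have "\<phi> (s * t) / (s * t) \<le> \<phi> t / t" "0 < \<phi> t"
      using that quasi pos by auto
    then show ?thesis using that by (simp add: field_simps)
  qed
  have min: "min 1 (1 / s) = 1 / s" if "1 < s" for s :: real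
    using that by simp
  have upper: "phibar0 \<phi> s \<le> s" if "1 < s" for s
    unfolding phibar0_def min[OF that] using that by (intro cSUP_least) (auto intro!: ratio)
  have "\<exists>s>1. phibar0 \<phi> s < s"
  proof (rule ccontr)
    assume "\<not> ?thesis"
    then have "phibar0 \<phi> s = s" if "1 < s" for s
      using upper that by force
    then have "\<forall>\<^sub>F s in at_top. 1 = ln (phibar0 \<phi> s) / ln s"
      by (intro eventually_mono[OF eventually_gt_at_top[of 1]]) simp
    then have "((\<lambda>s. ln (phibar0 \<phi> s) / ln s) \<longlongrightarrow> 1) at_top"
      by (rule Lim_transform_eventually[OF tendsto_const])
    then have "q_index0 \<phi> = 1"
      unfolding q_index0_def by (intro tendsto_Lim) auto
    with q show False by simp
  qed
  then obtain s where s: "1 < s" "phibar0 \<phi> s < s" by blast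
  define \<eta> where "\<eta> = phibar0 \<phi> s"
  have step: "\<phi> u \<le> \<eta> * \<phi> (u / s)" if "0 < u" "u \<le> 1" for u
  proof -
    have "bdd_above ((\<lambda>t. \<phi> (s * t) / \<phi> t) ` {0<..1 / s})"
      using ratio[OF s(1)] by (intro bdd_aboveI2[of _ _ s]) auto
    moreover have "u / s \<in> {0<..1 / s}" using that s by (auto simp: divide_simps)
    ultimately have "\<phi> (s * (u / s)) / \<phi> (u / s) \<le> \<eta>"
      unfolding \<eta>_def phibar0_def min[OF s(1)] by (rule cSUP_upper[rotated])
    moreover have "0 < \<phi> (u / s)"
    proof (rule pos)
      show "u / s \<le> 1" using that s by (simp add: divide_simps)
    qed (use that s in simp)
    ultimately show ?thesis using s by (simp add: field_simps)
  qed
  have \<eta>1: "1 \<le> \<eta>"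
  proof -
    have "\<phi> (1 / s) \<le> \<phi> 1" "0 < \<phi> (1 / s)" using s by (auto intro!: mono pos simp: divide_simps)
    with step[of 1] have "\<phi> (1 / s) \<le> \<eta> * \<phi> (1 / s)" by linarith
    with \<open>0 < \<phi> (1 / s)\<close> show ?thesis by simp
  qed
  have iter: "\<phi> t \<le> \<eta> ^ k * \<phi> (t / s ^ k)" if "0 < t" "t \<le> 1" for t k
  proof (induction k)
    case (Suc k)
    have "1 \<le> s ^ k" using s by simp
    then have "t / s ^ k \<le> 1" using that by (simp add: divide_simps)
    then have "\<phi> (t / s ^ k) \<le> \<eta> * \<phi> (t / s ^ Suc k)"
      using step[of "t / s ^ k"] that s by (simp add: field_simps)
    then have "\<eta> ^ k * \<phi> (t / s ^ k) \<le> \<eta> ^ k * (\<eta> * \<phi> (t / s ^ Suc k))"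
      using \<eta>1 by (intro mult_left_mono) auto
    with Suc show ?case by (simp add: mult_ac)
  qed simp
  \<comment> \<open>Chosen so that \<eta> = s powr \<alpha>, which turns the iterated factor \<eta>
    ^ k into a power of s ^ k. Since 1 \<le> \<eta> < s, the exponent lies in [0,1).\<close>
  define \<alpha> where "\<alpha> = log s \<eta>"
  have "\<alpha> < 1" "0 \<le> \<alpha>"
    using s \<eta>1 by (auto simp: \<alpha>_def \<eta>_def log_less_one_cancel_iff zero_le_log_cancel_iff)
  have \<eta>s: "\<eta> = s powr \<alpha>" using s \<eta>1 by (simp add: \<alpha>_def)
  have "\<phi> t \<le> \<eta> * (t / u) powr \<alpha> * \<phi> u" if "0 < u" "u \<le> t" "t \<le> 1" for u t
  proof -
    \<comment> \<open>The largest k with s ^ k \<le> t / u. One more iteration carries t below u;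
      its factor \<eta> becomes the constant \<open>D\<close>.\<close>
    define k where "k = nat \<lfloor>log s (t / u)\<rfloor>"
    have tu: "1 \<le> t / u" using that by simp
    then have l0: "0 \<le> log s (t / u)" using s by simp
    have "real k \<le> log s (t / u)" "log s (t / u) < real (Suc k)"
      using l0 by (auto simp: k_def) linarith
    then have k: "s powr real k \<le> t / u" "t / u < s powr real (Suc k)"
      using s tu by (auto simp: le_log_iff log_less_iff)
    have "t / s ^ Suc k \<le> u"
    proof -
      have "s powr real (Suc k) = s ^ Suc k" "0 < s ^ Suc k" using s by (auto intro: powr_realpow simp del: power_Suc of_nat_Suc)
      with k(2) that show ?thesis by (simp add: field_simps del: power_Suc of_nat_Suc)
    qed
    then have "\<phi> (t / s ^ Suc k) \<le> \<phi> u"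
      using that s by (intro mono) auto
    have "\<phi> t \<le> \<eta> ^ Suc k * \<phi> (t / s ^ Suc k)" by (rule iter) (use that in auto)
    also have "\<dots> \<le> \<eta> ^ Suc k * \<phi> u" using \<open>\<phi> (t / s ^ Suc k) \<le> \<phi> u\<close> \<eta>1 by (intro mult_left_mono) auto
    also have "\<eta> ^ Suc k = \<eta> * (s powr real k) powr \<alpha>"
      using s by (simp add: \<eta>s powr_powr mult.commute flip: powr_realpow)
    also have "\<dots> * \<phi> u \<le> \<eta> * (t / u) powr \<alpha> * \<phi> u"
    proof (intro mult_right_mono mult_left_mono)
      show "(s powr real k) powr \<alpha> \<le> (t / u) powr \<alpha>"
        using k \<open>0 \<le> \<alpha>\<close> s by (intro powr_mono2) auto
      show "0 \<le> \<phi> u" using pos[of u] that by simp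
    qed (use \<eta>1 in auto)
    finally show ?thesis .
  qed
  with \<open>\<alpha> < 1\<close> \<open>0 \<le> \<alpha>\<close> show thesis using that[of \<alpha> \<eta>] by blast
qed

section \<open>The decreasing rearrangement on the unit interval\<close>

abbreviation M01 :: "real measure" where "M01 \<equiv> lebesgue_on {0..1}"

lemma space_M01: "space M01 = {0..1}"
  by (simp add: space_restrict_space)

lemma sets_M01_iff: "A \<in> sets M01 \<longleftrightarrow> A \<in> sets lebesgue \<and> A \<subseteq> {0..1}"
  by (auto simp: sets_restrict_space_iff)

lemma lmeasurable_subset_01:
  fixes A :: "real set"
  assumes "A \<in> sets lebesgue" "A \<subseteq> {0..1}"
  shows "A \<in> lmeasurable"
  by (rule fmeasurableI2[OF lmeasurable_interval(1)[of 0 1] assms(2,1)])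

lemma level_set_measurable:
  assumes "on01 f"
  shows "{x\<in>{0..1}. c < \<bar>f x\<bar>} \<in> lmeasurable" "{x\<in>{0..1}. c \<le> \<bar>f x\<bar>} \<in> lmeasurable"
proof -
  have [measurable]: "f \<in> borel_measurable M01"
    using assms by (simp add: on01_def)
  have "{x\<in>space M01. c < \<bar>f x\<bar>} \<in> sets M01" "{x\<in>space M01. c \<le> \<bar>f x\<bar>} \<in> sets M01"
    by measurable
  then show "{x\<in>{0..1}. c < \<bar>f x\<bar>} \<in> lmeasurable" "{x\<in>{0..1}. c \<le> \<bar>f x\<bar>} \<in> lmeasurable"
    unfolding space_M01 sets_M01_iff by (blast intro: lmeasurable_subset_01)+
qed

lemma rearr_le:
  assumes "0 \<le> c" "measure lebesgue {x\<in>{0..1}. c < \<bar>f x\<bar>} \<le> s"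
  shows "rearr f s \<le> c"
  unfolding rearr_def
proof (rule cInf_lower)
  show "c \<in> {c. 0 \<le> c \<and> measure lebesgue {x\<in>{0..1}. c < \<bar>f x\<bar>} \<le> s}"
    using assms by blast
  show "bdd_below {c. 0 \<le> c \<and> measure lebesgue {x\<in>{0..1}. c < \<bar>f x\<bar>} \<le> s}"
    by (rule bdd_belowI[of _ 0]) blast
qed

text \<open>A level set of measure at least \<open>t\<close> keeps the rearrangement at height
  \<open>c\<close> throughout (0,t). The limit of the measures of {n < \<bar>f\<bar>} serves to show
  that the infimum defining \<open>rearr\<close> is over a nonempty set: \<open>f\<close> is finite
  everywhere, so these sets decrease to the empty set.\<close>

lemma le_rearr:
  assumes f: "on01 f" and c: "t \<le> measure lebesgue {x\<in>{0..1}. c \<le> \<bar>f x\<bar>}" and s: "0 < s" "s < t"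
  shows "c \<le> rearr f s"
  unfolding rearr_def
proof (rule cInf_greatest)
  let ?A = "\<lambda>c. {x\<in>{0..1}. c < \<bar>f x\<bar>}"
  have "(\<lambda>n. measure lebesgue (?A (real n))) \<longlonglongrightarrow> measure lebesgue (\<Inter>n. ?A (real n))"
  proof (rule Lim_measure_decseq)
    show "decseq (\<lambda>n. ?A (real n))"
      by (force simp: decseq_def)
    show "range (\<lambda>n. ?A (real n)) \<subseteq> sets lebesgue"
      using level_set_measurable(1)[OF f] by (blast dest: fmeasurableD)
    show "emeasure lebesgue (?A (real n)) \<noteq> \<infinity>" for n
      unfolding infinity_ennreal_def by (rule fmeasurableD2[OF level_set_measurable(1)[OF f]])
  qed
  moreover have "(\<Inter>n. ?A (real n)) = {}"
  proof (intro equals0I)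
    fix x assume *: "x \<in> (\<Inter>n. ?A (real n))"
    obtain n where "\<bar>f x\<bar> \<le> real n" using real_arch_simple by blast
    moreover have "real n < \<bar>f x\<bar>" using * by blast
    ultimately show False by simp
  qed
  ultimately have "(\<lambda>n. measure lebesgue (?A (real n))) \<longlonglongrightarrow> 0"
    by (simp only: measure_empty)
  then have "\<forall>\<^sub>F n in sequentially. measure lebesgue (?A (real n)) < s"
    using s by (intro order_tendstoD)
  then obtain n where "measure lebesgue (?A (real n)) < s"
    using eventually_happens'[OF sequentially_bot] by blast
  then have "real n \<in> {c. 0 \<le> c \<and> measure lebesgue (?A c) \<le> s}"
    by (intro CollectI conjI of_nat_0_le_iff less_imp_le)
  then show "{c. 0 \<le> c \<and> measure lebesgue (?A c) \<le> s} \<noteq> {}" by blast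
next
  fix c' assume "c' \<in> {c. 0 \<le> c \<and> measure lebesgue {x\<in>{0..1}. c < \<bar>f x\<bar>} \<le> s}"
  then have c': "measure lebesgue {x\<in>{0..1}. c' < \<bar>f x\<bar>} \<le> s" by blast
  show "c \<le> c'"
  proof (rule ccontr)
    assume "\<not> c \<le> c'"
    then have "{x\<in>{0..1}. c \<le> \<bar>f x\<bar>} \<subseteq> {x\<in>{0..1}. c' < \<bar>f x\<bar>}" by auto
    then have "measure lebesgue {x\<in>{0..1}. c \<le> \<bar>f x\<bar>} \<le> measure lebesgue {x\<in>{0..1}. c' < \<bar>f x\<bar>}"
      by (rule measure_mono_fmeasurable[OF _ fmeasurableD[OF level_set_measurable(2)[OF f]] level_set_measurable(1)[OF f]])
    with c c' s show False by linarith
  qed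
qed

text \<open>What is used of the weight from here on: \<open>quasi\<close> is the form in which
  concavity enters, and \<open>power\<close> with \<alpha> < 1 is the quantitative form of the index
  condition.\<close>

locale index_weight =
  fixes \<phi> :: "real \<Rightarrow> real" and D \<alpha> :: real
  assumes mono: "\<And>s t. 0 \<le> s \<Longrightarrow> s \<le> t \<Longrightarrow> t \<le> 1 \<Longrightarrow> \<phi> s \<le> \<phi> t"
    and zero: "\<phi> 0 = 0"
    and pos: "\<And>t. 0 < t \<Longrightarrow> t \<le> 1 \<Longrightarrow> 0 < \<phi> t"
    and quasi: "\<And>s t. 0 < s \<Longrightarrow> s \<le> t \<Longrightarrow> t \<le> 1 \<Longrightarrow> \<phi> t / t \<le> \<phi> s / s"
    and lim: "(\<phi> \<longlongrightarrow> 0) (at_right 0)"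
    and \<alpha>: "0 \<le> \<alpha>" "\<alpha> < 1"
    and power: "\<And>u t. 0 < u \<Longrightarrow> u \<le> t \<Longrightarrow> t \<le> 1 \<Longrightarrow> \<phi> t \<le> D * (t / u) powr \<alpha> * \<phi> u"
begin

lemma D: "1 \<le> D"
  using power[of 1 1] pos[of 1] by simp

lemma nonneg: "0 \<le> t \<Longrightarrow> t \<le> 1 \<Longrightarrow> 0 \<le> \<phi> t"
  using pos[of t] zero by (cases "t = 0") auto

lemma small:
  assumes "0 < e" obtains d where "0 < d" "d \<le> 1" "\<And>t. 0 \<le> t \<Longrightarrow> t \<le> d \<Longrightarrow> \<phi> t < e"
proof -
  have "\<forall>\<^sub>F t in at_right 0. \<phi> t < e" using lim assms by (rule order_tendstoD)
  then obtain b where b: "0 < b" "\<And>t. 0 < t \<Longrightarrow> t < b \<Longrightarrow> \<phi> t < e"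
    by (auto simp: eventually_at_right[of 0 1])
  show thesis
  proof (rule that[of "min 1 (b/2)"])
    show "\<phi> t < e" if "0 \<le> t" "t \<le> min 1 (b / 2)" for t
      using b that assms zero by (cases "t = 0") auto
  qed (use b in auto)
qed

text \<open>The power bound between \<open>t\<close> and 1 gives t / \<phi> t \<le> D / \<phi> 1 * t
  powr (1 - \<alpha>), and the exponent is positive. This is what later makes mass very close to 0
  invisible at a fixed distance from 0.\<close>

lemma kappa_small:
  assumes "0 < e" obtains d where "0 < d" "d \<le> 1" "\<And>t. 0 < t \<Longrightarrow> t \<le> d \<Longrightarrow> t / \<phi> t < e"
proof -
  have "((\<lambda>t. D / \<phi> 1 * t powr (1 - \<alpha>)) \<longlongrightarrow> D / \<phi> 1 * 0 powr (1 - \<alpha>)) (at_right 0)"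
    using \<alpha> by (intro tendsto_intros) (auto simp: eventually_at_right_less intro: eventually_mono[OF eventually_at_right_less])
  then have "\<forall>\<^sub>F t in at_right 0. D / \<phi> 1 * t powr (1 - \<alpha>) < e"
    using assms by (intro order_tendstoD) auto
  then obtain b where b: "0 < b" "\<And>t. 0 < t \<Longrightarrow> t < b \<Longrightarrow> D / \<phi> 1 * t powr (1 - \<alpha>) < e"
    by (auto simp: eventually_at_right[of 0 1])
  show thesis
  proof (rule that[of "min 1 (b/2)"])
    show "t / \<phi> t < e" if t: "0 < t" "t \<le> min 1 (b / 2)" for t
    proof -
      have "\<phi> 1 \<le> D * (1 / t) powr \<alpha> * \<phi> t" using power[of t 1] t by simp
      then have "t / \<phi> t \<le> D / \<phi> 1 * (t * (1 / t) powr \<alpha>)"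
        using t pos[of t] pos[of 1] by (simp add: field_simps)
      also have "t * (1 / t) powr \<alpha> = t powr (1 - \<alpha>)"
        using t by (simp add: powr_diff powr_divide)
      also have "D / \<phi> 1 * \<dots> < e" using b t by simp
      finally show ?thesis .
    qed
  qed (use b in auto)
qed

text \<open>The loss in passing from \<open>psi\<close> times F to the Marcinkiewicz norm: 4 from
  \<phi> s \<le> 4 * \<phi> (s / 4), \<open>D\<close> from the power bound, 1 / (1 - \<alpha>) from
  integrating s powr (- \<alpha>).\<close>

definition C where "C = 4 * D / (1 - \<alpha>)"

lemma C_pos: "0 < C"
  using D \<alpha> by (simp add: C_def)

text \<open>This says that 1 / \<phi> (s / 4) has Marcinkiewicz norm at most \<open>C\<close>, and
  it is where the index condition is decisive: the power bound dominates the integrand by a multiple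
  of s powr (- \<alpha>), which is integrable at 0 because \<alpha> < 1.\<close>

lemma nn_integral_inverse_le:
  assumes t: "0 < t" "t \<le> 1" and e: "0 \<le> e"
  shows "(\<integral>\<^sup>+ s\<in>{0..t}. ennreal (e / \<phi> (s / 4)) \<partial>lebesgue) \<le> ennreal (C * e * t / \<phi> t)"
proof -
  let ?g = "\<lambda>s. 4 * D * e * t powr \<alpha> / \<phi> t * s powr (- \<alpha>)"
  have le: "e / \<phi> (s / 4) \<le> ?g s" if s: "0 \<le> s" "s \<le> t" for s
  proof (cases "s = 0")
    case False
    then have "0 < s" using s by simp
    have p: "0 < \<phi> (s/4)" "0 < \<phi> s" "0 < \<phi> t" using \<open>0 < s\<close> s t by (auto intro!: pos)
    have "\<phi> s / s \<le> \<phi> (s/4) / (s/4)" using \<open>0 < s\<close> s t by (intro quasi) auto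
    then have "\<phi> s \<le> 4 * \<phi> (s / 4)" using \<open>0 < s\<close> by (simp add: field_simps)
    have "\<phi> t \<le> D * (t / s) powr \<alpha> * \<phi> s" using power \<open>0 < s\<close> s t by simp
    also have "\<dots> \<le> D * (t / s) powr \<alpha> * (4 * \<phi> (s / 4))"
      using \<open>\<phi> s \<le> 4 * \<phi> (s / 4)\<close> D by (intro mult_left_mono) auto
    finally have "1 / \<phi> (s / 4) \<le> 4 * D * (t / s) powr \<alpha> / \<phi> t"
      using p by (simp add: field_simps)
    then have "e * (1 / \<phi> (s / 4)) \<le> e * (4 * D * (t / s) powr \<alpha> / \<phi> t)"
      using e by (rule mult_left_mono)
    moreover have "(t / s) powr \<alpha> = t powr \<alpha> * s powr (- \<alpha>)"
      using \<open>0 < s\<close> t by (simp add: powr_divide powr_minus_divide)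
    ultimately show ?thesis by (simp add: mult_ac)
  \<comment> \<open>At s = 0 both sides are 0, by division by zero on the left and
    \<open>0 powr (- \<alpha>) = 0\<close> on the right.\<close>
  qed (simp add: zero)
  have "((\<lambda>s. s powr (-\<alpha>)) has_integral (t powr (-\<alpha> + 1) / (-\<alpha> + 1))) {0..t}"
    using \<alpha> t by (intro has_integral_powr_from_0) auto
  then have I: "(?g has_integral (4 * D * e * t powr \<alpha> / \<phi> t * (t powr (-\<alpha> + 1) / (-\<alpha> + 1)))) {0..t}"
    by (rule has_integral_mult_right)
  have "(\<integral>\<^sup>+ s\<in>{0..t}. ennreal (e / \<phi> (s / 4)) \<partial>lebesgue) \<le> (\<integral>\<^sup>+ s. ennreal (indicator {0..t} s * ?g s) \<partial>lebesgue)"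
  proof (rule nn_integral_mono)
    fix s show "ennreal (e / \<phi> (s / 4)) * indicator {0..t} s \<le> ennreal (indicator {0..t} s * ?g s)"
      using le[of s] by (cases "s \<in> {0..t}") (auto intro: ennreal_leI)
  qed
  also have "\<dots> = (\<integral>\<^sup>+ s. ennreal (indicator {0..t} s * ?g s) \<partial>lborel)"
    by (rule nn_integral_completion)
  also have "\<dots> = ennreal (4 * D * e * t powr \<alpha> / \<phi> t * (t powr (-\<alpha> + 1) / (-\<alpha> + 1)))"
    using pos[of t] t D e by (intro nn_integral_has_integral_lebesgue[OF _ I]) auto
  also have "4 * D * e * t powr \<alpha> / \<phi> t * (t powr (-\<alpha> + 1) / (-\<alpha> + 1)) = C * e * t / \<phi> t"
  proof -
    have "t powr \<alpha> * t powr (-\<alpha> + 1) = t" using t by (simp flip: powr_add)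
    then have "4 * D * e * t powr \<alpha> / \<phi> t * (t powr (-\<alpha> + 1) / (-\<alpha> + 1)) = 4 * D * e / \<phi> t * t / (-\<alpha> + 1)"
      by (metis (no_types, opaque_lifting) mult.assoc times_divide_eq_left times_divide_eq_right)
    then show ?thesis by (simp add: C_def mult_ac)
  qed
  finally show ?thesis .
qed

text \<open>For s / 4 < x < 1 - s / 4 the minimum in the first alternative is at least \<phi> (s /
  4). Hence, off \<open>A\<close>, the values above e / \<phi> (s / 4) occur only in two end
  intervals of total length s / 2. The remaining s / 2 is room for the set \<open>A\<close>, whose
  values up to \<open>B\<close> therefore matter only for s < 2 m(A). With \<open>A\<close> empty
  this bounds norms; with m(A) tending to 0 it gives order continuity.\<close>

lemma Mnorm_le:
  assumes f: "on01 f" and A: "A \<in> sets lebesgue" "A \<subseteq> {0..1}" and e: "0 \<le> e" and B: "0 \<le> B"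
    and le: "\<And>x. 0 < x \<Longrightarrow> x < 1 \<Longrightarrow> \<bar>f x\<bar> \<le> e / min (\<phi> x) (\<phi> (1 - x)) \<or> x \<in> A \<and> \<bar>f x\<bar> \<le> B"
  shows "Mnorm \<phi> f \<le> ennreal (C * e + B * \<phi> (min 1 (2 * measure lebesgue A)))"
proof -
  define m where "m = measure lebesgue A"
  have m0: "0 \<le> m" by (simp add: m_def)
  have Al: "A \<in> lmeasurable"
    by (rule lmeasurable_subset_01[OF A])
  have r: "rearr f s \<le> e / \<phi> (s / 4) + B * indicator {0..<2 * m} s" if s: "0 < s" "s \<le> 1" for s
  proof (rule rearr_le)
    let ?L = "{x\<in>{0..1}. e / \<phi> (s / 4) + B * indicator {0..<2 * m} s < \<bar>f x\<bar>}"
    have p4: "0 < \<phi> (s / 4)" using s by (intro pos) auto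
    show c0: "0 \<le> e / \<phi> (s / 4) + B * indicator {0..<2 * m} s" using p4 e B by (auto simp: indicator_def)
    let ?U = "{0..s/4} \<union> {1 - s/4..1}"
    \<comment> \<open>If s < 2 * m, the threshold already contains \<open>B\<close> and
      \<open>A\<close> contributes nothing; otherwise \<open>A\<close> itself has measure at most s
      / 2.\<close>
    let ?V = "if s < 2 * m then {} else A"
    have sub: "?L \<subseteq> ?U \<union> ?V"
    proof
      fix x assume x: "x \<in> ?L"
      show "x \<in> ?U \<union> ?V"
      proof (rule ccontr)
        assume n: "x \<notin> ?U \<union> ?V"
        with x s have x': "s/4 < x" "x < 1 - s/4" "0 < x" "x < 1" by auto
        then have "\<phi> (s/4) \<le> min (\<phi> x) (\<phi> (1 - x))" using s by (auto intro!: mono)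
        then have "e / min (\<phi> x) (\<phi> (1 - x)) \<le> e / \<phi> (s/4)"
          using e p4 by (intro divide_left_mono) auto
        moreover have "0 \<le> B * indicator {0..<2 * m} s" "0 \<le> e / \<phi> (s/4)" using B e p4 by (auto simp: indicator_def)
        ultimately have "x \<in> A \<and> \<bar>f x\<bar> \<le> B" using le[OF x'(3,4)] x by auto
        with n have "s < 2 * m" by (auto split: if_splits)
        with x s \<open>x \<in> A \<and> \<bar>f x\<bar> \<le> B\<close> \<open>0 \<le> e / \<phi> (s/4)\<close> show False by auto
      qed
    qed
    have "measure lebesgue ?L \<le> measure lebesgue (?U \<union> ?V)"
    proof (rule measure_mono_fmeasurable[OF sub])
      show "?L \<in> sets lebesgue"
        using level_set_measurable(1)[OF f] by (rule fmeasurableD)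
      show "?U \<union> ?V \<in> lmeasurable"
        using Al by (intro fmeasurable.Un) auto
    qed
    also have "\<dots> \<le> s"
    proof -
      have "measure lebesgue (?U \<union> ?V) \<le> measure lebesgue ?U + measure lebesgue ?V"
        using A by (intro measure_Un_le) auto
      moreover have "measure lebesgue ?U \<le> measure lebesgue {0..s/4} + measure lebesgue {1 - s/4..1}"
        by (intro measure_Un_le) auto
      moreover have "measure lebesgue {0..s/4} + measure lebesgue {1 - s/4..1} = s / 2" using s by simp
      moreover have "measure lebesgue ?V \<le> s / 2" using s by (auto simp: m_def)
      ultimately show ?thesis by linarith
    qed
    finally show "measure lebesgue ?L \<le> s" .
  qed
  show ?thesis
    unfolding Mnorm_def
  proof (rule SUP_least)
    fix t :: real assume "t \<in> {0<..1}"
    then have t: "0 < t" "t \<le> 1" by auto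
    let ?I = "\<integral>\<^sup>+ s\<in>{0..t}. ennreal (rearr f s) \<partial>lebesgue"
    have pt: "0 < \<phi> t" using pos t by simp
    have "?I
      \<le> (\<integral>\<^sup>+ s. ennreal (e / \<phi> (s / 4)) * indicator {0..t} s + ennreal B * indicator {0..min t (2 * m)} s \<partial>lebesgue)"
    proof (rule nn_integral_mono_AE)
      have "AE s in lebesgue. s \<noteq> (0::real)"
        by (intro AE_completion AE_lborel_singleton)
      then show "AE s in lebesgue. ennreal (rearr f s) * indicator {0..t} s
        \<le> ennreal (e / \<phi> (s / 4)) * indicator {0..t} s + ennreal B * indicator {0..min t (2 * m)} s"
      proof eventually_elim
        case (elim s)
        show ?case
        proof (cases "s \<in> {0..t}")
          case True
          with elim t have s: "0 < s" "s \<le> 1" by auto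
          then have p4: "0 < \<phi> (s / 4)" by (intro pos) auto
          have "ennreal (rearr f s) \<le> ennreal (e / \<phi> (s / 4) + B * indicator {0..<2 * m} s)"
            by (intro ennreal_leI r s)
          also have "\<dots> = ennreal (e / \<phi> (s / 4)) + ennreal (B * indicator {0..<2 * m} s)"
            using e p4 B by (intro ennreal_plus) (auto simp: indicator_def)
          also have "\<dots> \<le> ennreal (e / \<phi> (s / 4)) + ennreal B * indicator {0..min t (2 * m)} s"
            using True by (intro add_left_mono) (auto simp: indicator_def)
          finally show ?thesis using True by simp
        qed simp
      qed
    qed
    also have "\<dots> = (\<integral>\<^sup>+ s\<in>{0..t}. ennreal (e / \<phi> (s / 4)) \<partial>lebesgue) + (\<integral>\<^sup>+ s. ennreal B * indicator {0..min t (2 * m)} s \<partial>lebesgue)"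
    proof (rule nn_integral_add)
      \<comment> \<open>Nothing is known of \<phi> outside [0,1], so measurability is derived for a
        cut-off version. The two integrands agree since t \<le> 1 and \<phi> 0 = 0.\<close>
      have "mono_on {0<..1} \<phi>" by (auto simp: mono_on_def intro: mono)
      then have "\<phi> \<in> borel_measurable (restrict_space borel {0<..1})" by (rule borel_measurable_mono_on_fnc)
      then have [measurable]: "(\<lambda>x. indicator {0<..1} x * \<phi> x) \<in> borel_measurable borel"
        by (subst (asm) borel_measurable_restrict_space_iff) auto
      have "(\<lambda>s. ennreal (e / (indicator {0<..1} (s/4) * \<phi> (s / 4))) * indicator {0..t} s) \<in> borel_measurable lborel"
        by measurable
      then have "(\<lambda>s. ennreal (e / (indicator {0<..1} (s/4) * \<phi> (s / 4))) * indicator {0..t} s) \<in> borel_measurable lebesgue"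
        by (rule measurable_completion)
      also have "(\<lambda>s. ennreal (e / (indicator {0<..1} (s/4) * \<phi> (s / 4))) * indicator {0..t} s) = (\<lambda>s. ennreal (e / \<phi> (s / 4)) * indicator {0..t} s)"
        using t by (auto simp: fun_eq_iff indicator_def zero)
      finally show "(\<lambda>s. ennreal (e / \<phi> (s / 4)) * indicator {0..t} s) \<in> borel_measurable lebesgue" .
    qed (auto intro!: measurable_completion)
    also have "(\<integral>\<^sup>+ s. ennreal B * indicator {0..min t (2 * m)} s \<partial>lebesgue) = ennreal (B * min t (2 * m))"
      using B t m0 by (subst nn_integral_cmult_indicator) (auto simp: ennreal_mult)
    also have "(\<integral>\<^sup>+ s\<in>{0..t}. ennreal (e / \<phi> (s / 4)) \<partial>lebesgue) + ennreal (B * min t (2 * m))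
       \<le> ennreal (C * e * t / \<phi> t) + ennreal (B * min t (2 * m))"
      by (intro add_right_mono nn_integral_inverse_le t e)
    also have "\<dots> = ennreal (C * e * t / \<phi> t + B * min t (2 * m))"
      using B t m0 e pt C_pos by (intro ennreal_plus[symmetric]) auto
    finally have I: "?I
      \<le> ennreal (C * e * t / \<phi> t + B * min t (2 * m))" .
    have II: "\<phi> t / t * min t (2 * m) \<le> \<phi> (min 1 (2 * m))"
    proof (cases "t \<le> 2 * m")
      case True
      then show ?thesis using t by (auto intro!: mono)
    next
      case False
      show ?thesis
      proof (cases "m = 0")
        case False
        then have "\<phi> t / t \<le> \<phi> (2 * m) / (2 * m)" using \<open>\<not> t \<le> 2 * m\<close> t m0 by (intro quasi) auto
        then show ?thesis using False \<open>\<not> t \<le> 2 * m\<close> t m0 by (simp add: field_simps min_def)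
      qed (use zero t in auto)
    qed
    have "ennreal (\<phi> t / t) * ?I
      \<le> ennreal (\<phi> t / t) * ennreal (C * e * t / \<phi> t + B * min t (2 * m))"
      by (intro mult_left_mono I) auto
    also have "\<dots> = ennreal (\<phi> t / t * (C * e * t / \<phi> t + B * min t (2 * m)))"
      using B t m0 e pt C_pos by (intro ennreal_mult[symmetric]) auto
    also have "\<phi> t / t * (C * e * t / \<phi> t + B * min t (2 * m)) = C * e + B * (\<phi> t / t * min t (2 * m))"
      using t pt by (simp add: field_simps)
    also have "ennreal \<dots> \<le> ennreal (C * e + B * \<phi> (min 1 (2 * m)))"
      by (intro ennreal_leI add_left_mono mult_left_mono II B)
    finally show "ennreal (\<phi> t / t) * ?I
      \<le> ennreal (C * e + B * \<phi> (min 1 (2 * measure lebesgue A)))"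
      unfolding m_def .
  qed
qed

text \<open>The rearrangement is at least \<open>c\<close> on (0,t), so the term of the supremum
  that belongs to \<open>t\<close> itself is at least \<phi> t / t * (c * t).\<close>

lemma le_Mnorm:
  assumes f: "on01 f" and t: "0 < t" "t \<le> 1" and c: "0 \<le> c" "t \<le> measure lebesgue {x\<in>{0..1}. c \<le> \<bar>f x\<bar>}"
  shows "ennreal (c * \<phi> t) \<le> Mnorm \<phi> f"
proof -
  have "ennreal c * ennreal t = (\<integral>\<^sup>+ s. ennreal c * indicator {0..t} s \<partial>lebesgue)"
    using t by (subst nn_integral_cmult_indicator) auto
  also have "\<dots> \<le> (\<integral>\<^sup>+ s\<in>{0..t}. ennreal (rearr f s) \<partial>lebesgue)"
  proof (rule nn_integral_mono_AE)
    have "AE s in lebesgue. s \<noteq> (0::real)" "AE s in lebesgue. s \<noteq> t"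
      by (intro AE_completion AE_lborel_singleton)+
    then show "AE s in lebesgue. ennreal c * indicator {0..t} s \<le> ennreal (rearr f s) * indicator {0..t} s"
    proof eventually_elim
      case (elim s)
      then show ?case using le_rearr[OF f c(2), of s] by (auto simp: indicator_def intro!: ennreal_leI)
    qed
  qed
  finally have I: "ennreal c * ennreal t \<le> (\<integral>\<^sup>+ s\<in>{0..t}. ennreal (rearr f s) \<partial>lebesgue)" .
  have "c * \<phi> t = \<phi> t / t * (c * t)" using t by simp
  then have "ennreal (c * \<phi> t) = ennreal (\<phi> t / t) * (ennreal c * ennreal t)"
    using t c pos[of t] by (simp only: ennreal_mult divide_nonneg_pos mult_nonneg_nonneg less_imp_le)
  also have "\<dots> \<le> ennreal (\<phi> t / t) * (\<integral>\<^sup>+ s\<in>{0..t}. ennreal (rearr f s) \<partial>lebesgue)"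
    by (intro mult_left_mono I) simp
  also have "\<dots> \<le> Mnorm \<phi> f"
    unfolding Mnorm_def using t by (intro SUP_upper) auto
  finally show ?thesis .
qed

end

section \<open>A local description of the Cesaro space\<close>

text \<open>As a Bochner integral this is 0 when \<open>f\<close> is not integrable on [0,x]. For
  functions of the space that can happen at x = 1, hence the restriction to x < 1 in what
  follows.\<close>

definition cum :: "(real \<Rightarrow> real) \<Rightarrow> real \<Rightarrow> real" where
  "cum f x = (\<integral>t. indicator {0..x} t * \<bar>f t\<bar> \<partial>M01)"

definition locint :: "(real \<Rightarrow> real) \<Rightarrow> bool" where
  "locint f \<longleftrightarrow> on01 f \<and> (\<forall>x. 0 < x \<longrightarrow> x < 1 \<longrightarrow> integrable M01 (\<lambda>t. indicator {0..x} t * \<bar>f t\<bar>))"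

lemma finite_M01: "finite_measure M01"
  by (intro finite_measureI) (simp add: space_restrict_space emeasure_restrict_space)

lemma indicator_ivl_measurable_M01 [measurable]:
  fixes a b :: real
  shows "(indicator {a..b} :: real \<Rightarrow> real) \<in> borel_measurable M01"
    "(indicator (- {a..b}) :: real \<Rightarrow> real) \<in> borel_measurable M01"
  by (auto intro!: measurable_restrict_space1 measurable_completion)

lemma id_measurable_M01 [measurable]: "(\<lambda>t::real. t) \<in> borel_measurable M01"
  by (auto intro!: measurable_restrict_space1 measurable_completion)

lemma AE_M01: "AE t in M01. 0 < t \<and> t < 1"
proof -
  have "AE t in lebesgue. t \<noteq> (0::real)" "AE t in lebesgue. t \<noteq> (1::real)"
    by (intro AE_completion AE_lborel_singleton)+
  then have "AE t in lebesgue. t \<in> {0..1} \<longrightarrow> 0 < t \<and> t < (1::real)" by eventually_elim auto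
  moreover have "{0..1} \<inter> space lebesgue \<in> sets (lebesgue :: real measure)" by simp
  ultimately show ?thesis by (intro iffD2[OF AE_restrict_space_iff])
qed

lemma nn_integral_M01_ivl:
  assumes "x \<le> 1"
  shows "(\<integral>\<^sup>+ t\<in>{0..x}. ennreal \<bar>f t\<bar> \<partial>lebesgue) = (\<integral>\<^sup>+ t. ennreal (indicator {0..x} t * \<bar>f t\<bar>) \<partial>M01)"
  using assms by (subst nn_integral_restrict_space) (auto intro!: nn_integral_cong simp: indicator_def)

text \<open>No integrability is required: for an infinite integral both \<open>enn2real\<close> and
  the Bochner integral give 0.\<close>

lemma Ces_abs_eq:
  assumes "on01 f" "0 < x" "x \<le> 1"
  shows "Ces_abs f x = cum f x / x"
proof -
  have [measurable]: "f \<in> borel_measurable M01" using assms by (simp add: on01_def)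
  show ?thesis
    unfolding Ces_abs_def cum_def using assms
    by (subst integral_eq_nn_integral) (auto simp: nn_integral_M01_ivl)
qed

lemma locint_iff:
  assumes "on01 f"
  shows "locint f \<longleftrightarrow> (\<forall>x\<in>{0<..<1}. (\<integral>\<^sup>+ t\<in>{0..x}. ennreal \<bar>f t\<bar> \<partial>lebesgue) < \<infinity>)"
proof -
  have [measurable]: "f \<in> borel_measurable M01" using assms by (simp add: on01_def)
  have "integrable M01 (\<lambda>t. indicator {0..x} t * \<bar>f t\<bar>) \<longleftrightarrow> (\<integral>\<^sup>+ t\<in>{0..x}. ennreal \<bar>f t\<bar> \<partial>lebesgue) < \<infinity>"
    if "x < 1" for x
    using that by (subst integrable_iff_bounded) (auto simp: nn_integral_M01_ivl abs_mult)
  then show ?thesis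
    using assms by (auto simp: locint_def)
qed

lemma locintD:
  assumes "locint f"
  shows "on01 f" "f \<in> borel_measurable M01"
    "x < 1 \<Longrightarrow> integrable M01 (\<lambda>t. indicator {0..x} t * \<bar>f t\<bar>)"
proof -
  show f: "on01 f" "f \<in> borel_measurable M01"
    using assms by (auto simp: locint_def on01_def)
  note [measurable] = f(2)
  assume x: "x < 1"
  have "integrable M01 (\<lambda>t. indicator {0..max x (1/2)} t * \<bar>f t\<bar>)"
    using assms x by (auto simp: locint_def)
  then show "integrable M01 (\<lambda>t. indicator {0..x} t * \<bar>f t\<bar>)"
    by (rule Bochner_Integration.integrable_bound) (auto simp: indicator_def)
qed

text \<open>Allows e / (K + 1) as a tolerance for a factor K that may vanish.\<close>

lemma weighted_frac_le:
  fixes e K :: real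
  assumes "0 < e" "0 \<le> K"
  shows "K * (e / (K + 1)) \<le> e"
proof -
  have "K * (e / (K + 1)) \<le> (K + 1) * (e / (K + 1))" using assms by (intro mult_right_mono) auto
  also have "\<dots> = e" using assms by simp
  finally show ?thesis .
qed

lemma cum_nonneg: "0 \<le> cum f x"
  unfolding cum_def by (rule integral_nonneg_AE) (auto simp: indicator_def)

lemma cum_mono:
  assumes "locint f" "x \<le> y" "y < 1"
  shows "cum f x \<le> cum f y"
  unfolding cum_def using assms
  by (intro integral_mono locintD) (auto simp: indicator_def)

lemma cum_eq_of_zero:
  assumes "x \<le> y" "\<And>t. x < t \<Longrightarrow> t \<le> y \<Longrightarrow> 0 \<le> t \<Longrightarrow> t \<le> 1 \<Longrightarrow> f t = 0"
  shows "cum f y = cum f x"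
  unfolding cum_def
  by (rule Bochner_Integration.integral_cong) (use assms in \<open>auto simp: indicator_def space_M01 not_le\<close>)

lemma locint_lincomb:
  assumes "locint f" "locint g"
  shows "locint (\<lambda>t. a * f t + b * g t)"
    and "x < 1 \<Longrightarrow> cum (\<lambda>t. a * f t + b * g t) x \<le> \<bar>a\<bar> * cum f x + \<bar>b\<bar> * cum g x"
proof -
  note [measurable] = locintD(2)[OF assms(1)] locintD(2)[OF assms(2)]
  have le: "indicator {0..x} t * \<bar>a * f t + b * g t\<bar> \<le> \<bar>a\<bar> * (indicator {0..x} t * \<bar>f t\<bar>) + \<bar>b\<bar> * (indicator {0..x} t * \<bar>g t\<bar>)" for x t :: real
    using abs_triangle_ineq[of "a * f t" "b * g t"] by (auto simp: indicator_def abs_mult)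
  have int: "integrable M01 (\<lambda>t. \<bar>a\<bar> * (indicator {0..x} t * \<bar>f t\<bar>) + \<bar>b\<bar> * (indicator {0..x} t * \<bar>g t\<bar>))" if "x < 1" for x
    using that assms by (intro Bochner_Integration.integrable_add integrable_mult_right locintD)
  have int': "integrable M01 (\<lambda>t. indicator {0..x} t * \<bar>a * f t + b * g t\<bar>)" if "x < 1" for x
  proof (rule Bochner_Integration.integrable_bound[OF int[OF that]])
    have "norm (indicator {0..x} t * \<bar>a * f t + b * g t\<bar>) \<le> norm (\<bar>a\<bar> * (indicator {0..x} t * \<bar>f t\<bar>) + \<bar>b\<bar> * (indicator {0..x} t * \<bar>g t\<bar>))" for t
    proof -
      have "norm (indicator {0..x} t * \<bar>a * f t + b * g t\<bar>) = indicator {0..x} t * \<bar>a * f t + b * g t\<bar>"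
        by (simp add: indicator_def)
      with le[of x t] show ?thesis by (metis abs_ge_self order_trans real_norm_def)
    qed
    then show "AE t in M01. norm (indicator {0..x} t * \<bar>a * f t + b * g t\<bar>) \<le> norm (\<bar>a\<bar> * (indicator {0..x} t * \<bar>f t\<bar>) + \<bar>b\<bar> * (indicator {0..x} t * \<bar>g t\<bar>))"
      by (intro AE_I2)
  qed measurable
  then show "locint (\<lambda>t. a * f t + b * g t)"
    by (auto simp: locint_def on01_def)
  assume x: "x < 1"
  have "cum (\<lambda>t. a * f t + b * g t) x \<le> (\<integral>t. \<bar>a\<bar> * (indicator {0..x} t * \<bar>f t\<bar>) + \<bar>b\<bar> * (indicator {0..x} t * \<bar>g t\<bar>) \<partial>M01)"
    unfolding cum_def by (intro integral_mono int int' x le)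
  also have "\<dots> = \<bar>a\<bar> * cum f x + \<bar>b\<bar> * cum g x"
    unfolding cum_def using x assms
    by (subst Bochner_Integration.integral_add) (auto intro!: integrable_mult_right locintD)
  finally show "cum (\<lambda>t. a * f t + b * g t) x \<le> \<bar>a\<bar> * cum f x + \<bar>b\<bar> * cum g x" .
qed

lemma locint_solid:
  assumes f: "locint f" and g: "on01 g" and le: "\<And>t. 0 \<le> t \<Longrightarrow> t \<le> 1 \<Longrightarrow> \<bar>g t\<bar> \<le> \<bar>f t\<bar>"
  shows "locint g" and "x < 1 \<Longrightarrow> cum g x \<le> cum f x"
proof -
  note [measurable] = locintD(2)[OF f]
  have [measurable]: "g \<in> borel_measurable M01" using g by (simp add: on01_def)
  have "integrable M01 (\<lambda>t. indicator {0..x} t * \<bar>g t\<bar>)" if "x < 1" for x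
    by (rule Bochner_Integration.integrable_bound[OF locintD(3)[OF f that]])
      (auto intro!: AE_I2 simp: le space_restrict_space indicator_def)
  then show 1: "locint g" using g by (auto simp: locint_def)
  show "cum g x \<le> cum f x" if "x < 1"
    unfolding cum_def using that
    by (intro integral_mono locintD 1 f) (auto simp: le space_restrict_space indicator_def)
qed

text \<open>F is increasing on (0,1) and therefore Borel there. The point 1, where F may drop to its
  default value, is added by hand.\<close>

lemma on01_Ces_abs:
  assumes f: "locint f"
  shows "on01 (Ces_abs f)"
proof -
  have "mono_on {0<..<1} (cum f)"
    by (auto simp: mono_on_def intro: cum_mono f)
  then have "cum f \<in> borel_measurable (restrict_space borel {0<..<1})"
    by (rule borel_measurable_mono_on_fnc)
  then have [measurable]: "(\<lambda>x. indicator {0<..<1} x * cum f x) \<in> borel_measurable borel"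
    by (subst (asm) borel_measurable_restrict_space_iff) auto
  have "(\<lambda>x. indicator {0<..<1} x * cum f x / x + indicator {1} x * cum f 1) \<in> borel_measurable borel"
    by measurable
  then have "(\<lambda>x. indicator {0<..<1} x * cum f x / x + indicator {1} x * cum f 1) \<in> borel_measurable M01"
    by (intro measurable_restrict_space1 measurable_completion) simp
  also have "(\<lambda>x. indicator {0<..<1} x * cum f x / x + indicator {1} x * cum f 1) = Ces_abs f"
  proof
    fix x show "indicator {0<..<1} x * cum f x / x + indicator {1} x * cum f 1 = Ces_abs f x"
      using Ces_abs_eq[OF locintD(1)[OF f], of x] by (auto simp: indicator_def Ces_abs_def)
  qed
  finally show ?thesis by (simp add: on01_def)
qed

lemma tendsto_zero_ennrealI:
  fixes g :: "nat \<Rightarrow> ennreal"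
  assumes "\<And>e. 0 < e \<Longrightarrow> \<forall>\<^sub>F n in F. g n \<le> ennreal e"
  shows "(g \<longlongrightarrow> 0) F"
proof (rule order_tendstoI)
  fix a :: ennreal assume "0 < a"
  then obtain b where b: "0 < b" "b < a" using dense by blast
  then obtain e where "b = ennreal e" "0 < e"
    by (cases b) auto
  with assms[of e] b show "\<forall>\<^sub>F n in F. g n < a"
    by (auto elim: eventually_mono)
qed simp

section \<open>Membership and norm in terms of \<open>psi\<close> times F\<close>

context index_weight
begin

definition psi where "psi x = min (\<phi> x) (\<phi> (1 - x)) / x"

lemma psi_pos: "0 < x \<Longrightarrow> x < 1 \<Longrightarrow> 0 < psi x"
  using pos[of x] pos[of "1 - x"] by (simp add: psi_def)

definition vanishing where
  "vanishing f \<longleftrightarrow> (\<forall>e>0. \<exists>a>0. \<forall>x. 0 < x \<longrightarrow> x < 1 \<longrightarrow> x < a \<or> 1 - a < x \<longrightarrow> psi x * cum f x \<le> e)"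

lemma Ces_abs_le_iff:
  assumes "on01 f" "0 < x" "x < 1"
  shows "\<bar>Ces_abs f x\<bar> \<le> e / min (\<phi> x) (\<phi> (1 - x)) \<longleftrightarrow> psi x * cum f x \<le> e"
proof -
  have "0 < min (\<phi> x) (\<phi> (1 - x))" using assms pos[of x] pos[of "1 - x"] by simp
  then show ?thesis
    using assms cum_nonneg[of f x] by (simp add: Ces_abs_eq psi_def abs_of_nonneg field_simps)
qed

text \<open>Near the endpoints the first alternative is the smallness of \<open>psi\<close> times F;
  in between, the Cesaro mean is bounded because F x / x is at most F (1 - a) / a. This is the
  dichotomy that \<open>Mnorm_le\<close> asks for.\<close>

lemma vanishing_split:
  assumes f: "locint f" "vanishing f" and e: "0 < e"
  obtains B where "0 \<le> B" "\<And>x. 0 < x \<Longrightarrow> x < 1 \<Longrightarrow> \<bar>Ces_abs f x\<bar> \<le> e / min (\<phi> x) (\<phi> (1 - x)) \<or> \<bar>Ces_abs f x\<bar> \<le> B"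
proof -
  obtain a0 where a0: "a0 > 0" "\<And>x. 0 < x \<Longrightarrow> x < 1 \<Longrightarrow> x < a0 \<or> 1 - a0 < x \<Longrightarrow> psi x * cum f x \<le> e"
    using f(2) e unfolding vanishing_def by blast
  define a where "a = min a0 (1/3)"
  have a: "0 < a" "a < 1" "a \<le> a0" using a0 by (auto simp: a_def)
  show thesis
  proof (rule that[of "cum f (1 - a) / a"])
    show "0 \<le> cum f (1 - a) / a" using a cum_nonneg by simp
    fix x :: real assume x: "0 < x" "x < 1"
    show "\<bar>Ces_abs f x\<bar> \<le> e / min (\<phi> x) (\<phi> (1 - x)) \<or> \<bar>Ces_abs f x\<bar> \<le> cum f (1 - a) / a"
    proof (cases "x < a0 \<or> 1 - a0 < x")
      case True
      then show ?thesis using Ces_abs_le_iff[OF locintD(1)[OF f(1)] x] a0(2)[OF x] by blast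
    next
      case False
      then have "a \<le> x" "x \<le> 1 - a" using a by auto
      then have "cum f x / x \<le> cum f (1 - a) / a"
        using a x cum_nonneg by (intro frac_le cum_mono f) auto
      then show ?thesis using x cum_nonneg[of f x] by (simp add: Ces_abs_eq[OF locintD(1)[OF f(1)]])
    qed
  qed
qed

text \<open>Since F increases, the Cesaro mean is at least F x / (2 x) on [x,2x) and at least F x on
  [x,1). These rectangles have norm at least F x * \<phi> x / (2 x) and F x * \<phi> (1 - x), and
  for x \<ge> 1/2 the latter also costs a factor of at most 2. The set \<open>A\<close> is carried
  along so that the bound can be applied to shrinking neighbourhoods of the endpoints.\<close>

lemma Mnorm_Ces_lower:
  assumes f: "locint f" and A: "A \<in> sets M01" and x: "0 < x" "x < 1"
    and sub: "x \<le> 1/2 \<and> {x..<2*x} \<subseteq> A \<or> 1/2 \<le> x \<and> {x..<1} \<subseteq> A"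
  shows "ennreal (psi x * cum f x) \<le> 2 * Mnorm \<phi> (\<lambda>u. indicator A u * Ces_abs f u)"
proof -
  let ?h = "\<lambda>u. indicator A u * Ces_abs f u"
  have [measurable]: "Ces_abs f \<in> borel_measurable M01"
    using on01_Ces_abs[OF f] by (simp add: on01_def)
  have h: "on01 ?h" unfolding on01_def using A by measurable
  define t c where "t = (if x \<le> 1/2 \<and> {x..<2*x} \<subseteq> A then x else 1 - x)"
    and "c = cum f x / (if x \<le> 1/2 \<and> {x..<2*x} \<subseteq> A then 2 * x else 1)"
  define J where "J = (if x \<le> 1/2 \<and> {x..<2*x} \<subseteq> A then {x..<2*x} else {x..<1})"
  have J: "J \<subseteq> A" "J \<subseteq> {x..<1}" using sub x by (auto simp: J_def)
  have mJ: "J \<in> sets lebesgue" "measure lebesgue J = t" using x by (auto simp: J_def t_def)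
  have ge: "c \<le> ?h u" if "u \<in> J" for u
  proof -
    have u: "x \<le> u" "u < 1" "u \<in> A" using that J by auto
    then have "cum f x \<le> cum f u" by (intro cum_mono f)
    have "c \<le> cum f x / u"
      unfolding c_def using that x u cum_nonneg[of f x] by (intro divide_left_mono) (auto simp: J_def split: if_splits)
    also have "\<dots> \<le> cum f u / u" using \<open>cum f x \<le> cum f u\<close> u x by (intro divide_right_mono) auto
    finally show ?thesis using u x by (simp add: Ces_abs_eq[OF locintD(1)[OF f]])
  qed
  have "0 \<le> c" using cum_nonneg[of f x] x by (auto simp: c_def)
  have "ennreal (c * \<phi> t) \<le> Mnorm \<phi> ?h"
  proof (rule le_Mnorm[OF h])
    show "0 < t" "t \<le> 1" "0 \<le> c" using x \<open>0 \<le> c\<close> by (auto simp: t_def)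
    have "J \<subseteq> {u\<in>{0..1}. c \<le> \<bar>?h u\<bar>}"
      using ge J x by force
    then have "measure lebesgue J \<le> measure lebesgue {u\<in>{0..1}. c \<le> \<bar>?h u\<bar>}"
      by (rule measure_mono_fmeasurable[OF _ mJ(1) level_set_measurable(2)[OF h]])
    then show "t \<le> measure lebesgue {u\<in>{0..1}. c \<le> \<bar>?h u\<bar>}" unfolding mJ(2) .
  qed
  moreover have "psi x * cum f x \<le> 2 * (c * \<phi> t)"
  proof (cases "x \<le> 1/2 \<and> {x..<2*x} \<subseteq> A")
    case True
    then have "2 * (c * \<phi> t) = \<phi> x / x * cum f x" using x by (simp add: c_def t_def)
    moreover have "psi x * cum f x \<le> \<phi> x / x * cum f x"
      using x cum_nonneg by (intro mult_right_mono) (auto simp: psi_def intro!: divide_right_mono)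
    ultimately show ?thesis by linarith
  next
    case False
    then have "1/2 \<le> x" "2 * (c * \<phi> t) = 2 * \<phi> (1 - x) * cum f x" using sub by (auto simp: c_def t_def)
    moreover have "psi x \<le> 2 * \<phi> (1 - x)"
    proof -
      have "psi x \<le> \<phi> (1 - x) / x" using x by (auto simp: psi_def intro!: divide_right_mono)
      also have "\<dots> \<le> \<phi> (1 - x) / (1/2)" using x \<open>1/2 \<le> x\<close> nonneg[of "1 - x"] by (intro divide_left_mono) auto
      finally show ?thesis by simp
    qed
    ultimately show ?thesis using mult_right_mono[OF _ cum_nonneg[of f x], of "psi x" "2 * \<phi> (1 - x)"] by linarith
  qed
  ultimately have le: "ennreal (c * \<phi> t) \<le> Mnorm \<phi> ?h" and "ennreal (psi x * cum f x) \<le> ennreal (2 * (c * \<phi> t))"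
    by (auto intro!: ennreal_leI)
  note this(2)
  also have "ennreal (2 * (c * \<phi> t)) = 2 * ennreal (c * \<phi> t)" by (subst ennreal_mult') auto
  also have "\<dots> \<le> 2 * Mnorm \<phi> ?h" by (intro mult_left_mono le) simp
  finally show ?thesis .
qed

lemma Mnorm_Ces_le:
  assumes f: "locint f" and P: "0 \<le> P" "\<And>x. 0 < x \<Longrightarrow> x < 1 \<Longrightarrow> psi x * cum f x \<le> P"
  shows "Mnorm \<phi> (Ces_abs f) \<le> ennreal (C * P)"
proof -
  have "Mnorm \<phi> (Ces_abs f) \<le> ennreal (C * P + 0 * \<phi> (min 1 (2 * measure lebesgue ({}::real set))))"
    using P Ces_abs_le_iff[OF locintD(1)[OF f]] by (intro Mnorm_le on01_Ces_abs f) auto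
  then show ?thesis by simp
qed

text \<open>Order continuity, tested on neighbourhoods of the endpoints that shrink to a null set,
  gives the vanishing by the lower estimate. Conversely, a vanishing function splits for each e into
  a part of norm at most \<open>C * e\<close> and a bounded part, whose norm on a set of measure m
  is governed by \<phi> (2 m).\<close>

theorem in_CM0_iff: "in_CM0 \<phi> f \<longleftrightarrow> locint f \<and> vanishing f"
proof
  assume *: "in_CM0 \<phi> f"
  then have f: "locint f" by (auto simp: in_CM0_def locint_iff)
  have "vanishing f"
    unfolding vanishing_def
  proof (intro allI impI)
    fix e :: real assume e: "0 < e"
    define A where "A n = {0..1 / real (n + 2)} \<union> {1 - 1 / real (n + 2)..1}" for n
    have A: "A n \<in> sets lebesgue \<and> A n \<subseteq> {0..1}" for n
      by (auto simp: A_def divide_simps)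
    have "decseq A"
    proof (rule decseq_SucI)
      fix n show "A (Suc n) \<subseteq> A n"
        using frac_le[of 1 1 "real (n + 2)" "real (Suc n + 2)"] by (auto simp: A_def)
    qed
    have "(\<Inter>n. A n) \<subseteq> {0, 1}"
    proof
      fix x assume x: "x \<in> (\<Inter>n. A n)"
      show "x \<in> {0, 1}"
      proof (rule ccontr)
        assume "x \<notin> {0, 1}"
        then have "0 < min x (1 - x)" using x A[of 0] by auto
        then obtain n where "inverse (real (Suc n)) < min x (1 - x)" using reals_Archimedean by blast
        moreover have "1 / real (n + 2) \<le> inverse (real (Suc n))" by (simp add: divide_simps)
        ultimately have "x \<notin> A n" by (auto simp: A_def)
        with x show False by blast
      qed
    qed
    then have "emeasure lebesgue (\<Inter>n. A n) = 0"
    proof -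
      have N: "{0, 1} \<in> null_sets (lebesgue :: real measure)"
        by (intro null_sets_completionI finite_imp_null_set_lborel) simp
      have "(\<Inter>n. A n) \<in> sets lebesgue" using A by blast
      then have "(\<Inter>n. A n) \<in> null_sets lebesgue"
        by (rule null_sets_subset[OF N _ \<open>(\<Inter>n. A n) \<subseteq> {0, 1}\<close>])
      then show ?thesis by (rule null_setsD1)
    qed
    then have "(\<lambda>n. Mnorm \<phi> (\<lambda>x. indicator (A n) x * Ces_abs f x)) \<longlonglongrightarrow> 0"
      using * A \<open>decseq A\<close> unfolding in_CM0_def in_M0_def by blast
    then have "\<forall>\<^sub>F n in sequentially. Mnorm \<phi> (\<lambda>x. indicator (A n) x * Ces_abs f x) < ennreal (e/2)"
      using e by (intro order_tendstoD) auto
    then obtain n where n: "Mnorm \<phi> (\<lambda>x. indicator (A n) x * Ces_abs f x) < ennreal (e/2)"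
      by (auto simp: eventually_sequentially)
    \<comment> \<open>Half the radius of \<open>A n\<close>, so that [x,2x) stays inside
      \<open>A n\<close> for x < a.\<close>
    define a where "a = 1 / (2 * real (n + 2))"
    have a: "0 < a" "2 * a = 1 / real (n + 2)" "a \<le> 1/4" by (auto simp: a_def divide_simps)
    show "\<exists>a>0. \<forall>x. 0 < x \<longrightarrow> x < 1 \<longrightarrow> x < a \<or> 1 - a < x \<longrightarrow> psi x * cum f x \<le> e"
    proof (intro exI[of _ a] conjI allI impI a(1))
      fix x assume x: "0 < x" "x < 1" "x < a \<or> 1 - a < x"
      have "ennreal (psi x * cum f x) \<le> 2 * Mnorm \<phi> (\<lambda>u. indicator (A n) u * Ces_abs f u)"
      proof (rule Mnorm_Ces_lower[OF f _ x(1,2)])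
        show "A n \<in> sets M01" using A by (simp add: sets_M01_iff)
        show "x \<le> 1/2 \<and> {x..<2*x} \<subseteq> A n \<or> 1/2 \<le> x \<and> {x..<1} \<subseteq> A n"
        proof (cases "x < a")
          case True
          then show ?thesis using a x by (auto simp: A_def simp flip: a(2))
        next
          case False
          then show ?thesis using a x by (auto simp: A_def simp flip: a(2))
        qed
      qed
      also have "\<dots> \<le> 2 * ennreal (e / 2)" by (intro mult_left_mono less_imp_le[OF n]) simp
      also have "\<dots> = ennreal e" using e by (metis ennreal_mult'' ennreal_numeral half_gt_zero less_imp_le nonzero_mult_div_cancel_left times_divide_eq_right zero_neq_numeral)
      finally show "psi x * cum f x \<le> e" using e by (simp add: ennreal_le_iff)
    qed
  qed
  with f show "locint f \<and> vanishing f" by blast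
next
  assume "locint f \<and> vanishing f"
  then have f: "locint f" "vanishing f" by auto
  have o: "on01 (Ces_abs f)" by (rule on01_Ces_abs[OF f(1)])
  then have [measurable]: "Ces_abs f \<in> borel_measurable M01" by (simp add: on01_def)
  have bound: "\<exists>B\<ge>0. \<forall>A. A \<in> sets lebesgue \<longrightarrow> A \<subseteq> {0..1} \<longrightarrow> Mnorm \<phi> (\<lambda>x. indicator A x * Ces_abs f x)
      \<le> ennreal (C * e + B * \<phi> (min 1 (2 * measure lebesgue A)))" if e: "0 < e" for e
  proof -
    obtain B where B: "0 \<le> B" "\<And>x. 0 < x \<Longrightarrow> x < 1 \<Longrightarrow> \<bar>Ces_abs f x\<bar> \<le> e / min (\<phi> x) (\<phi> (1 - x)) \<or> \<bar>Ces_abs f x\<bar> \<le> B"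
      using vanishing_split[OF f e] by blast
    show ?thesis
    proof (intro exI[of _ B] conjI allI impI B(1))
      fix A :: "real set" assume A: "A \<in> sets lebesgue" "A \<subseteq> {0..1}"
      then have [measurable]: "A \<in> sets M01" by (simp add: sets_M01_iff)
      show "Mnorm \<phi> (\<lambda>x. indicator A x * Ces_abs f x) \<le> ennreal (C * e + B * \<phi> (min 1 (2 * measure lebesgue A)))"
      proof (rule Mnorm_le[OF _ A])
        show "on01 (\<lambda>x. indicator A x * Ces_abs f x)" unfolding on01_def by measurable
        fix x :: real assume x: "0 < x" "x < 1"
        have "0 \<le> e / min (\<phi> x) (\<phi> (1 - x))" using e x pos[of x] pos[of "1 - x"] by simp
        with B(2)[OF x] show "\<bar>indicator A x * Ces_abs f x\<bar> \<le> e / min (\<phi> x) (\<phi> (1 - x)) \<or> x \<in> A \<and> \<bar>indicator A x * Ces_abs f x\<bar> \<le> B"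
          by (auto simp: indicator_def)
      qed (use e B in auto)
    qed
  qed
  have "in_M \<phi> (Ces_abs f)"
  proof -
    have eq: "(\<lambda>x. indicator {0..1} x * Ces_abs f x) = Ces_abs f" by (auto simp: fun_eq_iff Ces_abs_def indicator_def)
    from bound[OF zero_less_one] obtain B where B: "\<forall>A. A \<in> sets lebesgue \<longrightarrow> A \<subseteq> {0..1} \<longrightarrow>
      Mnorm \<phi> (\<lambda>x. indicator A x * Ces_abs f x) \<le> ennreal (C * 1 + B * \<phi> (min 1 (2 * measure lebesgue A)))" by blast
    have "Mnorm \<phi> (Ces_abs f) < \<infinity>"
      by (rule le_less_trans[OF B[rule_format, OF fmeasurableD[OF lmeasurable_interval(1)] order.refl, unfolded eq]]) simp
    with o show ?thesis by (simp add: in_M_def)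
  qed
  moreover have "(\<lambda>n. Mnorm \<phi> (\<lambda>x. indicator (A n) x * Ces_abs f x)) \<longlonglongrightarrow> 0"
    if A: "\<forall>n. A n \<in> sets lebesgue \<and> A n \<subseteq> {0..1}" "decseq A" "emeasure lebesgue (\<Inter>n. A n) = 0" for A :: "nat \<Rightarrow> real set"
  proof (rule tendsto_zero_ennrealI)
    fix e :: real assume e: "0 < e"
    define e' where "e' = e / (2 * C)"
    have e': "0 < e'" "C * e' = e / 2" using e C_pos by (auto simp: e'_def)
    obtain B where B: "0 \<le> B" "\<And>A. A \<in> sets lebesgue \<Longrightarrow> A \<subseteq> {0..1} \<Longrightarrow> Mnorm \<phi> (\<lambda>x. indicator A x * Ces_abs f x)
      \<le> ennreal (C * e' + B * \<phi> (min 1 (2 * measure lebesgue A)))"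
      using bound[OF e'(1)] by blast
    obtain d where d: "0 < d" "d \<le> 1" "\<And>t. 0 \<le> t \<Longrightarrow> t \<le> d \<Longrightarrow> \<phi> t < e / (2 * (B + 1))"
      using small[of "e / (2 * (B + 1))"] e B(1) by auto
    have Al: "A n \<in> lmeasurable" for n
      using A by (blast intro: lmeasurable_subset_01)
    have "(\<lambda>n. measure lebesgue (A n)) \<longlonglongrightarrow> measure lebesgue (\<Inter>n. A n)"
    proof (rule Lim_measure_decseq)
      show "emeasure lebesgue (A n) \<noteq> \<infinity>" for n using fmeasurableD2[OF Al[of n]] by simp
    qed (use A in auto)
    also have "measure lebesgue (\<Inter>n. A n) = 0" using A by (simp add: measure_def)
    finally have "\<forall>\<^sub>F n in sequentially. measure lebesgue (A n) < d / 2"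
      using d by (intro order_tendstoD) auto
    then show "\<forall>\<^sub>F n in sequentially. Mnorm \<phi> (\<lambda>x. indicator (A n) x * Ces_abs f x) \<le> ennreal e"
    proof eventually_elim
      case (elim n)
      then have "\<phi> (min 1 (2 * measure lebesgue (A n))) < e / (2 * (B + 1))"
        by (intro d) auto
      then have "B * \<phi> (min 1 (2 * measure lebesgue (A n))) \<le> B * (e / (2 * (B + 1)))"
        using B by (intro mult_left_mono) auto
      also have "\<dots> \<le> e / 2" using weighted_frac_le[of "e / 2" B] B e by simp
      finally have "C * e' + B * \<phi> (min 1 (2 * measure lebesgue (A n))) \<le> e" using e' by simp
      then show ?case using B(2)[of "A n"] A by (meson ennreal_leI order_trans)
    qed
  qed
  ultimately show "in_CM0 \<phi> f"
    using locintD(1)[OF f(1)] f(1) unfolding in_CM0_def in_M0_def by (auto simp: locint_iff)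
qed

text \<open>The lower estimate for the whole interval. With \<open>CM_norm_le\<close> it makes the
  supremum of \<open>psi\<close> times F an equivalent norm, with constants 2 and
  \<open>C\<close>.\<close>

lemma cum_le_CM_norm:
  assumes f: "in_CM0 \<phi> f" and x: "0 < x" "x < 1"
  shows "psi x * cum f x \<le> 2 * CM_norm \<phi> f"
proof -
  have l: "locint f" using f by (simp add: in_CM0_iff)
  have "(\<lambda>x. indicator {0..1} x * Ces_abs f x) = Ces_abs f" by (auto simp: fun_eq_iff Ces_abs_def indicator_def)
  moreover have "ennreal (psi x * cum f x) \<le> 2 * Mnorm \<phi> (\<lambda>u. indicator {0..1} u * Ces_abs f u)"
    using x by (intro Mnorm_Ces_lower l) (auto simp: sets_M01_iff)
  moreover have "Mnorm \<phi> (Ces_abs f) = ennreal (CM_norm \<phi> f)"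
    using f by (simp add: CM_norm_def in_CM0_def in_M0_def in_M_def)
  ultimately have "ennreal (psi x * cum f x) \<le> 2 * ennreal (CM_norm \<phi> f)" by simp
  also have "\<dots> = ennreal (2 * CM_norm \<phi> f)" by (simp add: ennreal_mult')
  finally show ?thesis by (subst (asm) ennreal_le_iff) (auto simp: CM_norm_def)
qed

lemma CM_norm_nonneg: "0 \<le> CM_norm \<phi> f"
  by (simp add: CM_norm_def)

lemma CM_norm_le:
  assumes f: "in_CM0 \<phi> f" and P: "0 \<le> P" "\<And>x. 0 < x \<Longrightarrow> x < 1 \<Longrightarrow> psi x * cum f x \<le> P"
  shows "CM_norm \<phi> f \<le> C * P"
proof -
  have "Mnorm \<phi> (Ces_abs f) \<le> ennreal (C * P)"
    using f P by (intro Mnorm_Ces_le) (auto simp: in_CM0_iff)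
  then show ?thesis unfolding CM_norm_def using P C_pos by (intro enn2real_leI) auto
qed

lemma in_CM0_lincomb:
  assumes f: "in_CM0 \<phi> f" and g: "in_CM0 \<phi> g"
  shows "in_CM0 \<phi> (\<lambda>t. a * f t + b * g t)"
  unfolding in_CM0_iff
proof
  have fg: "locint f" "locint g" using f g by (auto simp: in_CM0_iff)
  show "locint (\<lambda>t. a * f t + b * g t)" by (rule locint_lincomb[OF fg])
  show "vanishing (\<lambda>t. a * f t + b * g t)"
    unfolding vanishing_def
  proof (intro allI impI)
    fix e :: real assume e: "0 < e"
    define e' where "e' = e / (\<bar>a\<bar> + \<bar>b\<bar> + 1)"
    have e': "0 < e'" using e by (simp add: e'_def)
    obtain a1 where a1: "a1 > 0" "\<And>x. 0 < x \<Longrightarrow> x < 1 \<Longrightarrow> x < a1 \<or> 1 - a1 < x \<Longrightarrow> psi x * cum f x \<le> e'"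
      using f e' unfolding in_CM0_iff vanishing_def by blast
    obtain a2 where a2: "a2 > 0" "\<And>x. 0 < x \<Longrightarrow> x < 1 \<Longrightarrow> x < a2 \<or> 1 - a2 < x \<Longrightarrow> psi x * cum g x \<le> e'"
      using g e' unfolding in_CM0_iff vanishing_def by blast
    show "\<exists>a0>0. \<forall>x. 0 < x \<longrightarrow> x < 1 \<longrightarrow> x < a0 \<or> 1 - a0 < x \<longrightarrow> psi x * cum (\<lambda>t. a * f t + b * g t) x \<le> e"
    proof (intro exI[of _ "min a1 a2"] conjI allI impI)
      fix x assume x: "0 < x" "x < 1" "x < min a1 a2 \<or> 1 - min a1 a2 < x"
      have "psi x * cum (\<lambda>t. a * f t + b * g t) x \<le> psi x * (\<bar>a\<bar> * cum f x + \<bar>b\<bar> * cum g x)"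
        using psi_pos[OF x(1,2)] by (intro mult_left_mono locint_lincomb(2)[OF fg] x) auto
      also have "\<dots> = \<bar>a\<bar> * (psi x * cum f x) + \<bar>b\<bar> * (psi x * cum g x)" by (simp add: algebra_simps)
      also have "\<dots> \<le> \<bar>a\<bar> * e' + \<bar>b\<bar> * e'"
        using x by (intro add_mono mult_left_mono a1(2) a2(2)) auto
      also have "\<dots> = (\<bar>a\<bar> + \<bar>b\<bar>) * (e / (\<bar>a\<bar> + \<bar>b\<bar> + 1))" by (simp add: e'_def ring_distribs add_divide_distrib)
      also have "\<dots> \<le> e" using e by (intro weighted_frac_le) auto
      finally show "psi x * cum (\<lambda>t. a * f t + b * g t) x \<le> e" .
    qed (use a1 a2 in auto)
  qed
qed

lemma in_CM0_solid:
  assumes f: "in_CM0 \<phi> f" and g: "on01 g" and le: "\<And>t. 0 \<le> t \<Longrightarrow> t \<le> 1 \<Longrightarrow> \<bar>g t\<bar> \<le> \<bar>f t\<bar>"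
  shows "in_CM0 \<phi> g"
  unfolding in_CM0_iff
proof
  have l: "locint f" using f by (auto simp: in_CM0_iff)
  show "locint g" by (rule locint_solid[OF l g le])
  have "psi x * cum g x \<le> psi x * cum f x" if "0 < x" "x < 1" for x
    using psi_pos[OF that] that by (intro mult_left_mono locint_solid(2)[OF l g le]) auto
  then have le': "psi x * cum g x \<le> e" if "psi x * cum f x \<le> e" "0 < x" "x < 1" for x e
    using that order_trans by blast
  show "vanishing g"
    unfolding vanishing_def
  proof (intro allI impI)
    fix e :: real assume "0 < e"
    with f obtain a where "a > 0" "\<And>x. 0 < x \<Longrightarrow> x < 1 \<Longrightarrow> x < a \<or> 1 - a < x \<Longrightarrow> psi x * cum f x \<le> e"
      unfolding in_CM0_iff vanishing_def by blast
    then show "\<exists>a>0. \<forall>x. 0 < x \<longrightarrow> x < 1 \<longrightarrow> x < a \<or> 1 - a < x \<longrightarrow> psi x * cum g x \<le> e"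
      using le' by (intro exI[of _ a]) auto
  qed
qed

lemma in_CM0_measurable: "in_CM0 \<phi> f \<Longrightarrow> f \<in> borel_measurable M01"
  by (simp add: in_CM0_def on01_def)

text \<open>For t * h t one has F x \<le> x times the L^1 norm of \<open>h\<close>, and the factor x
  cancels the denominator of \<open>psi\<close>. Multiplication by t thus embeds L^1 into the space;
  this is the origin of the bound 1 / t for densities.\<close>

lemma in_CM0_weighted_L1:
  assumes h: "integrable M01 h"
  shows "in_CM0 \<phi> (\<lambda>t. t * h t)" "CM_norm \<phi> (\<lambda>t. t * h t) \<le> C * \<phi> 1 * (\<integral>t. \<bar>h t\<bar> \<partial>M01)"
proof -
  note [measurable] = borel_measurable_integrable[OF h]
  let ?I = "\<integral>t. \<bar>h t\<bar> \<partial>M01"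
  have I0: "0 \<le> ?I" by (rule integral_nonneg_AE) simp
  have le: "indicator {0..x} t * \<bar>t * h t\<bar> \<le> x * \<bar>h t\<bar>" if "t \<in> space M01" "0 < x" for x t
    using that by (auto simp: indicator_def abs_mult space_restrict_space intro!: mult_right_mono)
  have int: "integrable M01 (\<lambda>t. indicator {0..x} t * \<bar>t * h t\<bar>)" if "0 < x" for x
  proof (rule Bochner_Integration.integrable_bound)
    show "integrable M01 (\<lambda>t. x * \<bar>h t\<bar>)" using h by simp
    show "AE t in M01. norm (indicator {0..x} t * \<bar>t * h t\<bar>) \<le> norm (x * \<bar>h t\<bar>)"
      using le that by (auto intro!: AE_I2 simp: abs_mult)
  qed simp
  have l: "locint (\<lambda>t. t * h t)"
    unfolding locint_def on01_def using int by simp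
  have cum: "cum (\<lambda>t. t * h t) x \<le> x * ?I" if "0 < x" for x
  proof -
    have "cum (\<lambda>t. t * h t) x \<le> (\<integral>t. x * \<bar>h t\<bar> \<partial>M01)"
      unfolding cum_def using h that by (intro integral_mono int le) auto
    then show ?thesis by simp
  qed
  have psi: "psi x * cum (\<lambda>t. t * h t) x \<le> min (\<phi> x) (\<phi> (1 - x)) * ?I" if x: "0 < x" "x < 1" for x
  proof -
    have "psi x * cum (\<lambda>t. t * h t) x \<le> psi x * (x * ?I)"
      using psi_pos[OF x] by (intro mult_left_mono cum x) auto
    then show ?thesis using x by (simp add: psi_def)
  qed
  have v: "vanishing (\<lambda>t. t * h t)"
    unfolding vanishing_def
  proof (intro allI impI)
    fix e :: real assume e: "0 < e"
    obtain d where d: "0 < d" "d \<le> 1" "\<And>t. 0 \<le> t \<Longrightarrow> t \<le> d \<Longrightarrow> \<phi> t < e / (?I + 1)"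
      using small[of "e / (?I + 1)"] e I0 by auto
    show "\<exists>a>0. \<forall>x. 0 < x \<longrightarrow> x < 1 \<longrightarrow> x < a \<or> 1 - a < x \<longrightarrow> psi x * cum (\<lambda>t. t * h t) x \<le> e"
    proof (intro exI[of _ d] conjI allI impI d)
      fix x assume x: "0 < x" "x < 1" "x < d \<or> 1 - d < x"
      then have "min (\<phi> x) (\<phi> (1 - x)) \<le> e / (?I + 1)"
        using d(3)[of x] d(3)[of "1 - x"] by (auto simp: min_le_iff_disj)
      then have "?I * min (\<phi> x) (\<phi> (1 - x)) \<le> ?I * (e / (?I + 1))"
        using I0 by (rule mult_left_mono)
      also have "\<dots> \<le> e" using e I0 by (intro weighted_frac_le)
      finally show "psi x * cum (\<lambda>t. t * h t) x \<le> e" using psi[OF x(1,2)] by (simp add: mult.commute)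
    qed
  qed
  show in_CM0: "in_CM0 \<phi> (\<lambda>t. t * h t)" using l v by (simp add: in_CM0_iff)
  have "CM_norm \<phi> (\<lambda>t. t * h t) \<le> C * (\<phi> 1 * ?I)"
  proof (rule CM_norm_le[OF in_CM0])
    show "0 \<le> \<phi> 1 * ?I" using nonneg[of 1] I0 by simp
    fix x :: real assume x: "0 < x" "x < 1"
    have "min (\<phi> x) (\<phi> (1 - x)) * ?I \<le> \<phi> 1 * ?I"
      using mono[of x 1] x I0 by (intro mult_right_mono) (auto simp: min_le_iff_disj)
    with psi[OF x] show "psi x * cum (\<lambda>t. t * h t) x \<le> \<phi> 1 * ?I" by linarith
  qed
  then show "CM_norm \<phi> (\<lambda>t. t * h t) \<le> C * \<phi> 1 * ?I" by (simp add: mult_ac)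
qed

end

section \<open>Densities of functionals\<close>

text \<open>On indicators \<open>T\<close> is a set function dominated by K times \<open>M\<close>.
  Adding K times \<open>M\<close> makes it nonnegative, and the domination by 2 K times
  \<open>M\<close> gives continuity at the empty set, hence countable additivity, and absolute
  continuity. Radon-Nikodym then yields a density, from which K is subtracted again; simple
  functions and dominated convergence extend the formula to all integrable functions.\<close>

lemma L1_functional_density:
  fixes T :: "('a \<Rightarrow> real) \<Rightarrow> real"
  assumes M: "finite_measure M" and K: "0 \<le> K"
    and lin: "\<And>f g a b. integrable M f \<Longrightarrow> integrable M g \<Longrightarrow> T (\<lambda>t. a * f t + b * g t) = a * T f + b * T g"
    and bound: "\<And>f. integrable M f \<Longrightarrow> \<bar>T f\<bar> \<le> K * (\<integral>t. \<bar>f t\<bar> \<partial>M)"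
  shows "\<exists>g\<in>borel_measurable M. (\<forall>t. \<bar>g t\<bar> \<le> K) \<and> (\<forall>f. integrable M f \<longrightarrow> T f = (\<integral>t. f t * g t \<partial>M))"
proof -
  interpret finite_measure M by fact
  define \<nu> where "\<nu> A = T (indicator A) + K * measure M A" for A
  have ind: "integrable M (indicator A :: 'a \<Rightarrow> real)" if "A \<in> sets M" for A
    using that by (intro integrable_real_indicator) (auto simp: less_top[symmetric])
  have Tind: "\<bar>T (indicator A)\<bar> \<le> K * measure M A" if "A \<in> sets M" for A
    using bound[OF ind[OF that]] that by simp
  have \<nu>0: "0 \<le> \<nu> A" "\<nu> A \<le> 2 * K * measure M A" if "A \<in> sets M" for A
    using Tind[OF that] by (auto simp: \<nu>_def)
  have add: "\<nu> (A \<union> B) = \<nu> A + \<nu> B" if "A \<in> sets M" "B \<in> sets M" "A \<inter> B = {}" for A B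
  proof -
    have "(indicator (A \<union> B) :: 'a \<Rightarrow> real) = (\<lambda>t. 1 * indicator A t + 1 * indicator B t)"
      using that by (auto simp: fun_eq_iff indicator_def)
    then have "T (indicator (A \<union> B)) = T (indicator A) + T (indicator B)"
      using lin[OF ind ind, of A B 1 1] that by simp
    then show ?thesis
      using that finite_measure_Union[of A B] by (simp add: \<nu>_def algebra_simps)
  qed
  have empty: "\<nu> {} = 0" using \<nu>0[of "{}"] by simp
  define N where "N = measure_of (space M) (sets M) (\<lambda>A. ennreal (\<nu> A))"
  have ca: "countably_additive (sets M) (\<lambda>A. ennreal (\<nu> A))"
  proof (rule sets.empty_continuous_imp_countably_additive)
    show "positive (sets M) (\<lambda>A. ennreal (\<nu> A))" by (simp add: positive_def empty)
    show "additive (sets M) (\<lambda>A. ennreal (\<nu> A))"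
      by (auto simp: additive_def add \<nu>0 intro!: ennreal_plus)
    fix A :: "nat \<Rightarrow> 'a set" assume A: "range A \<subseteq> sets M" "decseq A" "(\<Inter>i. A i) = {}"
    have "(\<lambda>i. measure M (A i)) \<longlonglongrightarrow> measure M (\<Inter>i. A i)"
      using A by (intro finite_Lim_measure_decseq)
    then have "(\<lambda>i. 2 * K * measure M (A i)) \<longlonglongrightarrow> 2 * K * 0"
      using A by (intro tendsto_intros) simp
    then have "(\<lambda>i. \<nu> (A i)) \<longlonglongrightarrow> 0"
      by (intro tendsto_sandwich[of "\<lambda>_. 0" "\<lambda>i. \<nu> (A i)" _ "\<lambda>i. 2 * K * measure M (A i)"] always_eventually allI \<nu>0)
        (use A in auto)
    then show "(\<lambda>i. ennreal (\<nu> (A i))) \<longlonglongrightarrow> 0"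
      using tendsto_ennrealI by force
  qed auto
  have N: "emeasure N A = ennreal (\<nu> A)" if "A \<in> sets M" for A
    unfolding N_def
  proof (rule emeasure_measure_of_sigma)
    show "positive (sets M) (\<lambda>A. ennreal (\<nu> A))" by (simp add: positive_def empty)
  qed (use that ca in \<open>auto simp: sets.sigma_algebra_axioms\<close>)
  have sN: "sets N = sets M" by (simp add: N_def)
  have "absolutely_continuous M N"
    unfolding absolutely_continuous_def
  proof
    fix A assume "A \<in> null_sets M"
    then have A: "A \<in> sets M" "measure M A = 0" by (auto simp: measure_def)
    then have "\<nu> A = 0" using \<nu>0[of A] by simp
    with A show "A \<in> null_sets N" by (auto simp: null_sets_def N sN)
  qed
  from Radon_Nikodym[OF this sN] obtain d where d[measurable]: "d \<in> borel_measurable M" and dN: "density M d = N"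
    by blast
  have dA: "(\<integral>\<^sup>+ t. d t * indicator A t \<partial>M) = ennreal (\<nu> A)" if "A \<in> sets M" for A
    using emeasure_density[OF d that] N[OF that] dN by simp
  have "(\<integral>\<^sup>+ t. d t \<partial>M) = ennreal (\<nu> (space M))"
    using dA[of "space M"] nn_integral_cong[of M "\<lambda>t. d t * indicator (space M) t" d] by simp
  then have dfin: "AE t in M. d t \<noteq> \<infinity>" by (intro nn_integral_PInf_AE) auto
  have dr: "AE t in M. ennreal (enn2real (d t)) = d t"
    using dfin by eventually_elim (simp add: less_top)
  have eint: "integrable M (\<lambda>t. enn2real (d t))"
  proof (rule integrableI_nonneg)
    have "(\<integral>\<^sup>+ t. ennreal (enn2real (d t)) \<partial>M) = (\<integral>\<^sup>+ t. d t \<partial>M)"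
      using dr by (rule nn_integral_cong_AE)
    then show "(\<integral>\<^sup>+ t. ennreal (enn2real (d t)) \<partial>M) < \<infinity>"
      using \<open>(\<integral>\<^sup>+ t. d t \<partial>M) = ennreal (\<nu> (space M))\<close> by simp
  qed auto
  have eA: "(\<integral>t. indicator A t * enn2real (d t) \<partial>M) = \<nu> A" if A[measurable]: "A \<in> sets M" for A
  proof -
    have "(\<integral>t. indicator A t * enn2real (d t) \<partial>M) = enn2real (\<integral>\<^sup>+ t. ennreal (indicator A t * enn2real (d t)) \<partial>M)"
      by (rule integral_eq_nn_integral) auto
    also have "(\<integral>\<^sup>+ t. ennreal (indicator A t * enn2real (d t)) \<partial>M) = (\<integral>\<^sup>+ t. d t * indicator A t \<partial>M)"
      by (rule nn_integral_cong_AE) (use dr in eventually_elim, auto simp: indicator_def)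
    finally show ?thesis using dA[OF A] \<nu>0[OF A] by simp
  qed
  define e where "e t = enn2real (d t) - K" for t
  have e_int: "integrable M e" unfolding e_def using eint by simp
  have e_ind: "(\<integral>t. indicator A t * e t \<partial>M) = T (indicator A)" if A: "A \<in> sets M" for A
  proof -
    have "(\<integral>t. indicator A t * e t \<partial>M) = (\<integral>t. indicator A t * enn2real (d t) - K * indicator A t \<partial>M)"
      by (simp add: e_def algebra_simps)
    also have "\<dots> = \<nu> A - K * measure M A"
      using A eA[OF A] ind[OF A] integrable_real_mult_indicator[OF A eint]
      by (subst Bochner_Integration.integral_diff) (auto simp: mult.commute)
    finally show ?thesis by (simp add: \<nu>_def)
  qed
  \<comment> \<open>All averages of \<open>e\<close> over sets of positive measure lie in [-K,K],
    hence so do almost all of its values. Truncation to this interval below makes the bound hold at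
    every point.\<close>
  have ae: "AE t in M. e t \<in> {- K..K}"
  proof (rule averaging_theorem[OF e_int])
    fix A assume A: "A \<in> sets M" "0 < measure M A"
    have "set_lebesgue_integral M A e = T (indicator A)"
      using e_ind[OF A(1)] by (simp add: set_lebesgue_integral_def)
    moreover have "T (indicator A) / measure M A \<in> {- K..K}"
      using Tind[OF A(1)] A(2) by (auto simp: field_simps abs_le_iff)
    ultimately show "(1 / measure M A) *\<^sub>R set_lebesgue_integral M A e \<in> {- K..K}"
      by simp
  qed simp
  define g where "g t = max (- K) (min K (e t))" for t
  have g_meas[measurable]: "g \<in> borel_measurable M" unfolding g_def using e_int by measurable
  have g_le: "\<bar>g t\<bar> \<le> K" for t using K by (auto simp: g_def)
  have ge: "AE t in M. g t = e t" using ae by eventually_elim (auto simp: g_def)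
  have fg_int: "integrable M (\<lambda>t. f t * g t)" if f: "integrable M f" for f
  proof (rule Bochner_Integration.integrable_bound)
    show "integrable M (\<lambda>t. K * f t)" using f by simp
    show "AE t in M. norm (f t * g t) \<le> norm (K * f t)"
    proof (rule AE_I2)
      fix t
      have "\<bar>f t\<bar> * \<bar>g t\<bar> \<le> \<bar>f t\<bar> * K" by (intro mult_left_mono g_le) simp
      then show "norm (f t * g t) \<le> norm (K * f t)" using K by (simp add: abs_mult mult.commute)
    qed
  qed (use f in measurable)
  have "T f = (\<integral>t. f t * g t \<partial>M)" if "integrable M f" for f
    using that
  proof (induction rule: integrable_induct)
    case (base A c)
    have "T (\<lambda>t. indicator A t *\<^sub>R c) = c * T (indicator A)"
      using lin[OF ind ind, of A A c 0] base by (simp add: mult.commute)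
    also have "T (indicator A) = (\<integral>t. indicator A t * g t \<partial>M)"
    proof -
      have "(\<integral>t. indicator A t * g t \<partial>M) = (\<integral>t. indicator A t * e t \<partial>M)"
        using base e_int by (intro integral_cong_AE) (use ge in \<open>auto intro: eventually_mono\<close>)
      then show ?thesis using e_ind[OF base(1)] by simp
    qed
    also have "c * (\<integral>t. indicator A t * g t \<partial>M) = (\<integral>t. indicator A t *\<^sub>R c * g t \<partial>M)"
      by (subst integral_mult_right_zero[symmetric]) (simp add: mult_ac)
    finally show ?case .
  next
    case (add f1 f2)
    have "T (\<lambda>x. f1 x + f2 x) = T f1 + T f2"
      using lin[OF add.hyps(1,2), of 1 1] by simp
    also have "\<dots> = (\<integral>t. (f1 t + f2 t) * g t \<partial>M)"
      using add fg_int by (simp add: ring_distribs)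
    finally show ?case .
  next
    case (lim f s)
    note [measurable] = borel_measurable_integrable[OF lim.hyps(4)] borel_measurable_integrable[OF lim.hyps(1)]
    have "(\<lambda>i. \<integral>t. s i t * g t \<partial>M) \<longlonglongrightarrow> (\<integral>t. f t * g t \<partial>M)"
    proof (rule integral_dominated_convergence)
      show "integrable M (\<lambda>t. 2 * K * \<bar>f t\<bar>)" using lim by simp
      show "AE t in M. norm (s i t * g t) \<le> 2 * K * \<bar>f t\<bar>" for i
      proof (rule AE_I2)
        fix t assume "t \<in> space M"
        then have "\<bar>s i t\<bar> * \<bar>g t\<bar> \<le> (2 * \<bar>f t\<bar>) * K"
          using lim.hyps(3)[of t i] g_le[of t] by (intro mult_mono) auto
        then show "norm (s i t * g t) \<le> 2 * K * \<bar>f t\<bar>" by (simp add: abs_mult mult_ac)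
      qed
      show "AE t in M. (\<lambda>i. s i t * g t) \<longlonglongrightarrow> f t * g t"
        by (intro AE_I2 tendsto_mult tendsto_const lim.hyps(2))
    qed measurable
    moreover have "(\<lambda>i. T (s i)) \<longlonglongrightarrow> T f"
    proof -
      have "(\<lambda>i. \<integral>t. \<bar>s i t - f t\<bar> \<partial>M) \<longlonglongrightarrow> (\<integral>t. 0 \<partial>M)"
      proof (rule integral_dominated_convergence)
        show "integrable M (\<lambda>t. 3 * \<bar>f t\<bar>)" using lim by simp
        show "AE t in M. norm \<bar>s i t - f t\<bar> \<le> 3 * \<bar>f t\<bar>" for i
        proof (rule AE_I2)
          fix t assume "t \<in> space M"
          then show "norm \<bar>s i t - f t\<bar> \<le> 3 * \<bar>f t\<bar>" using lim.hyps(3)[of t i] by simp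
        qed
        show "AE t in M. (\<lambda>i. \<bar>s i t - f t\<bar>) \<longlonglongrightarrow> 0"
          by (intro AE_I2 tendsto_rabs_zero LIM_zero lim.hyps(2))
      qed auto
      then have "(\<lambda>i. K * (\<integral>t. \<bar>s i t - f t\<bar> \<partial>M)) \<longlonglongrightarrow> 0"
        by (intro tendsto_mult_right_zero) simp
      moreover have "\<bar>T (s i) - T f\<bar> \<le> K * (\<integral>t. \<bar>s i t - f t\<bar> \<partial>M)" for i
        using lin[OF lim.hyps(1)[of i] lim.hyps(4), of 1 "-1"] bound[of "\<lambda>t. s i t - f t"] lim.hyps(1)[of i] lim.hyps(4) by simp
      ultimately have "(\<lambda>i. T (s i) - T f) \<longlonglongrightarrow> 0"
        by (intro Lim_null_comparison[of "\<lambda>i. T (s i) - T f" "\<lambda>i. K * (\<integral>t. \<bar>s i t - f t\<bar> \<partial>M)"] always_eventually allI)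
          (simp_all only: real_norm_def)
      then show ?thesis by (simp add: LIM_zero_iff)
    qed
    then have "(\<lambda>i. \<integral>t. s i t * g t \<partial>M) \<longlonglongrightarrow> T f" by (simp only: lim.IH)
    ultimately show ?case by (intro LIMSEQ_unique)
  qed
  with g_meas g_le show ?thesis by blast
qed

section \<open>Functionals on the Cesaro space\<close>

context index_weight
begin

lemma CM_dualD:
  assumes "l \<in> CM_dual \<phi>"
  shows "in_CM0 \<phi> f \<Longrightarrow> in_CM0 \<phi> g \<Longrightarrow> l (\<lambda>t. a * f t + b * g t) = a * l f + b * l g"
    and "\<not> in_CM0 \<phi> f \<Longrightarrow> l f = 0"
    and "\<exists>K. \<forall>f. in_CM0 \<phi> f \<longrightarrow> \<bar>l f\<bar> \<le> K * CM_norm \<phi> f"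
  using assms unfolding CM_dual_def by blast+

lemma dual_bound:
  assumes l: "l \<in> CM_dual \<phi>"
  shows "0 \<le> dual_norm \<phi> l" and "in_CM0 \<phi> f \<Longrightarrow> \<bar>l f\<bar> \<le> dual_norm \<phi> l * CM_norm \<phi> f"
proof -
  let ?S = "{K. 0 \<le> K \<and> (\<forall>f. in_CM0 \<phi> f \<longrightarrow> \<bar>l f\<bar> \<le> K * CM_norm \<phi> f)}"
  obtain K where K: "\<And>f. in_CM0 \<phi> f \<Longrightarrow> \<bar>l f\<bar> \<le> K * CM_norm \<phi> f"
    using CM_dualD(3)[OF l] by blast
  have "\<bar>l f\<bar> \<le> max 0 K * CM_norm \<phi> f" if "in_CM0 \<phi> f" for f
    using K[OF that] mult_right_mono[OF max.cobounded2[of K 0] CM_norm_nonneg[of f]] by simp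
  then have ne: "?S \<noteq> {}" by (auto intro!: exI[of _ "max 0 K"])
  show "0 \<le> dual_norm \<phi> l" unfolding dual_norm_def using ne by (intro cInf_greatest) auto
  assume f: "in_CM0 \<phi> f"
  show "\<bar>l f\<bar> \<le> dual_norm \<phi> l * CM_norm \<phi> f"
  proof (cases "CM_norm \<phi> f = 0")
    case True
    then show ?thesis using K[OF f] by simp
  next
    case False
    then have pos: "0 < CM_norm \<phi> f" using CM_norm_nonneg[of f] by simp
    have "\<bar>l f\<bar> / CM_norm \<phi> f \<le> dual_norm \<phi> l"
      unfolding dual_norm_def using f pos by (intro cInf_greatest[OF ne]) (auto simp: field_simps)
    then show ?thesis using pos by (simp add: field_simps)
  qed
qed

lemma dual_norm_almost_attained:
  assumes l: "l \<in> CM_dual \<phi>"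
  obtains z where "in_CM0 \<phi> z" "dual_norm \<phi> l \<le> 2 * \<bar>l z / CM_norm \<phi> z\<bar>"
proof (cases "dual_norm \<phi> l = 0")
  case True
  have "in_CM0 \<phi> (\<lambda>t. t * 0)" by (rule in_CM0_weighted_L1) simp
  with True show ?thesis by (intro that) auto
next
  case False
  then have pos: "0 < dual_norm \<phi> l" using dual_bound(1)[OF l] by simp
  let ?S = "{K. 0 \<le> K \<and> (\<forall>f. in_CM0 \<phi> f \<longrightarrow> \<bar>l f\<bar> \<le> K * CM_norm \<phi> f)}"
  have "dual_norm \<phi> l / 2 \<notin> ?S"
  proof
    assume "dual_norm \<phi> l / 2 \<in> ?S"
    then have "dual_norm \<phi> l \<le> dual_norm \<phi> l / 2"
      by (subst dual_norm_def, intro cInf_lower) (auto intro: bdd_belowI[of _ 0])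
    with pos show False by simp
  qed
  then obtain z where z: "in_CM0 \<phi> z" "dual_norm \<phi> l / 2 * CM_norm \<phi> z < \<bar>l z\<bar>"
    using pos by auto
  have "CM_norm \<phi> z \<noteq> 0" using z dual_bound(2)[OF l z(1)] by auto
  then have "0 < CM_norm \<phi> z" using CM_norm_nonneg[of z] by simp
  with z show ?thesis by (intro that[of z]) (auto simp: field_simps)
qed

definition fnl :: "(real \<Rightarrow> real) \<Rightarrow> (real \<Rightarrow> real) \<Rightarrow> real" where
  "fnl g f = (if in_CM0 \<phi> f then \<integral>t. f t * g t \<partial>M01 else 0)"

text \<open>A bounded density supported in [0,x] sees only F x, which is at most 2 / psi x times the
  norm because 0 < x < 1.\<close>

lemma fnl_dual:
  assumes g[measurable]: "g \<in> borel_measurable M01" and x: "0 < x" "x < 1" and B: "0 \<le> B"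
    and le: "\<And>t. 0 \<le> t \<Longrightarrow> t \<le> 1 \<Longrightarrow> \<bar>g t\<bar> \<le> B * indicator {0..x} t"
  shows "in_CM0 \<phi> f \<Longrightarrow> integrable M01 (\<lambda>t. f t * g t)"
    and "in_CM0 \<phi> f \<Longrightarrow> \<bar>fnl g f\<bar> \<le> B * cum f x"
    and "fnl g \<in> CM_dual \<phi>"
proof -
  have le': "\<bar>f t * g t\<bar> \<le> B * (indicator {0..x} t * \<bar>f t\<bar>)" if "t \<in> space M01" for f t
    using mult_left_mono[OF le[of t], of "\<bar>f t\<bar>"] that by (simp add: abs_mult mult_ac space_restrict_space)
  have int: "integrable M01 (\<lambda>t. f t * g t)" if f: "in_CM0 \<phi> f" for f
  proof (rule Bochner_Integration.integrable_bound)
    have l: "locint f" using f by (simp add: in_CM0_iff)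
    then show "integrable M01 (\<lambda>t. B * (indicator {0..x} t * \<bar>f t\<bar>))"
      using x by (intro integrable_mult_right locintD)
    have [measurable]: "f \<in> borel_measurable M01" using l by (rule locintD)
    show "(\<lambda>t. f t * g t) \<in> borel_measurable M01" by measurable
    show "AE t in M01. norm (f t * g t) \<le> norm (B * (indicator {0..x} t * \<bar>f t\<bar>))"
    proof (rule AE_I2)
      fix t assume "t \<in> space M01"
      from le'[OF this, of f] show "norm (f t * g t) \<le> norm (B * (indicator {0..x} t * \<bar>f t\<bar>))"
        by (metis abs_ge_self order_trans real_norm_def)
    qed
  qed
  then show "in_CM0 \<phi> f \<Longrightarrow> integrable M01 (\<lambda>t. f t * g t)" .
  have bd: "\<bar>fnl g f\<bar> \<le> B * cum f x" if f: "in_CM0 \<phi> f" for f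
  proof -
    have l: "locint f" using f by (simp add: in_CM0_iff)
    have "\<bar>fnl g f\<bar> \<le> (\<integral>t. \<bar>f t * g t\<bar> \<partial>M01)"
      using f integral_abs_bound[of M01 "\<lambda>t. f t * g t"] by (simp add: fnl_def)
    also have "\<dots> \<le> (\<integral>t. B * (indicator {0..x} t * \<bar>f t\<bar>) \<partial>M01)"
      using x l by (intro integral_mono integrable_abs int f integrable_mult_right locintD le')
    also have "\<dots> = B * cum f x" by (simp add: cum_def)
    finally show ?thesis .
  qed
  then show "in_CM0 \<phi> f \<Longrightarrow> \<bar>fnl g f\<bar> \<le> B * cum f x" .
  have "\<bar>fnl g f\<bar> \<le> (B * (2 / psi x)) * CM_norm \<phi> f" if f: "in_CM0 \<phi> f" for f
  proof -
    have "cum f x \<le> 2 / psi x * CM_norm \<phi> f"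
      using cum_le_CM_norm[OF f x] psi_pos[OF x] by (simp add: field_simps)
    with bd[OF f] B show ?thesis
      by (metis (no_types, opaque_lifting) mult.assoc mult_left_mono order_trans)
  qed
  moreover have "fnl g (\<lambda>t. a * f t + b * h t) = a * fnl g f + b * fnl g h" if "in_CM0 \<phi> f" "in_CM0 \<phi> h" for f h a b
  proof -
    have "(\<integral>t. (a * f t + b * h t) * g t \<partial>M01) = (\<integral>t. a * (f t * g t) + b * (h t * g t) \<partial>M01)"
      by (simp add: algebra_simps)
    also have "\<dots> = a * (\<integral>t. f t * g t \<partial>M01) + b * (\<integral>t. h t * g t \<partial>M01)"
      using int[OF that(1)] int[OF that(2)] by simp
    finally show ?thesis using that in_CM0_lincomb[OF that] by (simp add: fnl_def)
  qed
  moreover have "fnl g f = 0" if "\<not> in_CM0 \<phi> f" for f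
    using that by (simp add: fnl_def)
  ultimately show "fnl g \<in> CM_dual \<phi>"
    unfolding CM_dual_def by blast
qed

text \<open>Composing \<open>y\<close> with the embedding of L^1 gives a bounded density
  \<open>g\<close>, and G t = g t / t. A general \<open>f\<close> is not t times an integrable
  function, but its truncations to [a_n, 1 - a_n] are, and they converge to \<open>f\<close> in norm
  because \<open>psi\<close> times F vanishes at the endpoints.\<close>

lemma dual_density:
  assumes y: "y \<in> CM_dual \<phi>"
  shows "\<exists>G\<in>borel_measurable M01. (\<forall>t. 0 < t \<longrightarrow> \<bar>G t\<bar> \<le> C * \<phi> 1 * dual_norm \<phi> y / t) \<and>
     (\<forall>f. in_CM0 \<phi> f \<longrightarrow> integrable M01 (\<lambda>t. f t * G t) \<and> y f = (\<integral>t. f t * G t \<partial>M01))"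
proof -
  define K where "K = C * \<phi> 1 * dual_norm \<phi> y"
  define T where "T h = y (\<lambda>t. t * h t)" for h
  have K0: "0 \<le> K" using C_pos nonneg[of 1] dual_bound(1)[OF y] by (simp add: K_def)
  have Tlin: "T (\<lambda>t. a * f t + b * g t) = a * T f + b * T g" if "integrable M01 f" "integrable M01 g" for f g a b
    using CM_dualD(1)[OF y in_CM0_weighted_L1(1)[OF that(1)] in_CM0_weighted_L1(1)[OF that(2)], of a b]
    by (simp add: T_def algebra_simps)
  have Tb: "\<bar>T f\<bar> \<le> K * (\<integral>t. \<bar>f t\<bar> \<partial>M01)" if "integrable M01 f" for f
  proof -
    have "\<bar>T f\<bar> \<le> dual_norm \<phi> y * CM_norm \<phi> (\<lambda>t. t * f t)"
      unfolding T_def by (intro dual_bound(2)[OF y] in_CM0_weighted_L1(1)[OF that])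
    also have "\<dots> \<le> dual_norm \<phi> y * (C * \<phi> 1 * (\<integral>t. \<bar>f t\<bar> \<partial>M01))"
      by (intro mult_left_mono in_CM0_weighted_L1(2)[OF that] dual_bound(1)[OF y])
    finally show ?thesis by (simp add: K_def mult_ac)
  qed
  from L1_functional_density[OF finite_M01 K0 Tlin Tb] obtain g where g[measurable]: "g \<in> borel_measurable M01"
    and gK: "\<And>t. \<bar>g t\<bar> \<le> K" and Tg: "\<And>f. integrable M01 f \<Longrightarrow> T f = (\<integral>t. f t * g t \<partial>M01)"
    by blast
  define G where "G t = g t / t" for t
  have G[measurable]: "G \<in> borel_measurable M01" unfolding G_def by measurable
  have "integrable M01 (\<lambda>t. f t * G t) \<and> y f = (\<integral>t. f t * G t \<partial>M01)" if f: "in_CM0 \<phi> f" for f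
  proof -
    let ?Q = "dual_norm \<phi> y * (C * (2 * CM_norm \<phi> f))"
    have l: "locint f" and v: "vanishing f" using f by (auto simp: in_CM0_iff)
    have [measurable]: "f \<in> borel_measurable M01" using l by (rule locintD)
    define a where "a n = 1 / real (n + 3)" for n
    have a: "0 < a n" "a n < 1/2" for n by (auto simp: a_def divide_simps)
    have a_lim: "a \<longlonglongrightarrow> 0"
      unfolding a_def using LIMSEQ_ignore_initial_segment[OF lim_1_over_n, of 3] by simp
    define E where "E n = {a n..1 - a n}" for n
    have trunc: "integrable M01 (\<lambda>t. indicator (E n) t * (f t / t))" for n
    proof (rule Bochner_Integration.integrable_bound)
      show "integrable M01 (\<lambda>t. (1 / a n) * (indicator {0..1 - a n} t * \<bar>f t\<bar>))"
        using a[of n] by (intro integrable_mult_right locintD l) auto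
      show "AE t in M01. norm (indicator (E n) t * (f t / t)) \<le> norm (1 / a n * (indicator {0..1 - a n} t * \<bar>f t\<bar>))"
      proof (rule AE_I2)
        fix t :: real
        have "\<bar>f t\<bar> / \<bar>t\<bar> \<le> \<bar>f t\<bar> / a n" if "a n \<le> t" using that a[of n] by (intro divide_left_mono) auto
        then show "norm (indicator (E n) t * (f t / t)) \<le> norm (1 / a n * (indicator {0..1 - a n} t * \<bar>f t\<bar>))"
          using a[of n] by (auto simp: indicator_def E_def)
      qed
    qed (simp add: E_def)
    have tr: "T (\<lambda>t. indicator (E n) t * (f t / t)) = y (\<lambda>t. indicator (E n) t * f t)" for n
    proof -
      have "(\<lambda>t. t * (indicator (E n) t * (f t / t))) = (\<lambda>t. indicator (E n) t * f t)"
        using a[of n] by (auto simp: fun_eq_iff indicator_def E_def)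
      then show ?thesis by (simp add: T_def)
    qed
    have absint: "(\<integral>t. indicator (E n) t * \<bar>f t * G t\<bar> \<partial>M01) \<le> ?Q" for n
    proof -
      \<comment> \<open>With this sign the integral of \<bar>f G\<bar> over \<open>E n\<close> is
        the value of \<open>y\<close> at a function dominated by \<bar>f\<bar>, hence bounded
        uniformly in n.\<close>
      define s where "s t = sgn (f t * G t)" for t
      have [measurable]: "s \<in> borel_measurable M01" unfolding s_def by measurable
      have sf: "in_CM0 \<phi> (\<lambda>t. indicator (E n) t * s t * f t)"
      proof (rule in_CM0_solid[OF f])
        show "on01 (\<lambda>t. indicator (E n) t * s t * f t)" unfolding on01_def E_def by measurable
        show "\<bar>indicator (E n) t * s t * f t\<bar> \<le> \<bar>f t\<bar>" for t
          by (auto simp: s_def indicator_def abs_mult sgn_if)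
      qed
      have i: "integrable M01 (\<lambda>t. s t * (indicator (E n) t * (f t / t)))"
        by (rule Bochner_Integration.integrable_bound[OF trunc[of n]])
          (auto simp: s_def E_def abs_mult sgn_if)
      have "(\<integral>t. indicator (E n) t * \<bar>f t * G t\<bar> \<partial>M01) = (\<integral>t. s t * (indicator (E n) t * (f t / t)) * g t \<partial>M01)"
        by (rule Bochner_Integration.integral_cong) (auto simp: s_def G_def sgn_if indicator_def abs_if)
      also have "\<dots> = T (\<lambda>t. s t * (indicator (E n) t * (f t / t)))" by (rule Tg[OF i, symmetric])
      also have "\<dots> = y (\<lambda>t. indicator (E n) t * s t * f t)"
      proof -
        have "(\<lambda>t. t * (s t * (indicator (E n) t * (f t / t)))) = (\<lambda>t. indicator (E n) t * s t * f t)"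
          using a[of n] by (auto simp: fun_eq_iff indicator_def E_def)
        then show ?thesis by (simp add: T_def)
      qed
      also have "\<dots> \<le> dual_norm \<phi> y * CM_norm \<phi> (\<lambda>t. indicator (E n) t * s t * f t)"
        using dual_bound(2)[OF y sf] by simp
      also have "\<dots> \<le> ?Q"
      proof (intro mult_left_mono dual_bound(1)[OF y] CM_norm_le[OF sf])
        fix x :: real assume x: "0 < x" "x < 1"
        have "psi x * cum (\<lambda>t. indicator (E n) t * s t * f t) x \<le> psi x * cum f x"
          using psi_pos[OF x] x sf
          by (intro mult_left_mono locint_solid(2)[OF l])
            (auto simp: in_CM0_iff s_def indicator_def abs_mult sgn_if dest: locintD)
        with cum_le_CM_norm[OF f x] show "psi x * cum (\<lambda>t. indicator (E n) t * s t * f t) x \<le> 2 * CM_norm \<phi> f" by linarith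
      qed (simp add: CM_norm_nonneg)
      finally show ?thesis .
    qed
    have ev: "\<forall>\<^sub>F n in sequentially. t \<in> E n" if "0 < t" "t < 1" for t
    proof -
      have "\<forall>\<^sub>F n in sequentially. a n < min t (1 - t)"
        using a_lim that by (intro order_tendstoD) auto
      then show ?thesis by eventually_elim (auto simp: E_def)
    qed
    have E_int: "integrable M01 (\<lambda>t. indicator (E n) t * (f t * G t))" for n
    proof -
      have "integrable M01 (\<lambda>t. K * (indicator (E n) t * (f t / t)))" by (intro integrable_mult_right trunc)
      then show ?thesis
      proof (rule Bochner_Integration.integrable_bound)
        show "AE t in M01. norm (indicator (E n) t * (f t * G t)) \<le> norm (K * (indicator (E n) t * (f t / t)))"
        proof (rule AE_I2)
          fix t
          have "\<bar>f t / t\<bar> * \<bar>g t\<bar> \<le> \<bar>f t / t\<bar> * K" by (intro mult_left_mono gK) simp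
          then show "norm (indicator (E n) t * (f t * G t)) \<le> norm (K * (indicator (E n) t * (f t / t)))"
            using K0 by (auto simp: indicator_def G_def abs_mult mult_ac)
        qed
      qed (simp add: E_def)
    qed
    \<comment> \<open>Fatou's lemma passes the uniform bound over the sets \<open>E n\<close> on to
      (0,1).\<close>
    have fin: "(\<integral>\<^sup>+ t. ennreal \<bar>f t * G t\<bar> \<partial>M01) \<le> ennreal (?Q)"
    proof -
      have "(\<integral>\<^sup>+ t. ennreal \<bar>f t * G t\<bar> \<partial>M01) \<le> (\<integral>\<^sup>+ t. liminf (\<lambda>n. ennreal (indicator (E n) t * \<bar>f t * G t\<bar>)) \<partial>M01)"
      proof (rule nn_integral_mono_AE)
        show "AE t in M01. ennreal \<bar>f t * G t\<bar> \<le> liminf (\<lambda>n. ennreal (indicator (E n) t * \<bar>f t * G t\<bar>))"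
          using AE_M01
        proof eventually_elim
          case (elim t)
          have "\<forall>\<^sub>F n in sequentially. ennreal \<bar>f t * G t\<bar> \<le> ennreal (indicator (E n) t * \<bar>f t * G t\<bar>)"
            using elim by (intro eventually_mono[OF ev]) auto
          then show ?case by (rule Liminf_bounded)
        qed
      qed
      also have "\<dots> \<le> liminf (\<lambda>n. \<integral>\<^sup>+ t. ennreal (indicator (E n) t * \<bar>f t * G t\<bar>) \<partial>M01)"
        by (rule nn_integral_liminf) (simp add: E_def)
      also have "\<dots> \<le> liminf (\<lambda>n. ennreal (?Q))"
      proof (intro Liminf_mono always_eventually allI)
        fix n
        have "integrable M01 (\<lambda>t. indicator (E n) t * \<bar>f t * G t\<bar>)"
          using integrable_abs[OF E_int[of n]] by (simp add: abs_mult)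
        then have "(\<integral>\<^sup>+ t. ennreal (indicator (E n) t * \<bar>f t * G t\<bar>) \<partial>M01) = ennreal (\<integral>t. indicator (E n) t * \<bar>f t * G t\<bar> \<partial>M01)"
          by (intro nn_integral_eq_integral) auto
        also have "\<dots> \<le> ennreal (?Q)" by (intro ennreal_leI absint)
        finally show "(\<integral>\<^sup>+ t. ennreal (indicator (E n) t * \<bar>f t * G t\<bar>) \<partial>M01) \<le> ennreal (?Q)" .
      qed
      also have "\<dots> = ennreal (?Q)" by (simp add: Liminf_const)
      finally show ?thesis .
    qed
    have int: "integrable M01 (\<lambda>t. f t * G t)"
      by (rule integrableI_bounded) (use fin in \<open>auto intro: le_less_trans\<close>)
    have lim1: "(\<lambda>n. \<integral>t. indicator (E n) t * (f t * G t) \<partial>M01) \<longlonglongrightarrow> (\<integral>t. f t * G t \<partial>M01)"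
    proof (rule integral_dominated_convergence[where w = "\<lambda>t. \<bar>f t * G t\<bar>"])
      show "AE t in M01. (\<lambda>n. indicator (E n) t * (f t * G t)) \<longlonglongrightarrow> f t * G t"
        using AE_M01
      proof eventually_elim
        case (elim t)
        have "\<forall>\<^sub>F n in sequentially. f t * G t = indicator (E n) t * (f t * G t)"
          using elim by (intro eventually_mono[OF ev]) auto
        then show ?case by (rule Lim_transform_eventually[OF tendsto_const])
      qed
    qed (use int in \<open>auto intro!: AE_I2 simp: E_def indicator_def\<close>)
    have eq: "(\<integral>t. indicator (E n) t * (f t * G t) \<partial>M01) = y (\<lambda>t. indicator (E n) t * f t)" for n
    proof -
      have "(\<integral>t. indicator (E n) t * (f t * G t) \<partial>M01) = (\<integral>t. indicator (E n) t * (f t / t) * g t \<partial>M01)"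
        by (simp add: G_def mult_ac)
      then show ?thesis using Tg[OF trunc[of n]] tr[of n] by simp
    qed
    have lim2: "(\<lambda>n. y (\<lambda>t. indicator (E n) t * f t)) \<longlonglongrightarrow> y f"
    proof -
      let ?r = "\<lambda>n t. indicator (- E n) t * f t"
      let ?q = "\<lambda>n t. indicator (E n) t * f t"
      have q: "in_CM0 \<phi> (?q n)" for n
        by (rule in_CM0_solid[OF f]) (auto simp: on01_def E_def indicator_def)
      have r: "in_CM0 \<phi> (?r n)" for n
      proof (rule in_CM0_solid[OF f])
        have "(?r n) = (\<lambda>t. f t - indicator {a n..1 - a n} t * f t)"
          by (auto simp: E_def indicator_def fun_eq_iff)
        then show "on01 (?r n)" unfolding on01_def by simp
      qed (auto simp: indicator_def)
      have split: "y f = y (?q n) + y (?r n)" for n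
      proof -
        have "(\<lambda>t. 1 * ?q n t + 1 * ?r n t) = f" by (auto simp: fun_eq_iff indicator_def)
        with CM_dualD(1)[OF y q[of n] r[of n], of 1 1] show ?thesis by simp
      qed
      have "(\<lambda>n. y (?r n)) \<longlonglongrightarrow> 0"
      proof (rule LIMSEQ_I)
        fix e :: real assume e: "0 < e"
        define e' where "e' = e / 2 / (dual_norm \<phi> y * C + 1)"
        have d0: "0 \<le> dual_norm \<phi> y * C" using dual_bound(1)[OF y] C_pos by simp
        then have e': "0 < e'" using e by (simp add: e'_def)
        have e'': "dual_norm \<phi> y * (C * e') < e"
        proof -
          have "dual_norm \<phi> y * (C * e') = dual_norm \<phi> y * C * (e / 2 / (dual_norm \<phi> y * C + 1))"
            by (simp add: e'_def)
          also have "\<dots> \<le> e / 2" by (rule weighted_frac_le[OF half_gt_zero[OF e] d0])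
          finally show ?thesis using e by linarith
        qed
        obtain b where b: "b > 0" "\<And>x. 0 < x \<Longrightarrow> x < 1 \<Longrightarrow> x < b \<or> 1 - b < x \<Longrightarrow> psi x * cum f x \<le> e'"
          using v[unfolded vanishing_def, rule_format, OF e'] by blast
        \<comment> \<open>In the middle the remainder vanishes, so its F keeps the value taken at
          \<open>a n\<close>, while \<open>psi\<close> there is at most psi (a n). The estimate is
          thus referred back to a point near 0.\<close>
        have small_tail: "psi x * cum (?r n) x \<le> e'" if n: "a n < b" and x: "0 < x" "x < 1" for n x
        proof (cases "x < b \<or> 1 - b < x")
          case True
          have "cum (?r n) x \<le> cum f x"
            using x r[of n] by (intro locint_solid(2)[OF l]) (auto simp: in_CM0_iff indicator_def dest: locintD)
          then have "psi x * cum (?r n) x \<le> psi x * cum f x"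
            using psi_pos[OF x] by (intro mult_left_mono) auto
          with b(2)[OF x True] show ?thesis by linarith
        next
          case False
          then have an: "a n \<le> x" "x \<le> 1 - a n" using n by auto
          have "cum (?r n) x = cum (?r n) (a n)"
            using an by (intro cum_eq_of_zero) (auto simp: E_def)
          also have "\<dots> \<le> cum f (a n)"
            using a[of n] r[of n] by (intro locint_solid(2)[OF l]) (auto simp: in_CM0_iff indicator_def dest: locintD)
          finally have "psi x * cum (?r n) x \<le> psi (a n) * cum f (a n)"
          proof (rule mult_mono[rotated])
            have "psi x \<le> \<phi> x / x" unfolding psi_def using x by (intro divide_right_mono) auto
            also have "\<dots> \<le> \<phi> (a n) / a n" using an a[of n] x by (intro quasi) auto
            also have "\<dots> = psi (a n)" using mono[of "a n" "1 - a n"] a[of n] by (simp add: psi_def)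
            finally show "psi x \<le> psi (a n)" .
          qed (use psi_pos[of "a n"] a[of n] cum_nonneg in auto)
          with b(2)[of "a n"] a[of n] n show ?thesis by auto
        qed
        have "\<forall>\<^sub>F n in sequentially. a n < b" using a_lim b(1) by (rule order_tendstoD)
        then obtain no where no: "\<And>n. n \<ge> no \<Longrightarrow> a n < b" by (auto simp: eventually_sequentially)
        show "\<exists>no. \<forall>n\<ge>no. norm (y (?r n) - 0) < e"
        proof (intro exI[of _ no] allI impI)
          fix n assume n: "no \<le> n"
          have "\<bar>y (?r n)\<bar> \<le> dual_norm \<phi> y * CM_norm \<phi> (?r n)" by (rule dual_bound(2)[OF y r])
          also have "\<dots> \<le> dual_norm \<phi> y * (C * e')"
            using e' n by (intro mult_left_mono dual_bound(1)[OF y] CM_norm_le[OF r] small_tail no) auto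
          finally show "norm (y (?r n) - 0) < e" using e'' by simp
        qed
      qed
      then have "(\<lambda>n. y f - y (?r n)) \<longlonglongrightarrow> y f - 0" by (intro tendsto_intros)
      moreover have "y (?q n) = y f - y (?r n)" for n using split[of n] by linarith
      ultimately show ?thesis by simp
    qed
    have "y f = (\<integral>t. f t * G t \<partial>M01)"
      by (rule LIMSEQ_unique[OF lim2 lim1[unfolded eq]])
    with int show ?thesis by blast
  qed
  moreover have "\<bar>G t\<bar> \<le> K / t" if "0 < t" for t
    using gK[of t] that by (simp add: G_def divide_right_mono)
  ultimately show ?thesis using G unfolding K_def by blast
qed

end

section \<open>Weakly null sequences\<close>

context index_weight
begin

lemma dual_series:
  assumes l: "\<And>j. l j \<in> CM_dual \<phi>" and b: "\<And>j f. in_CM0 \<phi> f \<Longrightarrow> \<bar>l j f\<bar> \<le> K * CM_norm \<phi> f"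
    and c: "summable (\<lambda>j. \<bar>c j\<bar>)"
  shows "(\<lambda>f. \<Sum>j. c j * l j f) \<in> CM_dual \<phi>"
proof -
  have le: "\<bar>c j * l j f\<bar> \<le> \<bar>c j\<bar> * (K * CM_norm \<phi> f)" if "in_CM0 \<phi> f" for j f
    using b[OF that] by (simp add: abs_mult mult_left_mono)
  have sa: "summable (\<lambda>j. \<bar>c j * l j f\<bar>)" if "in_CM0 \<phi> f" for f
    by (rule summable_comparison_test[OF _ summable_mult2[OF c]]) (use le[OF that] in auto)
  have s: "summable (\<lambda>j. c j * l j f)" if "in_CM0 \<phi> f" for f
    by (rule summable_rabs_cancel[OF sa[OF that]])
  have "(\<Sum>j. c j * l j (\<lambda>t. a * f t + b * g t)) = a * (\<Sum>j. c j * l j f) + b * (\<Sum>j. c j * l j g)"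
    if "in_CM0 \<phi> f" "in_CM0 \<phi> g" for f g a b
  proof -
    have "(\<Sum>j. c j * l j (\<lambda>t. a * f t + b * g t)) = (\<Sum>j. a * (c j * l j f) + b * (c j * l j g))"
      using CM_dualD(1)[OF l that] by (simp add: algebra_simps)
    also have "\<dots> = (\<Sum>j. a * (c j * l j f)) + (\<Sum>j. b * (c j * l j g))"
      by (rule suminf_add[symmetric]) (intro summable_mult s that)+
    also have "\<dots> = a * (\<Sum>j. c j * l j f) + b * (\<Sum>j. c j * l j g)"
      by (simp add: suminf_mult[OF s] that)
    finally show ?thesis .
  qed
  moreover have "\<bar>\<Sum>j. c j * l j f\<bar> \<le> (\<Sum>j. \<bar>c j\<bar>) * K * CM_norm \<phi> f" if "in_CM0 \<phi> f" for f
  proof -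
    have "\<bar>\<Sum>j. c j * l j f\<bar> \<le> (\<Sum>j. \<bar>c j * l j f\<bar>)" by (rule summable_rabs[OF sa[OF that]])
    also have "\<dots> \<le> (\<Sum>j. \<bar>c j\<bar> * (K * CM_norm \<phi> f))"
      by (intro suminf_le le sa that summable_mult2 c)
    also have "\<dots> = (\<Sum>j. \<bar>c j\<bar>) * K * CM_norm \<phi> f" by (simp add: suminf_mult2[OF c, symmetric])
    finally show ?thesis .
  qed
  moreover have "(\<Sum>j. c j * l j f) = 0" if "\<not> in_CM0 \<phi> f" for f
    using CM_dualD(2)[OF l that] by simp
  ultimately show ?thesis unfolding CM_dual_def by blast
qed

text \<open>The hypotheses describe a weakly unconditionally Cauchy series. It need not converge in
  the space, but its sum always exists as a functional on the dual.\<close>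

lemma bidual_series:
  assumes sa: "\<And>l. l \<in> CM_dual \<phi> \<Longrightarrow> summable (\<lambda>j. \<bar>c j * l (z j)\<bar>)"
    and le: "\<And>l. l \<in> CM_dual \<phi> \<Longrightarrow> (\<Sum>j. \<bar>c j * l (z j)\<bar>) \<le> K * dual_norm \<phi> l"
  shows "(\<lambda>l. \<Sum>j. c j * l (z j)) \<in> CM_bidual \<phi>"
  unfolding CM_bidual_def
proof (intro CollectI conjI allI impI exI ballI)
  fix l1 l2 :: "(real \<Rightarrow> real) \<Rightarrow> real" and a b
  assume l: "l1 \<in> CM_dual \<phi>" "l2 \<in> CM_dual \<phi>"
  note s = l[THEN sa, THEN summable_rabs_cancel]
  have "(\<Sum>j. c j * (a * l1 (z j) + b * l2 (z j))) = (\<Sum>j. a * (c j * l1 (z j)) + b * (c j * l2 (z j)))"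
    by (simp add: algebra_simps)
  also have "\<dots> = (\<Sum>j. a * (c j * l1 (z j))) + (\<Sum>j. b * (c j * l2 (z j)))"
    by (rule suminf_add[symmetric]) (intro summable_mult s)+
  finally show "(\<Sum>j. c j * (a * l1 (z j) + b * l2 (z j))) = a * (\<Sum>j. c j * l1 (z j)) + b * (\<Sum>j. c j * l2 (z j))"
    by (simp only: suminf_mult[OF s(1)] suminf_mult[OF s(2)])
next
  fix l assume l: "l \<in> CM_dual \<phi>"
  show "\<bar>\<Sum>j. c j * l (z j)\<bar> \<le> K * dual_norm \<phi> l"
    by (rule order_trans[OF summable_rabs[OF sa[OF l]] le[OF l]])
qed

text \<open>Uniform boundedness by signed series of almost norming functionals: weak convergence is
  applied to each such series, whose values along the sequence are therefore bounded.\<close>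

lemma weakly_null_bounded:
  assumes x: "weakly_null \<phi> x"
  obtains K where "0 < K" "\<And>n s. 0 < s \<Longrightarrow> s < 1 \<Longrightarrow> psi s * cum (x n) s \<le> K"
proof -
  have xX: "in_CM0 \<phi> (x n)" for n using x by (simp add: weakly_null_def)
  define P where "P n = (SUP s\<in>{0<..<1}. psi s * cum (x n) s)" for n
  have bdd: "bdd_above ((\<lambda>s. psi s * cum (x n) s) ` {0<..<1})" for n
    using cum_le_CM_norm[OF xX[of n]] by (intro bdd_aboveI2[of _ _ "2 * CM_norm \<phi> (x n)"]) auto
  have leP: "psi s * cum (x n) s \<le> P n" if "0 < s" "s < 1" for n s
    unfolding P_def using that by (intro cSUP_upper bdd) auto
  have P0: "0 \<le> P n" for n
  proof -
    have "0 \<le> psi (1/2) * cum (x n) (1/2)"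
      using psi_pos[of "1/2"] cum_nonneg by (intro mult_nonneg_nonneg) auto
    also have "\<dots> \<le> P n" by (rule leP) auto
    finally show ?thesis .
  qed
  have "\<exists>s. 0 < s \<and> s < 1 \<and> P n \<le> 2 * (psi s * cum (x n) s)" for n
  proof (cases "P n = 0")
    case True
    then show ?thesis using psi_pos[of "1/2"] cum_nonneg[of "x n" "1/2"] by (intro exI[of _ "1/2"]) auto
  next
    case False
    then have "P n / 2 < (SUP s\<in>{0<..<1}. psi s * cum (x n) s)" using P0[of n] by (simp flip: P_def)
    then obtain s where "s \<in> {0<..<1}" "P n / 2 < psi s * cum (x n) s"
      using less_cSUP_iff[OF _ bdd, of "P n / 2" n] by auto
    then show ?thesis by (intro exI[of _ s]) auto
  qed
  then obtain s where s: "\<And>n. 0 < s n" "\<And>n. s n < 1" "\<And>n. P n \<le> 2 * (psi (s n) * cum (x n) (s n))"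
    by metis
  \<comment> \<open>Almost norming for \<open>x n\<close>: at \<open>x n\<close> the functional has
    the value psi (s n) * cum (x n) (s n), at least half of the supremum, and on the whole space its
    norm is at most 2.\<close>
  define g where "g n t = psi (s n) * indicator {0..s n} t * sgn (x n t)" for n t
  have [measurable]: "x n \<in> borel_measurable M01" for n
    by (rule in_CM0_measurable[OF xX])
  have g_meas: "g n \<in> borel_measurable M01" for n unfolding g_def by measurable
  have g_le: "\<bar>g n t\<bar> \<le> psi (s n) * indicator {0..s n} t" for n t
    using psi_pos[OF s(1,2)[of n]] by (auto simp: g_def abs_mult indicator_def sgn_if)
  note fd = fnl_dual[OF g_meas s(1) s(2) less_imp_le[OF psi_pos[OF s(1) s(2)]] g_le]
  have "\<exists>K. \<forall>n. P n \<le> K"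
  proof (rule bounded_of_bounded_signed_series[where b = "\<lambda>n j. fnl (g j) (x n)"])
    show "\<bar>fnl (g j) (x n)\<bar> \<le> P n" for n j
      using fd(2)[OF xX[of n], of j] leP[OF s(1,2)[of j], of n] by linarith
    show "P n \<le> 2 * \<bar>fnl (g n) (x n)\<bar>" for n
    proof -
      have "x n t * g n t = psi (s n) * (indicator {0..s n} t * \<bar>x n t\<bar>)" for t
        by (simp add: g_def sgn_if abs_if)
      then have "fnl (g n) (x n) = (\<integral>t. psi (s n) * (indicator {0..s n} t * \<bar>x n t\<bar>) \<partial>M01)"
        using xX[of n] by (simp add: fnl_def)
      also have "\<dots> = psi (s n) * cum (x n) (s n)" by (simp add: cum_def)
      finally show ?thesis using s(3)[of n] by linarith
    qed
    fix \<sigma> :: "nat \<Rightarrow> real" and r assume \<sigma>: "\<forall>j. \<bar>\<sigma> j\<bar> \<le> 1"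
    have "(\<lambda>f. \<Sum>j. ((1/4)^j * \<sigma> j) * fnl (g (r j)) f) \<in> CM_dual \<phi>"
    proof (rule dual_series[where K = 2])
      show "fnl (g (r j)) \<in> CM_dual \<phi>" for j by (rule fd(3))
      show "\<bar>fnl (g (r j)) f\<bar> \<le> 2 * CM_norm \<phi> f" if "in_CM0 \<phi> f" for j f
        using fd(2)[OF that, of "r j"] cum_le_CM_norm[OF that s(1,2)[of "r j"]] by linarith
      show "summable (\<lambda>j. \<bar>(1/4)^j * \<sigma> j\<bar>)"
      proof (rule summable_comparison_test)
        show "summable (\<lambda>j. (1/4)^j :: real)" by (simp add: summable_geometric)
        show "\<exists>N. \<forall>n\<ge>N. norm \<bar>(1 / 4) ^ n * \<sigma> n\<bar> \<le> (1 / 4) ^ n"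
          using \<sigma> by (auto simp: abs_mult power_abs intro!: mult_left_le)
      qed
    qed
    moreover have "\<forall>l\<in>CM_dual \<phi>. (\<lambda>n. l (x n)) \<longlonglongrightarrow> 0"
      using x by (simp add: weakly_null_def)
    ultimately have "(\<lambda>n. \<Sum>j. ((1/4)^j * \<sigma> j) * fnl (g (r j)) (x n)) \<longlonglongrightarrow> 0"
      by (rule bspec[rotated])
    then show "Bseq (\<lambda>n. \<Sum>j. (1/4)^j * \<sigma> j * fnl (g (r j)) (x n))"
      by (intro convergent_imp_Bseq convergentI)
  qed
  then obtain K where "\<And>n. P n \<le> K" by blast
  then have "psi s * cum (x n) s \<le> max 1 K" if "0 < s" "s < 1" for n s
    using leP[OF that, of n] by (meson max.coboundedI2 order_trans)
  then show thesis by (intro that[of "max 1 K"]) auto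
qed

text \<open>The same argument one level higher: evaluations at normalised, almost norming elements
  take the place of the functionals, and the signed series lie in the bidual.\<close>

lemma weakly_null_dual_bounded:
  assumes y: "weakly_null_dual \<phi> y"
  obtains K where "0 < K" "\<And>n. dual_norm \<phi> (y n) \<le> K"
proof -
  have yX: "y n \<in> CM_dual \<phi>" for n using y by (simp add: weakly_null_dual_def)
  have "\<forall>n. \<exists>z. in_CM0 \<phi> z \<and> dual_norm \<phi> (y n) \<le> 2 * \<bar>y n z / CM_norm \<phi> z\<bar>"
    using dual_norm_almost_attained[OF yX] by metis
  then obtain z where z: "\<And>n. in_CM0 \<phi> (z n)" "\<And>n. dual_norm \<phi> (y n) \<le> 2 * \<bar>y n (z n) / CM_norm \<phi> (z n)\<bar>"
    by metis
  define b where "b l j = l (z j) / CM_norm \<phi> (z j)" for l :: "(real \<Rightarrow> real) \<Rightarrow> real" and j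
  have ble: "\<bar>b l j\<bar> \<le> dual_norm \<phi> l" if l: "l \<in> CM_dual \<phi>" for l j
  proof (cases "CM_norm \<phi> (z j) = 0")
    case True
    then show ?thesis using dual_bound(1)[OF l] by (simp add: b_def)
  next
    case False
    then have "0 < CM_norm \<phi> (z j)" using CM_norm_nonneg[of "z j"] by simp
    then show ?thesis using dual_bound(2)[OF l z(1)[of j]] by (simp add: b_def field_simps)
  qed
  have "\<exists>K. \<forall>n. dual_norm \<phi> (y n) \<le> K"
  proof (rule bounded_of_bounded_signed_series[where b = "\<lambda>n j. b (y n) j"])
    show "\<bar>b (y n) j\<bar> \<le> dual_norm \<phi> (y n)" for n j by (rule ble[OF yX])
    show "dual_norm \<phi> (y n) \<le> 2 * \<bar>b (y n) n\<bar>" for n using z(2) by (simp add: b_def)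
    fix \<sigma> :: "nat \<Rightarrow> real" and r assume \<sigma>: "\<forall>j. \<bar>\<sigma> j\<bar> \<le> 1"
    define c where "c j = (1/4)^j * \<sigma> j / CM_norm \<phi> (z (r j))" for j
    have c: "(1/4)^j * \<sigma> j * b l (r j) = c j * l (z (r j))" for l j by (simp add: b_def c_def)
    have geo: "summable (\<lambda>j. (1/4)^j :: real)" by (simp add: summable_geometric)
    have le: "\<bar>c j * l (z (r j))\<bar> \<le> (1/4)^j * dual_norm \<phi> l" if "l \<in> CM_dual \<phi>" for l j
    proof -
      have "\<bar>\<sigma> j\<bar> * \<bar>b l (r j)\<bar> \<le> 1 * dual_norm \<phi> l" using \<sigma> ble[OF that] by (intro mult_mono) auto
      then show ?thesis by (simp add: abs_mult power_abs mult.assoc flip: c)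
    qed
    have sa: "summable (\<lambda>j. \<bar>c j * l (z (r j))\<bar>)" if "l \<in> CM_dual \<phi>" for l
      by (rule summable_comparison_test[OF _ summable_mult2[OF geo]]) (use le[OF that] in auto)
    have "(\<lambda>l. \<Sum>j. c j * l (z (r j))) \<in> CM_bidual \<phi>"
    proof (rule bidual_series[OF sa])
      fix l assume l: "l \<in> CM_dual \<phi>"
      have "(\<Sum>j. \<bar>c j * l (z (r j))\<bar>) \<le> (\<Sum>j. (1/4)^j * dual_norm \<phi> l)"
        by (intro suminf_le le sa l summable_mult2 geo)
      also have "\<dots> = (\<Sum>j. (1/4)^j) * dual_norm \<phi> l" by (rule suminf_mult2[OF geo, symmetric])
      finally show "(\<Sum>j. \<bar>c j * l (z (r j))\<bar>) \<le> (\<Sum>j. (1/4)^j) * dual_norm \<phi> l" .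
    qed
    moreover have "\<forall>L\<in>CM_bidual \<phi>. (\<lambda>n. L (y n)) \<longlonglongrightarrow> 0"
      using y by (simp add: weakly_null_dual_def)
    ultimately have "(\<lambda>n. \<Sum>j. c j * y n (z (r j))) \<longlonglongrightarrow> 0"
      by (rule bspec[rotated])
    then show "Bseq (\<lambda>n. \<Sum>j. (1/4)^j * \<sigma> j * b (y n) (r j))"
      unfolding c by (intro convergent_imp_Bseq convergentI)
  qed
  then obtain K where "\<And>n. dual_norm \<phi> (y n) \<le> K" by blast
  then have "dual_norm \<phi> (y n) \<le> max 1 K" for n by (simp add: max.coboundedI2)
  then show thesis by (intro that[of "max 1 K"]) auto
qed

text \<open>A substitute for a weak-star cluster point of a bounded sequence, obtained by applying
  the generalised limit to the numbers l (h m).\<close>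

lemma bidual_limit:
  assumes h: "\<And>m. in_CM0 \<phi> (h m)" "\<And>m. CM_norm \<phi> (h m) \<le> K"
  obtains L where "L \<in> CM_bidual \<phi>"
    "\<And>l c. l \<in> CM_dual \<phi> \<Longrightarrow> \<forall>\<^sub>F m in sequentially. c \<le> l (h m) \<Longrightarrow> c \<le> L l"
proof -
  obtain \<Lambda> :: "(nat \<Rightarrow> real) \<Rightarrow> real" where
    lin: "\<And>s t a b. Bseq s \<Longrightarrow> Bseq t \<Longrightarrow> \<Lambda> (\<lambda>n. a * s n + b * t n) = a * \<Lambda> s + b * \<Lambda> t" and
    ge: "\<And>s c. Bseq s \<Longrightarrow> \<forall>\<^sub>F n in sequentially. c \<le> s n \<Longrightarrow> c \<le> \<Lambda> s"
    using generalized_limit by blast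
  have le: "\<bar>l (h m)\<bar> \<le> K * dual_norm \<phi> l" if l: "l \<in> CM_dual \<phi>" for l m
  proof -
    have "\<bar>l (h m)\<bar> \<le> dual_norm \<phi> l * CM_norm \<phi> (h m)" by (rule dual_bound(2)[OF l h(1)])
    also have "\<dots> \<le> dual_norm \<phi> l * K" by (intro mult_left_mono h dual_bound(1)[OF l])
    finally show ?thesis by (simp add: mult.commute)
  qed
  have B: "Bseq (\<lambda>m. l (h m))" if l: "l \<in> CM_dual \<phi>" for l
    by (rule BseqI'[of _ "K * dual_norm \<phi> l"]) (use le[OF l] in simp)
  define L where "L l = \<Lambda> (\<lambda>m. l (h m))" for l
  have "\<bar>L l\<bar> \<le> K * dual_norm \<phi> l" if l: "l \<in> CM_dual \<phi>" for l
  proof -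
    \<comment> \<open>Only lower bounds pass to the generalised limit. The upper bound is the lower
      bound of the negated sequence, written in the shape required by \<open>lin\<close>.\<close>
    have "- (K * dual_norm \<phi> l) \<le> l (h m)" "- (K * dual_norm \<phi> l) \<le> (-1) * l (h m) + 0 * l (h m)" for m
      using le[OF l, of m] by auto
    then have "- (K * dual_norm \<phi> l) \<le> L l" "- (K * dual_norm \<phi> l) \<le> \<Lambda> (\<lambda>m. (-1) * l (h m) + 0 * l (h m))"
      unfolding L_def using B[OF l] by (auto intro!: ge always_eventually simp: Bseq_minus_iff)
    then show ?thesis using lin[OF B[OF l] B[OF l], of "-1" 0] by (simp add: L_def)
  qed
  moreover have "L (\<lambda>f. a * l1 f + b * l2 f) = a * L l1 + b * L l2" if "l1 \<in> CM_dual \<phi>" "l2 \<in> CM_dual \<phi>" for l1 l2 a b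
    unfolding L_def by (rule lin[OF B[OF that(1)] B[OF that(2)]])
  ultimately have "L \<in> CM_bidual \<phi>" unfolding CM_bidual_def by blast
  moreover have "c \<le> L l" if "l \<in> CM_dual \<phi>" "\<forall>\<^sub>F m in sequentially. c \<le> l (h m)" for l c
    unfolding L_def by (rule ge[OF B[OF that(1)] that(2)])
  ultimately show thesis by (rule that)
qed

text \<open>
  If the superlevel sets stayed large, some point would lie in infinitely many of them and outside
  every null finite intersection. The normalised indicators of these finite intersections then
  concentrate, and a generalised limit along them is a bidual functional on which the given
  sequence does not tend to 0.
\<close>
lemma density_null_in_measure:
  assumes y: "weakly_null_dual \<phi> y"
    and G[measurable]: "\<And>n. G n \<in> borel_measurable M01"
    and Gy: "\<And>n f. in_CM0 \<phi> f \<Longrightarrow> integrable M01 (\<lambda>t. f t * G n t) \<and> y n f = (\<integral>t. f t * G n t \<partial>M01)"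
    and a: "0 < a" and e: "0 < e"
  shows "(\<lambda>n. measure M01 {t\<in>{a..1 - a}. e < G n t}) \<longlonglongrightarrow> 0"
proof (rule ccontr)
  interpret finite_measure M01 by (rule finite_M01)
  define E where "E = {a..1 - a}"
  have E01: "E \<subseteq> {0..1}" using a by (auto simp: E_def)
  then have E_sets: "E \<in> sets M01" by (simp add: sets_M01_iff E_def)
  define A where "A n = {t\<in>E. e < G n t}" for n
  have A_sets: "A n \<in> sets M01" for n
  proof -
    have "A n = E \<inter> {t\<in>space M01. e < G n t}" using E01 by (auto simp: A_def space_M01)
    moreover have "{t\<in>space M01. e < G n t} \<in> sets M01" by measurable
    ultimately show ?thesis using E_sets by auto
  qed
  assume "\<not> (\<lambda>n. measure M01 {t\<in>{a..1 - a}. e < G n t}) \<longlonglongrightarrow> 0"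
  then obtain \<delta> where \<delta>: "\<delta> > 0" and big: "\<And>m. \<exists>n\<ge>m. \<delta> \<le> measure M01 (A n)"
    by (auto simp: LIMSEQ_iff not_less A_def E_def)
  \<comment> \<open>The intersection of the \<open>V m\<close> consists of the points lying in
    infinitely many \<open>A n\<close>; it still has measure at least \<delta>.\<close>
  define V where "V m = (\<Union>n\<in>{m..}. A n)" for m
  have V_sets: "V m \<in> sets M01" for m unfolding V_def using A_sets by blast
  have V_big: "\<delta> \<le> measure M01 (V m)" for m
  proof -
    obtain n where n: "m \<le> n" "\<delta> \<le> measure M01 (A n)" using big by blast
    then have "A n \<subseteq> V m" by (auto simp: V_def)
    then show ?thesis using n finite_measure_mono[of "A n" "V m"] V_sets by fastforce
  qed
  have "decseq V" unfolding decseq_def V_def by (intro allI impI UN_mono) auto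
  then have "(\<lambda>m. measure M01 (V m)) \<longlonglongrightarrow> measure M01 (\<Inter>m. V m)"
    using V_sets by (intro finite_Lim_measure_decseq) auto
  then have meas: "\<delta> \<le> measure M01 (\<Inter>m. V m)"
    using V_big by (intro LIMSEQ_le_const) auto
  define F where "F S = {t\<in>E. \<forall>n\<in>S. t \<in> A n}" for S :: "nat set"
  have F_sets: "F S \<in> sets M01" for S
  proof (cases "S = {}")
    case False
    then have "F S = E \<inter> (\<Inter>n\<in>S. A n)" by (auto simp: F_def)
    then show ?thesis using False E_sets A_sets by (auto intro!: sets.countable_INT')
  qed (simp add: F_def E_sets)
  \<comment> \<open>Null, because there are only countably many finite index sets. For a point
    outside it, every finite family of sets \<open>A n\<close> that contain the point has an
    intersection of positive measure.\<close>
  define Z where "Z = (\<Union>S\<in>{S. finite S \<and> measure M01 (F S) = 0}. F S)"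
  have Z: "Z \<in> null_sets M01"
    unfolding Z_def
  proof (rule null_sets_UN')
    have "countable {S::nat set. finite S}" by (rule countable_Collect_finite)
    then show "countable {S. finite S \<and> measure M01 (F S) = 0}" by (rule countable_subset[rotated]) auto
    show "F S \<in> null_sets M01" if "S \<in> {S. finite S \<and> measure M01 (F S) = 0}" for S
      using that F_sets[of S] by (auto simp: null_sets_def emeasure_eq_measure)
  qed
  have "\<not> (\<Inter>m. V m) \<subseteq> Z"
  proof
    assume "(\<Inter>m. V m) \<subseteq> Z"
    then have "measure M01 (\<Inter>m. V m) \<le> measure M01 Z" using Z by (intro finite_measure_mono) auto
    also have "measure M01 Z = 0" using Z by (auto simp: measure_def)
    finally show False using meas \<delta> by simp
  qed
  then obtain \<omega> where \<omega>: "\<And>m. \<omega> \<in> V m" "\<omega> \<notin> Z" by blast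
  define I where "I = {n. \<omega> \<in> A n}"
  have I_inf: "\<exists>n\<ge>m. n \<in> I" for m using \<omega>(1)[of m] by (auto simp: V_def I_def)
  define H where "H m = F {n\<in>I. n \<le> m}" for m
  have H_sets: "H m \<in> sets M01" for m by (simp add: H_def F_sets)
  have H_pos: "0 < measure M01 (H m)" for m
  proof -
    have "\<omega> \<in> E" using \<omega>(1)[of 0] by (auto simp: V_def A_def)
    then have "\<omega> \<in> H m" by (auto simp: H_def F_def I_def)
    then have "measure M01 (H m) \<noteq> 0" using \<omega>(2) unfolding Z_def H_def by auto
    then show ?thesis by (simp add: zero_less_measure_iff)
  qed
  have HE: "H m \<subseteq> E" for m by (auto simp: H_def F_def)
  \<comment> \<open>Normalised to have integral 1. Since the support stays in [a, 1 - a], division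
    by t costs at most 1 / a, and the sequence is bounded in the space.\<close>
  define h where "h m t = indicator (H m) t / measure M01 (H m)" for m and t :: real
  have h: "in_CM0 \<phi> (h m) \<and> CM_norm \<phi> (h m) \<le> C * \<phi> 1 * (1 / a)" for m
  proof -
    let ?k = "\<lambda>t. h m t / t"
    have hint: "integrable M01 (h m)"
      unfolding h_def using H_sets[of m] by (intro integrable_divide integrable_real_indicator) (auto simp: less_top[symmetric])
    have le: "\<bar>?k t\<bar> \<le> 1 / a * h m t" for t
    proof (cases "t \<in> H m")
      case True
      then have t: "a \<le> t" using HE[of m] by (auto simp: E_def)
      have h0: "0 \<le> h m t" using H_pos[of m] by (auto simp: h_def)
      have "h m t / t \<le> h m t / a" using t a h0 by (intro divide_left_mono) auto
      then show ?thesis using t a h0 by simp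
    qed (simp add: h_def)
    have [measurable]: "h m \<in> borel_measurable M01" using hint by auto
    have k: "integrable M01 ?k"
    proof (rule Bochner_Integration.integrable_bound)
      show "integrable M01 (\<lambda>t. 1 / a * h m t)" using hint by (rule integrable_mult_right)
      show "AE t in M01. norm (?k t) \<le> norm (1 / a * h m t)"
        by (rule AE_I2) (metis le abs_ge_self order_trans real_norm_def)
    qed measurable
    have eq: "(\<lambda>t. t * ?k t) = h m"
      using HE[of m] a by (auto simp: fun_eq_iff h_def indicator_def E_def)
    have "(\<integral>t. \<bar>?k t\<bar> \<partial>M01) \<le> (\<integral>t. 1 / a * h m t \<partial>M01)"
      by (intro integral_mono le integrable_abs k integrable_mult_right hint)
    also have "\<dots> = 1 / a * (\<integral>t. h m t \<partial>M01)" by (rule integral_mult_right_zero)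
    also have "(\<integral>t. h m t \<partial>M01) = 1"
      using H_sets[of m] H_pos[of m] sets.sets_into_space[OF H_sets[of m]] by (simp add: h_def Int_absorb2)
    finally have "(\<integral>t. \<bar>?k t\<bar> \<partial>M01) \<le> 1 / a" by simp
    then have "C * \<phi> 1 * (\<integral>t. \<bar>?k t\<bar> \<partial>M01) \<le> C * \<phi> 1 * (1 / a)"
      using C_pos nonneg[of 1] by (intro mult_left_mono) auto
    with in_CM0_weighted_L1[OF k] show ?thesis unfolding eq by linarith
  qed
  obtain L where L: "L \<in> CM_bidual \<phi>"
    "\<And>l c. l \<in> CM_dual \<phi> \<Longrightarrow> \<forall>\<^sub>F m in sequentially. c \<le> l (h m) \<Longrightarrow> c \<le> L l"
    using bidual_limit[of h "C * \<phi> 1 * (1 / a)"] h by blast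
  have "e \<le> L (y n)" if n: "n \<in> I" for n
  proof (rule L(2))
    show "y n \<in> CM_dual \<phi>" using y by (simp add: weakly_null_dual_def)
    \<comment> \<open>From m = n on, \<open>H m\<close> is contained in \<open>A n\<close>, so
      \<open>h m\<close> averages G n over points where it exceeds e. One-sided level sets exclude
      cancellation in this average.\<close>
    have "e \<le> y n (h m)" if m: "n \<le> m" for m
    proof -
      have hm: "in_CM0 \<phi> (h m)" using h by blast
      have hint: "integrable M01 (h m)"
        unfolding h_def using H_sets[of m] by (intro integrable_divide integrable_real_indicator) (auto simp: less_top[symmetric])
      have "e = e * (\<integral>t. h m t \<partial>M01)"
        using H_sets[of m] H_pos[of m] sets.sets_into_space[OF H_sets[of m]] by (simp add: h_def Int_absorb2)
      also have "\<dots> = (\<integral>t. e * h m t \<partial>M01)" by simp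
      also have "\<dots> \<le> (\<integral>t. h m t * G n t \<partial>M01)"
      proof (rule integral_mono)
        fix t
        have "e \<le> G n t" if "t \<in> H m" using that n m by (auto simp: H_def F_def A_def I_def)
        then show "e * h m t \<le> h m t * G n t"
          using H_pos[of m] by (auto simp: h_def indicator_def divide_right_mono)
      qed (use hint Gy[OF hm] in auto)
      also have "\<dots> = y n (h m)" using Gy[OF hm] by simp
      finally show ?thesis .
    qed
    then show "\<forall>\<^sub>F m in sequentially. e \<le> y n (h m)" by (auto simp: eventually_sequentially)
  qed
  moreover have "(\<lambda>n. L (y n)) \<longlonglongrightarrow> 0" using y L(1) by (simp add: weakly_null_dual_def)
  then have "\<forall>\<^sub>F n in sequentially. L (y n) < e" using e by (rule order_tendstoD)
  then obtain m where "\<And>n. n \<ge> m \<Longrightarrow> L (y n) < e" by (auto simp: eventually_sequentially)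
  ultimately show False using I_inf[of m] by (meson not_le)
qed

end

section \<open>Gliding humps\<close>

text \<open>Absolute continuity of the integral, from \<bar>f\<bar> \<le> k + max 0 (\<bar>f\<bar> -
  k): the second term has small integral for large k, and the first is at most k times the
  measure.\<close>

lemma integral_small_on_small_sets:
  fixes f :: "'a \<Rightarrow> real"
  assumes f: "integrable M f" and e: "0 < e"
  obtains \<eta> where "0 < \<eta>" "\<And>B. B \<in> sets M \<Longrightarrow> emeasure M B < \<infinity> \<Longrightarrow> measure M B \<le> \<eta> \<Longrightarrow> (\<integral>t. indicator B t * \<bar>f t\<bar> \<partial>M) \<le> e"
proof -
  note [measurable] = borel_measurable_integrable[OF f]
  have "(\<lambda>k. \<integral>t. max 0 (\<bar>f t\<bar> - real k) \<partial>M) \<longlonglongrightarrow> (\<integral>t. 0 \<partial>M)"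
  proof (rule integral_dominated_convergence[where w = "\<lambda>t. \<bar>f t\<bar>"])
    show "AE t in M. (\<lambda>k. max 0 (\<bar>f t\<bar> - real k)) \<longlonglongrightarrow> 0"
    proof (rule AE_I2)
      fix t
      obtain k0 where "\<bar>f t\<bar> \<le> real k0" using real_arch_simple by blast
      then have "\<forall>\<^sub>F k in sequentially. 0 = max 0 (\<bar>f t\<bar> - real k)"
        by (auto simp: eventually_sequentially intro!: exI[of _ k0])
      then show "(\<lambda>k. max 0 (\<bar>f t\<bar> - real k)) \<longlonglongrightarrow> 0" by (rule Lim_transform_eventually[OF tendsto_const])
    qed
  qed (use f in auto)
  then have "\<forall>\<^sub>F k in sequentially. (\<integral>t. max 0 (\<bar>f t\<bar> - real k) \<partial>M) < e / 2"
    using e by (intro order_tendstoD) auto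
  then obtain k where k: "(\<integral>t. max 0 (\<bar>f t\<bar> - real k) \<partial>M) < e / 2" by (auto simp: eventually_sequentially)
  have ik: "integrable M (\<lambda>t. max 0 (\<bar>f t\<bar> - real k))"
    by (rule Bochner_Integration.integrable_bound[OF f]) auto
  show thesis
  proof (rule that[of "e / (2 * (real k + 1))"])
    show "0 < e / (2 * (real k + 1))" using e by simp
    fix B assume B: "B \<in> sets M" "emeasure M B < \<infinity>" "measure M B \<le> e / (2 * (real k + 1))"
    have iB: "integrable M (indicator B :: 'a \<Rightarrow> real)" using B by (intro integrable_real_indicator) auto
    have "(\<integral>t. indicator B t * \<bar>f t\<bar> \<partial>M) \<le> (\<integral>t. real k * indicator B t + max 0 (\<bar>f t\<bar> - real k) \<partial>M)"
    proof (rule integral_mono)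
      show "integrable M (\<lambda>t. indicator B t * \<bar>f t\<bar>)"
        using integrable_real_mult_indicator[OF B(1) integrable_abs[OF f]] by (simp add: mult.commute)
      show "integrable M (\<lambda>t. real k * indicator B t + max 0 (\<bar>f t\<bar> - real k))"
        by (intro Bochner_Integration.integrable_add integrable_mult_right iB ik)
    qed (auto simp: indicator_def)
    also have "\<dots> = real k * measure M B + (\<integral>t. max 0 (\<bar>f t\<bar> - real k) \<partial>M)"
      using iB ik B sets.sets_into_space[OF B(1)] by (simp add: Int_absorb2)
    also have "\<dots> \<le> e"
    proof -
      have "real k * measure M B \<le> real k * (e / 2 / (real k + 1))" using B(3) by (intro mult_left_mono) auto
      also have "\<dots> \<le> e / 2" using e by (intro weighted_frac_le) auto
      finally show ?thesis using k by linarith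
    qed
    finally show "(\<integral>t. indicator B t * \<bar>f t\<bar> \<partial>M) \<le> e" .
  qed
qed

section \<open>Blocks escaping to the endpoints, and blocks in the middle\<close>

context index_weight
begin

text \<open>A condition on the numbers alone, so that \<open>b\<close> can be fixed before the
  functions supported beyond it are known. \<open>P\<close> ranges over [K, 2 K] because the bound
  of the partial sums creeps from K towards 2 K as blocks are added.\<close>

definition far :: "real \<Rightarrow> real \<Rightarrow> real \<Rightarrow> real \<Rightarrow> bool" where
  "far K e a b \<longleftrightarrow> 0 < b \<and> b < a \<and> (\<forall>u z P. locint u \<longrightarrow> locint z \<longrightarrow>
     (\<forall>t\<in>{0..1} - {a..1 - a}. u t = 0) \<longrightarrow> (\<forall>t\<in>{b..1 - b}. z t = 0) \<longrightarrow>
     K \<le> P \<longrightarrow> P \<le> 2 * K \<longrightarrow>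
     (\<forall>x. 0 < x \<longrightarrow> x < 1 \<longrightarrow> psi x * cum u x \<le> P) \<longrightarrow>
     (\<forall>x. 0 < x \<longrightarrow> x < 1 \<longrightarrow> psi x * cum z x \<le> K) \<longrightarrow>
     (\<forall>x. 0 < x \<longrightarrow> x < 1 \<longrightarrow> psi x * cum (\<lambda>t. u t + z t) x \<le> P + e))"

text \<open>The property that makes the space resemble a \<open>c\<^sub>0\<close>-sum: pieces supported far apart add up
  almost like a maximum.\<close>
lemma far_exists:
  assumes a: "0 < a" "a < 1/2" and K: "0 < K" and e: "0 < e"
  shows "\<exists>b. far K e a b"
proof -
  have pa: "0 < \<phi> a" using a by (intro pos) auto
  \<comment> \<open>Controls what outer mass near 0 contributes to F in the middle.\<close>
  obtain d1 where d1: "0 < d1" "\<And>t. 0 < t \<Longrightarrow> t \<le> d1 \<Longrightarrow> t / \<phi> t < e * a / (K * \<phi> a)"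
    using kappa_small[of "e * a / (K * \<phi> a)"] a K e pa by (metis divide_pos_pos mult_pos_pos)
  \<comment> \<open>Controls what the accumulated inner mass contributes near 1, where
    \<open>psi\<close> is at most 2 * \<phi> b.\<close>
  obtain d2 where d2: "0 < d2" "\<And>t. 0 \<le> t \<Longrightarrow> t \<le> d2 \<Longrightarrow> \<phi> t < e * \<phi> a / (4 * K)"
    using small[of "e * \<phi> a / (4 * K)"] K e pa by (metis divide_pos_pos mult_pos_pos zero_less_numeral)
  define b where "b = min (min d1 d2) (a / 2)"
  have b: "0 < b" "b < a" "b \<le> d1" "b \<le> d2" using d1 d2 a by (auto simp: b_def)
  have pb: "0 < \<phi> b" using a b by (intro pos) auto
  have kb: "b / \<phi> b * (K * \<phi> a / a) \<le> e"
  proof -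
    have "b / \<phi> b * (K * \<phi> a / a) \<le> e * a / (K * \<phi> a) * (K * \<phi> a / a)"
      using d1(2)[OF b(1,3)] a K pa by (intro mult_right_mono) auto
    also have "\<dots> = e" using a K pa by simp
    finally show ?thesis .
  qed
  have fb: "2 * \<phi> b * (2 * K / \<phi> a) \<le> e"
    using d2(2)[of b] b K pa by (simp add: field_simps)
  have le: "psi x * cum (\<lambda>t. u t + z t) x \<le> P + e"
    if u: "locint u" "\<And>t. t \<in> {0..1} - {a..1 - a} \<Longrightarrow> u t = 0"
      and z: "locint z" "\<And>t. t \<in> {b..1 - b} \<Longrightarrow> z t = 0"
      and P: "K \<le> P" "P \<le> 2 * K"
      and pu: "\<And>x. 0 < x \<Longrightarrow> x < 1 \<Longrightarrow> psi x * cum u x \<le> P"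
      and pz: "\<And>x. 0 < x \<Longrightarrow> x < 1 \<Longrightarrow> psi x * cum z x \<le> K"
      and x: "0 < x" "x < 1" for u z P x
  proof -
    have "cum (\<lambda>t. u t + z t) x \<le> cum u x + cum z x"
      using locint_lincomb(2)[OF u(1) z(1) x(2), of 1 1] by simp
    then have "psi x * cum (\<lambda>t. u t + z t) x \<le> psi x * (cum u x + cum z x)"
      using psi_pos[OF x] by (intro mult_left_mono) auto
    also have "\<dots> = psi x * cum u x + psi x * cum z x" by (rule distrib_left)
    also have "\<dots> \<le> P + e"
    proof -
      \<comment> \<open>To the left of a the inner function has not yet started; between a and 1 - b
        only the mass of \<open>z\<close> on [0,b] interferes; beyond 1 - b only the total mass of
        \<open>u\<close> does.\<close>
      consider "x < a" | "a \<le> x" "x < 1 - b" | "1 - b \<le> x" by linarith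
      then show ?thesis
      proof cases
        case 1
        then have "cum u x = cum u (-1)" using x by (intro cum_eq_of_zero u) auto
        also have "\<dots> = 0" by (simp add: cum_def indicator_def)
        finally show ?thesis using pz[OF x] P e by simp
      next
        case 2
        have "cum z x = cum z b" using 2 b by (intro cum_eq_of_zero z) auto
        have "psi b = \<phi> b / b" using mono[of b "1 - b"] a b by (simp add: psi_def)
        with pz[of b] a b have "\<phi> b / b * cum z b \<le> K" by simp
        then have "cum z b \<le> b / \<phi> b * K" using b pb by (simp add: field_simps)
        moreover have "psi x \<le> \<phi> a / a"
        proof -
          have "psi x \<le> \<phi> x / x" unfolding psi_def using x by (intro divide_right_mono) auto
          also have "\<dots> \<le> \<phi> a / a" using 2 a x by (intro quasi) auto
          finally show ?thesis .
        qed
        ultimately have "psi x * cum z b \<le> \<phi> a / a * (b / \<phi> b * K)"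
          using psi_pos[OF x] a pa cum_nonneg by (intro mult_mono) auto
        also have "\<dots> \<le> e" using kb by (simp add: mult_ac)
        finally show ?thesis using pu[OF x] \<open>cum z x = cum z b\<close> by simp
      next
        case 3
        have "cum u x = cum u (1 - a)" using 3 a b by (intro cum_eq_of_zero u) auto
        have "psi (1 - a) \<ge> \<phi> a"
        proof -
          have "psi (1 - a) = \<phi> a / (1 - a)" using mono[of a "1 - a"] a by (simp add: psi_def)
          also have "\<dots> \<ge> \<phi> a / 1" using a pa by (intro divide_left_mono) auto
          finally show ?thesis by simp
        qed
        then have "\<phi> a * cum u (1 - a) \<le> psi (1 - a) * cum u (1 - a)"
          using cum_nonneg by (intro mult_right_mono)
        also have "\<dots> \<le> 2 * K" using pu[of "1 - a"] a P by simp
        finally have "cum u (1 - a) \<le> 2 * K / \<phi> a" using pa by (simp add: field_simps)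
        moreover have "psi x \<le> 2 * \<phi> b"
        proof -
          have "psi x \<le> \<phi> (1 - x) / x" unfolding psi_def using x by (intro divide_right_mono) auto
          also have "\<dots> \<le> \<phi> b / (1/2)" using 3 a b x pb by (intro frac_le mono) auto
          finally show ?thesis by simp
        qed
        ultimately have "psi x * cum u (1 - a) \<le> 2 * \<phi> b * (2 * K / \<phi> a)"
          using psi_pos[OF x] pb cum_nonneg by (intro mult_mono) auto
        also have "\<dots> \<le> e" by (rule fb)
        finally show ?thesis using pz[OF x] P \<open>cum u x = cum u (1 - a)\<close> by simp
      qed
    qed
    finally show ?thesis .
  qed
  have "far K e a b"
    unfolding far_def
  proof (intro conjI allI impI b(1,2))
    fix u z :: "real \<Rightarrow> real" and P x :: real
    assume *: "locint u" "locint z" "\<forall>t\<in>{0..1} - {a..1 - a}. u t = 0" "\<forall>t\<in>{b..1 - b}. z t = 0"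
      "K \<le> P" "P \<le> 2 * K" "\<forall>x. 0 < x \<longrightarrow> x < 1 \<longrightarrow> psi x * cum u x \<le> P"
      "\<forall>x. 0 < x \<longrightarrow> x < 1 \<longrightarrow> psi x * cum z x \<le> K" "0 < x" "x < 1"
    show "psi x * cum (\<lambda>t. u t + z t) x \<le> P + e"
      by (rule le[OF *(1) *(3)[rule_format] *(2) *(4)[rule_format] *(5,6) *(7)[rule_format] *(8)[rule_format] *(9,10)])
  qed
  then show ?thesis by blast
qed

text \<open>Otherwise more than \<delta> of the integral of \<bar>x_n G_n\<bar> sits, for suitable
  increasing n, on disjoint sets \<open>W j\<close> moving to the endpoints. The blocks
  \<open>z j\<close> cut out there have uniformly bounded signed sums, so for every S the sum of l
  (z j) over j in S is a bidual functional. The y_n tend to 0 on each of these, and Schur's lemma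
  contradicts y_n (z j) > \<delta> for the n chosen with j.\<close>

lemma uniform_tails:
  assumes x: "weakly_null \<phi> x" and y: "weakly_null_dual \<phi> y"
    and K: "0 < K" "\<And>n s. 0 < s \<Longrightarrow> s < 1 \<Longrightarrow> psi s * cum (x n) s \<le> K"
    and G[measurable]: "\<And>n. G n \<in> borel_measurable M01"
    and Gy: "\<And>n f. in_CM0 \<phi> f \<Longrightarrow> integrable M01 (\<lambda>t. f t * G n t) \<and> y n f = (\<integral>t. f t * G n t \<partial>M01)"
    and \<delta>: "0 < \<delta>"
  obtains a where "0 < a" "a < 1/2" "\<And>n. (\<integral>t. indicator (- {a..1 - a}) t * \<bar>x n t * G n t\<bar> \<partial>M01) \<le> \<delta>"
proof (rule ccontr)
  note far_tail = that
  assume nothesis: "\<not> thesis"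
  have xX: "in_CM0 \<phi> (x n)" for n using x by (simp add: weakly_null_def)
  have yX: "y n \<in> CM_dual \<phi>" for n using y by (simp add: weakly_null_dual_def)
  have [measurable]: "x n \<in> borel_measurable M01" for n
    by (rule in_CM0_measurable[OF xX])
  define \<Phi> where "\<Phi> a n = (\<integral>t. indicator (- {a..1 - a}) t * \<bar>x n t * G n t\<bar> \<partial>M01)" for a n
  have xG: "integrable M01 (\<lambda>t. \<bar>x n t * G n t\<bar>)" for n using Gy[OF xX] by (intro integrable_abs) blast
  have xGa: "integrable M01 (\<lambda>t. indicator (- {a..1 - a}) t * \<bar>x n t * G n t\<bar>)" for a n
    by (rule Bochner_Integration.integrable_bound[OF xG[of n]]) (auto simp: indicator_def)
  have \<Phi>_mono: "\<Phi> a n \<le> \<Phi> b n" if "a \<le> b" for a b n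
    unfolding \<Phi>_def using that by (intro integral_mono xGa) (auto simp: indicator_def)
  have \<Phi>_lim: "\<exists>a. 0 < a \<and> a < b \<and> \<Phi> a n < c" if "0 < b" "0 < c" for b c n
  proof -
    define a where "a k = b / real (k + 2)" for k
    have a: "0 < a k" "a k < b" for k using that by (auto simp: a_def divide_simps)
    have a_lim: "a \<longlonglongrightarrow> 0"
      unfolding a_def using tendsto_mult_right_zero[OF LIMSEQ_ignore_initial_segment[OF lim_1_over_n, of 2], of b] by simp
    have "(\<lambda>k. \<Phi> (a k) n) \<longlonglongrightarrow> (\<integral>t. 0 \<partial>M01)"
      unfolding \<Phi>_def
    proof (rule integral_dominated_convergence[OF _ _ xG[of n]])
      show "AE t in M01. (\<lambda>k. indicator (- {a k..1 - a k}) t * \<bar>x n t * G n t\<bar>) \<longlonglongrightarrow> 0"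
        using AE_M01
      proof eventually_elim
        case (elim t)
        have "\<forall>\<^sub>F k in sequentially. a k < min t (1 - t)" using elim by (intro order_tendstoD[OF a_lim]) auto
        then have "\<forall>\<^sub>F k in sequentially. 0 = indicator (- {a k..1 - a k}) t * \<bar>x n t * G n t\<bar>"
          by eventually_elim (auto simp: indicator_def)
        then show ?case by (rule Lim_transform_eventually[OF tendsto_const])
      qed
    qed (auto intro!: AE_I2 simp: indicator_def)
    then have "\<forall>\<^sub>F k in sequentially. \<Phi> (a k) n < c" using that by (intro order_tendstoD) auto
    then obtain k where "\<Phi> (a k) n < c" by (auto simp: eventually_sequentially)
    with a show ?thesis by blast
  qed
  \<comment> \<open>For each single n the tail integral tends to 0, so after shrinking the
    neighbourhood of the endpoints only indices from m on can violate the bound.\<close>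
  have big: "\<exists>n\<ge>m. \<delta> < \<Phi> a n" if a: "0 < a" "a < 1/2" for a m
  proof -
    have "\<exists>a'. 0 < a' \<and> a' \<le> a \<and> (\<forall>n<m. \<Phi> a' n \<le> \<delta>)"
    proof (induction m)
      case 0
      then show ?case using a by auto
    next
      case (Suc m)
      then obtain a1 where a1: "0 < a1" "a1 \<le> a" "\<forall>n<m. \<Phi> a1 n \<le> \<delta>" by blast
      obtain a2 where a2: "0 < a2" "a2 < a1" "\<Phi> a2 m < \<delta>" using \<Phi>_lim[OF a1(1) \<delta>, of m] by blast
      have "\<Phi> a2 n \<le> \<delta>" if "n < Suc m" for n
      proof (cases "n = m")
        case False
        with that have "\<Phi> a1 n \<le> \<delta>" using a1(3) by simp
        with a2 \<Phi>_mono[of a2 a1 n] show ?thesis by simp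
      qed (use a2 in simp)
      with a1 a2 show ?case by (intro exI[of _ a2]) auto
    qed
    then obtain a' where a': "0 < a'" "a' \<le> a" "\<forall>n<m. \<Phi> a' n \<le> \<delta>" by blast
    moreover obtain n where n: "\<delta> < \<Phi> a' n"
      using nothesis far_tail[of a'] a' a unfolding \<Phi>_def[symmetric] by (meson not_le order_le_less_trans)
    ultimately have "m \<le> n" by (meson not_le)
    moreover have "\<delta> < \<Phi> a n" using n \<Phi>_mono[OF a'(2), of n] by linarith
    ultimately show ?thesis by blast
  qed
  \<comment> \<open>In a triple (b, n, a) the block lives between the neighbourhoods of radius a and
    b of the endpoints and belongs to the index n.\<close>
  let ?ok = "\<lambda>(b, n, a). 0 < a \<and> a < b \<and> b < 1/2 \<and> \<delta> < \<Phi> b n - \<Phi> a n"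
  have pick: "\<exists>n a. m \<le> n \<and> ?ok (b, n, a)" if b: "0 < b" "b < 1/2" for b m
  proof -
    obtain n where n: "m \<le> n" "\<delta> < \<Phi> b n" using big[OF b] by blast
    obtain a where "0 < a" "a < b" "\<Phi> a n < \<Phi> b n - \<delta>" using \<Phi>_lim[OF b(1), of "\<Phi> b n - \<delta>" n] n by auto
    with n b show ?thesis by (intro exI[of _ n] exI[of _ a]) auto
  qed
  \<comment> \<open>The tolerances K / 2 ^ Suc j sum to K, which keeps every partial sum of blocks
    below 2 K.\<close>
  have "\<exists>s. \<forall>j. ?ok (s j) \<and>
      (fst (snd (s j)) < fst (snd (s (Suc j))) \<and> far K (K / 2 ^ Suc j) (snd (snd (s j))) (fst (s (Suc j))))"
  proof (rule dependent_nat_choice)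
    obtain n a where "?ok (1/4, n, a)" using pick[of "1/4" 0] by auto
    then show "\<exists>s. ?ok s" by blast
    fix s :: "real \<times> nat \<times> real" and j assume s: "?ok s"
    obtain b n a where s_eq: "s = (b, n, a)" by (cases s)
    have "0 < K / 2 ^ Suc j" using K by simp
    then obtain b' where b': "far K (K / 2 ^ Suc j) a b'" using far_exists[of a K] s K s_eq by fastforce
    then have "0 < b'" "b' < a" by (auto simp: far_def)
    then obtain n' a' where "Suc n \<le> n'" "?ok (b', n', a')" using pick[of b' "Suc n"] s s_eq by auto
    with b' show "\<exists>s'. ?ok s' \<and> (fst (snd s) < fst (snd s') \<and> far K (K / 2 ^ Suc j) (snd (snd s)) (fst s'))"
      unfolding s_eq by (intro exI[of _ "(b', n', a')"]) auto
  qed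
  then obtain s where S: "\<forall>j. ?ok (s j) \<and>
      (fst (snd (s j)) < fst (snd (s (Suc j))) \<and> far K (K / 2 ^ Suc j) (snd (snd (s j))) (fst (s (Suc j))))"
    by (rule exE)
  note s = conjunct1[OF spec[OF S]] conjunct1[OF conjunct2[OF spec[OF S]]] conjunct2[OF conjunct2[OF spec[OF S]]]
  define b n a where "b j = fst (s j)" and "n j = fst (snd (s j))" and "a j = snd (snd (s j))" for j
  have ok: "0 < a j" "a j < b j" "b j < 1/2" "\<delta> < \<Phi> (b j) (n j) - \<Phi> (a j) (n j)" for j
    using s(1)[of j] by (auto simp: a_def b_def n_def split: prod.splits)
  have n_mono: "strict_mono n" using s(2) by (simp add: strict_mono_Suc_iff n_def)
  have far: "far K (K / 2 ^ Suc j) (a j) (b (Suc j))" for j using s(3) by (simp add: a_def b_def)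
  have ab: "b (Suc j) < a j" for j using far[of j] by (simp add: far_def)
  define W where "W j = {a j..1 - a j} - {b j..1 - b j}" for j
  have W_ind: "indicator (W j) t = (indicator (- {b j..1 - b j}) t - indicator (- {a j..1 - a j}) t :: real)" for j t
    using ok[of j] by (auto simp: W_def indicator_def)
  have [measurable]: "(indicator (W j) :: real \<Rightarrow> real) \<in> borel_measurable M01" for j
  proof -
    have "(indicator (W j) :: real \<Rightarrow> real) = (\<lambda>t. indicator (- {b j..1 - b j}) t - indicator (- {a j..1 - a j}) t)"
      by (rule ext) (rule W_ind)
    then show ?thesis by simp
  qed
  \<comment> \<open>With this sign, z j * G (n j) equals \<bar>x (n j) * G (n j)\<bar> on
    \<open>W j\<close>, while \<bar>z j\<bar> \<le> \<bar>x (n j)\<bar> keeps the block in the space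
    under the common bound K.\<close>
  define z where "z j t = indicator (W j) t * (\<bar>x (n j) t\<bar> * sgn (G (n j) t))" for j t
  have z_on: "on01 (z j)" for j unfolding on01_def z_def by measurable
  have z_le: "\<bar>z j t\<bar> \<le> \<bar>x (n j) t\<bar>" for j t by (auto simp: z_def indicator_def abs_mult sgn_if)
  have zX: "in_CM0 \<phi> (z j)" for j by (rule in_CM0_solid[OF xX z_on z_le])
  have z_psi: "psi r * cum (z j) r \<le> K" if r: "0 < r" "r < 1" for j r
  proof -
    have "locint (x (n j))" using xX[of "n j"] by (simp add: in_CM0_iff)
    then have "cum (z j) r \<le> cum (x (n j)) r" using r(2) by (intro locint_solid(2)[OF _ z_on z_le])
    then have "psi r * cum (z j) r \<le> psi r * cum (x (n j)) r" using psi_pos[OF r] by (intro mult_left_mono) auto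
    with K(2)[OF r, of "n j"] show ?thesis by linarith
  qed
  have yz: "\<delta> < y (n j) (z j)" for j
  proof -
    have "z j t * G (n j) t = indicator (- {b j..1 - b j}) t * \<bar>x (n j) t * G (n j) t\<bar>
        - indicator (- {a j..1 - a j}) t * \<bar>x (n j) t * G (n j) t\<bar>" for t
    proof -
      have "z j t * G (n j) t = indicator (W j) t * \<bar>x (n j) t * G (n j) t\<bar>"
        by (simp add: z_def abs_mult abs_sgn[of "G (n j) t"] mult_ac)
      then show ?thesis by (simp add: W_ind left_diff_distrib)
    qed
    then have "y (n j) (z j) = \<Phi> (b j) (n j) - \<Phi> (a j) (n j)"
      using Gy[OF zX[of j], of "n j"] xGa by (simp add: \<Phi>_def)
    with ok show ?thesis by simp
  qed
  define U where "U \<sigma> m t = (\<Sum>j<m. \<sigma> j * z j t)" for \<sigma> :: "nat \<Rightarrow> real" and m t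
  have U_Suc: "U \<sigma> (Suc m) = (\<lambda>t. 1 * U \<sigma> m t + \<sigma> m * z m t)" for \<sigma> m
    by (rule ext) (simp add: U_def)
  have "in_CM0 \<phi> (\<lambda>t. t * 0)" by (rule in_CM0_weighted_L1) simp
  then have UX0: "in_CM0 \<phi> (U \<sigma> 0)" for \<sigma> by (simp add: U_def[abs_def])
  have UX: "in_CM0 \<phi> (U \<sigma> m)" for \<sigma> m
  proof (induction m)
    case (Suc m)
    then show ?case unfolding U_Suc by (rule in_CM0_lincomb[OF _ zX])
  qed (rule UX0)
  have lU: "l (U \<sigma> m) = (\<Sum>j<m. \<sigma> j * l (z j))" if l: "l \<in> CM_dual \<phi>" for l \<sigma> m
  proof (induction m)
    case 0
    have "l (\<lambda>t. 0 * U \<sigma> 0 t + 0 * U \<sigma> 0 t) = 0 * l (U \<sigma> 0) + 0 * l (U \<sigma> 0)"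
      by (rule CM_dualD(1)[OF l UX0 UX0])
    then show ?case by (simp add: U_def)
  next
    case (Suc m)
    then show ?case unfolding U_Suc CM_dualD(1)[OF l UX zX] by simp
  qed
  have U_supp: "U \<sigma> (Suc m) t = 0" if "t \<notin> {a m..1 - a m}" for \<sigma> m t
  proof -
    have "t \<notin> {a i..1 - a i}" if "i \<le> m" for i
      using that
    proof (induction i rule: inc_induct)
      case base
      then show ?case using \<open>t \<notin> {a m..1 - a m}\<close> .
    next
      case (step i)
      then show ?case using ab[of i] ok(2)[of "Suc i"] by auto
    qed
    then show ?thesis by (auto simp: U_def z_def W_def indicator_def intro!: sum.neutral)
  qed
  \<comment> \<open>The bound is K plus the first m tolerances. It is stated for m + 1 summands, so
    that the induction starts with one block and the bound K.\<close>
  have U_psi: "psi r * cum (U \<sigma> (Suc m)) r \<le> K * (2 - 1 / 2 ^ m)"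
    if \<sigma>: "\<And>j. \<bar>\<sigma> j\<bar> \<le> 1" and r: "0 < r" "r < 1" for \<sigma> m r
    using r
  proof (induction m arbitrary: r)
    case 0
    have "cum (U \<sigma> (Suc 0)) r \<le> cum (z 0) r"
      using zX[of 0] UX[of \<sigma> "Suc 0"] 0 \<sigma>[of 0]
      by (intro locint_solid(2)) (auto simp: in_CM0_iff U_def abs_mult intro: locintD mult_left_le_one_le)
    then have "psi r * cum (U \<sigma> (Suc 0)) r \<le> psi r * cum (z 0) r" using psi_pos[OF 0] by (intro mult_left_mono) auto
    with z_psi[OF 0, of 0] show ?case by simp
  next
    case (Suc m)
    let ?z = "\<lambda>t. \<sigma> (Suc m) * z (Suc m) t"
    have zl: "locint ?z"
      using locint_lincomb(1)[of "z (Suc m)" "z (Suc m)" "\<sigma> (Suc m)" 0] zX[of "Suc m"] by (simp add: in_CM0_iff)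
    have zp: "psi q * cum ?z q \<le> K" if q: "0 < q" "q < 1" for q
    proof -
      have "cum ?z q \<le> cum (z (Suc m)) q"
        using zX[of "Suc m"] locintD(1)[OF zl] q \<sigma>[of "Suc m"]
        by (intro locint_solid(2)) (auto simp: in_CM0_iff abs_mult intro: mult_left_le_one_le)
      then have "psi q * cum ?z q \<le> psi q * cum (z (Suc m)) q" using psi_pos[OF q] by (intro mult_left_mono) auto
      with z_psi[OF q, of "Suc m"] show ?thesis by linarith
    qed
    have p2: "K \<le> K * (2 - 1 / 2 ^ m)" "K * (2 - 1 / 2 ^ m) \<le> 2 * K"
      using K(1) by (auto simp: field_simps)
    have "psi r * cum (\<lambda>t. U \<sigma> (Suc m) t + ?z t) r \<le> K * (2 - 1 / 2 ^ m) + K / 2 ^ Suc m"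
    proof -
      note f = conjunct2[OF conjunct2[OF far[of m, unfolded far_def]], rule_format, of "U \<sigma> (Suc m)" ?z "K * (2 - 1 / 2 ^ m)" r]
      show ?thesis
      proof (rule f)
        show "locint (U \<sigma> (Suc m))" using UX[of \<sigma> "Suc m"] by (simp add: in_CM0_iff)
        show "?z t = 0" if "t \<in> {b (Suc m)..1 - b (Suc m)}" for t using that by (simp add: z_def W_def)
        show "U \<sigma> (Suc m) t = 0" if "t \<in> {0..1} - {a m..1 - a m}" for t using that by (intro U_supp) simp
      qed (use zl zp p2 Suc in auto)
    qed
    moreover have "K * (2 - 1 / 2 ^ m) + K / 2 ^ Suc m = K * (2 - 1 / 2 ^ Suc m)"
      by (simp add: field_simps)
    ultimately show ?case by (simp add: U_Suc[of \<sigma> "Suc m"])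
  qed
  have U_norm: "CM_norm \<phi> (U \<sigma> m) \<le> C * (2 * K)" if \<sigma>: "\<And>j. \<bar>\<sigma> j\<bar> \<le> 1" for \<sigma> m
  proof (rule CM_norm_le[OF UX])
    show "0 \<le> 2 * K" using K by simp
    fix r :: real assume r: "0 < r" "r < 1"
    show "psi r * cum (U \<sigma> m) r \<le> 2 * K"
    proof (cases m)
      case 0
      then show ?thesis using K by (simp add: U_def cum_def)
    next
      case (Suc k)
      have "K * (2 - 1 / 2 ^ k) \<le> K * 2" using K by (intro mult_left_mono) auto
      then show ?thesis using U_psi[where m = k and \<sigma> = \<sigma>, OF \<sigma> r] unfolding \<open>m = Suc k\<close> by linarith
    qed
  qed
  have part: "(\<Sum>j<m. \<bar>l (z j)\<bar>) \<le> dual_norm \<phi> l * (C * (2 * K))" if l: "l \<in> CM_dual \<phi>" for l m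
  proof -
    \<comment> \<open>Choosing the signs of the values l (z j) turns the bound on signed sums into
      absolute summability with a bound proportional to the dual norm.\<close>
    define \<sigma> where "\<sigma> j = sgn (l (z j))" for j
    have \<sigma>: "\<bar>\<sigma> j\<bar> \<le> 1" for j by (simp add: \<sigma>_def sgn_if)
    have "(\<Sum>j<m. \<bar>l (z j)\<bar>) = (\<Sum>j<m. \<sigma> j * l (z j))" by (intro sum.cong) (auto simp: \<sigma>_def sgn_if)
    also have "\<dots> = l (U \<sigma> m)" by (rule lU[OF l, symmetric])
    also have "\<dots> \<le> dual_norm \<phi> l * CM_norm \<phi> (U \<sigma> m)" using dual_bound(2)[OF l UX[of \<sigma> m]] by linarith
    also have "\<dots> \<le> dual_norm \<phi> l * (C * (2 * K))" by (intro mult_left_mono U_norm \<sigma> dual_bound(1)[OF l])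
    finally show ?thesis .
  qed
  have row: "summable (\<lambda>j. \<bar>l (z j)\<bar>)" if l: "l \<in> CM_dual \<phi>" for l
    using part[OF l] by (intro summableI_nonneg_bounded[where x = "dual_norm \<phi> l * (C * (2 * K))"]) auto
  define L where "L S l = (\<Sum>j. of_bool (j \<in> S) * l (z j))" for S and l :: "(real \<Rightarrow> real) \<Rightarrow> real"
  have rowS: "summable (\<lambda>j. \<bar>of_bool (j \<in> S) * l (z j)\<bar>)" if l: "l \<in> CM_dual \<phi>" for l S
    by (rule summable_comparison_test[OF _ row[OF l]]) auto
  have L: "L S \<in> CM_bidual \<phi>" for S
    unfolding L_def[abs_def]
  proof (rule bidual_series[OF rowS])
    fix l assume l: "l \<in> CM_dual \<phi>"
    have "(\<Sum>j. \<bar>of_bool (j \<in> S) * l (z j)\<bar>) \<le> (\<Sum>j. \<bar>l (z j)\<bar>)" by (intro suminf_le rowS row l) auto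
    also have "\<dots> \<le> dual_norm \<phi> l * (C * (2 * K))" by (intro suminf_le_const row part l)
    finally show "(\<Sum>j. \<bar>of_bool (j \<in> S) * l (z j)\<bar>) \<le> (C * (2 * K)) * dual_norm \<phi> l" by (simp add: mult.commute)
  qed
  have "(\<lambda>i. y (n i) (z i)) \<longlonglongrightarrow> 0"
  proof (rule schur_diagonal[of "\<lambda>i j. y (n i) (z j)"])
    show "summable (\<lambda>j. \<bar>y (n i) (z j)\<bar>)" for i by (rule row[OF yX])
    show "(\<lambda>i. \<Sum>j. if j \<in> S then y (n i) (z j) else 0) \<longlonglongrightarrow> 0" for S
    proof -
      have "(\<lambda>i. L S (y i)) \<longlonglongrightarrow> 0" using y L[of S] by (simp add: weakly_null_dual_def)
      moreover have "L S l = (\<Sum>j. if j \<in> S then l (z j) else 0)" for l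
        unfolding L_def by (intro suminf_cong) simp
      ultimately show ?thesis using LIMSEQ_subseq_LIMSEQ[OF _ n_mono, of "\<lambda>i. L S (y i)" 0] by (simp add: o_def)
    qed
  qed
  then have "\<forall>\<^sub>F i in sequentially. y (n i) (z i) < \<delta>" using \<delta> by (rule order_tendstoD)
  then obtain i where "y (n i) (z i) < \<delta>" by (auto simp: eventually_sequentially)
  with yz[of i] show False by simp
qed

text \<open>Otherwise a subsequence keeps an integral of at least \<delta> over its sets. Thinned so
  that the later sets are tiny, these can be made disjoint at the cost of \<delta> / 2. On disjoint
  sets the bounded densities \<open>k j\<close> can be summed over any set S of indices to a density
  that is again bounded and vanishes near 1; the x_n tend to 0 on this functional, and Schur's lemma
  applies.\<close>

lemma uniform_integrability:
  assumes x: "weakly_null \<phi> x"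
    and G[measurable]: "\<And>n. G n \<in> borel_measurable M01"
    and G_le: "\<And>n t. 0 < t \<Longrightarrow> \<bar>G n t\<bar> \<le> B / t" and B: "0 \<le> B"
    and xG: "\<And>n. integrable M01 (\<lambda>t. x n t * G n t)"
    and a: "0 < a" "a < 1/2"
    and A: "\<And>n. A n \<in> sets M01" "\<And>n. A n \<subseteq> {a..1 - a}" "(\<lambda>n. measure M01 (A n)) \<longlonglongrightarrow> 0"
  shows "(\<lambda>n. \<integral>t. indicator (A n) t * \<bar>x n t * G n t\<bar> \<partial>M01) \<longlonglongrightarrow> 0"
proof (rule ccontr)
  interpret finite_measure M01 by (rule finite_M01)
  have xX: "in_CM0 \<phi> (x n)" for n using x by (simp add: weakly_null_def)
  have [measurable]: "x n \<in> borel_measurable M01" for n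
    by (rule in_CM0_measurable[OF xX])
  have int: "integrable M01 (\<lambda>t. indicator S t * \<bar>x n t * G n t\<bar>)" if "S \<in> sets M01" for S n
    using integrable_real_mult_indicator[OF that integrable_abs[OF xG[of n]]] by (simp add: mult.commute)
  define \<Psi> where "\<Psi> S n = (\<integral>t. indicator S t * \<bar>x n t * G n t\<bar> \<partial>M01)" for S n
  have \<Psi>0: "0 \<le> \<Psi> S n" for S n unfolding \<Psi>_def by (intro integral_nonneg_AE) (auto simp: indicator_def)
  assume "\<not> (\<lambda>n. \<integral>t. indicator (A n) t * \<bar>x n t * G n t\<bar> \<partial>M01) \<longlonglongrightarrow> 0"
  then obtain \<delta> where \<delta>: "\<delta> > 0" and big: "\<And>m. \<exists>n\<ge>m. \<delta> \<le> \<Psi> (A n) n"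
    using \<Psi>0 by (auto simp: LIMSEQ_iff not_less \<Psi>_def[symmetric])
  \<comment> \<open>\<eta> is a measure below which the integral of \<bar>x n * G n\<bar> is at most
    \<delta> / 2, that is, the loss allowed to the n-th set.\<close>
  let ?ok = "\<lambda>(n, \<eta>). 0 < \<eta> \<and> \<delta> \<le> \<Psi> (A n) n \<and> (\<forall>S\<in>sets M01. measure M01 S \<le> \<eta> \<longrightarrow> \<Psi> S n \<le> \<delta> / 2)"
  have pick: "\<exists>n' \<eta>'. m \<le> n' \<and> measure M01 (A n') \<le> \<eta> / 2 \<and> \<eta>' \<le> \<eta> / 2 \<and> ?ok (n', \<eta>')" if \<eta>: "0 < \<eta>" for \<eta> m
  proof -
    have "\<forall>\<^sub>F n in sequentially. measure M01 (A n) < \<eta> / 2" using A(3) \<eta> by (intro order_tendstoD) auto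
    then obtain m' where m': "\<And>n. n \<ge> m' \<Longrightarrow> measure M01 (A n) < \<eta> / 2" by (auto simp: eventually_sequentially)
    obtain n' where n': "max m m' \<le> n'" "\<delta> \<le> \<Psi> (A n') n'" using big by blast
    obtain \<zeta> where \<zeta>: "0 < \<zeta>" "\<And>S. S \<in> sets M01 \<Longrightarrow> emeasure M01 S < \<infinity> \<Longrightarrow> measure M01 S \<le> \<zeta> \<Longrightarrow> \<Psi> S n' \<le> \<delta> / 2"
      using integral_small_on_small_sets[OF xG[of n'], of "\<delta> / 2"] \<delta> unfolding \<Psi>_def by auto
    have "\<Psi> S n' \<le> \<delta> / 2" if "S \<in> sets M01" "measure M01 S \<le> min \<zeta> (\<eta> / 2)" for S
      using that by (intro \<zeta>(2)) (auto simp: less_top[symmetric])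
    with \<zeta> \<eta> n' m'[of n'] show ?thesis
      by (intro exI[of _ n'] exI[of _ "min \<zeta> (\<eta> / 2)"]) auto
  qed
  let ?Q = "\<lambda>s s'. fst s < fst s' \<and> measure M01 (A (fst s')) \<le> snd s / 2 \<and> snd s' \<le> snd s / 2"
  have "\<exists>s. \<forall>j. ?ok (s j) \<and> ?Q (s j) (s (Suc j))"
  proof (rule dependent_nat_choice)
    obtain n \<eta> where "?ok (n, \<eta>)" using pick[of 1 0] by auto
    then show "\<exists>s. ?ok s" by blast
    fix s :: "nat \<times> real" assume s: "?ok s"
    obtain n \<eta> where s_eq: "s = (n, \<eta>)" by (cases s)
    with s have "0 < \<eta>" by simp
    from pick[OF this, of "Suc n"] obtain n' \<eta>' where
      "Suc n \<le> n'" "measure M01 (A n') \<le> \<eta> / 2" "\<eta>' \<le> \<eta> / 2" "?ok (n', \<eta>')" by blast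
    then show "\<exists>s'. ?ok s' \<and> ?Q s s'" unfolding s_eq by (intro exI[of _ "(n', \<eta>')"]) auto
  qed
  then obtain s where S: "\<forall>j. ?ok (s j) \<and> ?Q (s j) (s (Suc j))" by (rule exE)
  define r \<eta> where "r j = fst (s j)" and "\<eta> j = snd (s j)" for j
  have ok: "0 < \<eta> j" "\<delta> \<le> \<Psi> (A (r j)) (r j)" "\<And>S. S \<in> sets M01 \<Longrightarrow> measure M01 S \<le> \<eta> j \<Longrightarrow> \<Psi> S (r j) \<le> \<delta> / 2" for j
    using conjunct1[OF spec[OF S, of j]] by (auto simp: r_def \<eta>_def split: prod.splits)
  have Q: "r j < r (Suc j)" "measure M01 (A (r (Suc j))) \<le> \<eta> j / 2" "\<eta> (Suc j) \<le> \<eta> j / 2" for j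
    using conjunct2[OF spec[OF S, of j]] by (auto simp: r_def \<eta>_def)
  have r_mono: "strict_mono r" using Q by (simp add: strict_mono_Suc_iff)
  have \<eta>_decay: "\<eta> (j + i) \<le> \<eta> j * (1/2) ^ i" for i j
  proof (induction i)
    case (Suc i)
    then show ?case using Q(3)[of "j + i"] by simp
  qed simp
  \<comment> \<open>The later sets have measures at most \<eta> j * (1/2) ^ Suc i, so all of them
    together may be removed from the j-th set.\<close>
  define R where "R j = (\<Union>i. A (r (Suc (j + i))))" for j
  have R_sets: "R j \<in> sets M01" for j unfolding R_def using A(1) by blast
  have R_small: "measure M01 (R j) \<le> \<eta> j" for j
  proof -
    have le: "measure M01 (A (r (Suc (j + i)))) \<le> \<eta> j * (1/2) ^ Suc i" for i
      using Q(2)[of "j + i"] \<eta>_decay[of j i] by simp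
    have sm: "summable (\<lambda>i. \<eta> j * (1/2) ^ Suc i)"
      by (intro summable_mult) (simp add: summable_geometric)
    have smA: "summable (\<lambda>i. measure M01 (A (r (Suc (j + i)))))"
      by (rule summable_comparison_test'[OF sm, of 0]) (simp only: real_norm_def abs_of_nonneg measure_nonneg le)
    have "measure M01 (R j) \<le> (\<Sum>i. measure M01 (A (r (Suc (j + i)))))"
      unfolding R_def by (rule finite_measure_subadditive_countably[OF _ smA]) (use A(1) in auto)
    also have "\<dots> \<le> (\<Sum>i. \<eta> j * (1/2) ^ Suc i)"
      by (intro suminf_le le sm smA)
    also have "\<dots> = \<eta> j"
      using power_half_series sums_mult[of "\<lambda>i. (1/2::real) ^ Suc i" 1 "\<eta> j"] by (simp add: sums_iff)
    finally show ?thesis .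
  qed
  define W where "W j = A (r j) - R j" for j
  have W_sets[measurable]: "W j \<in> sets M01" for j unfolding W_def using A(1) R_sets by auto
  have W_sub: "W j \<subseteq> {a..1 - a}" for j using A(2) by (auto simp: W_def)
  have W_disj: "W i \<inter> W j = {}" if "i < j" for i j
  proof -
    have "A (r j) \<subseteq> R i" unfolding R_def using that by (auto intro!: exI[of _ "j - Suc i"])
    then show ?thesis by (auto simp: W_def)
  qed
  have W_uniq: "i = j" if "t \<in> W i" "t \<in> W j" for i j t
    using W_disj[of i j] W_disj[of j i] that by (metis disjoint_iff linorder_neqE_nat)
  have W_big: "\<delta> / 2 \<le> \<Psi> (W j) (r j)" for j
  proof -
    have "\<Psi> (A (r j)) (r j) \<le> (\<integral>t. indicator (W j) t * \<bar>x (r j) t * G (r j) t\<bar> + indicator (R j) t * \<bar>x (r j) t * G (r j) t\<bar> \<partial>M01)"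
      unfolding \<Psi>_def by (intro integral_mono Bochner_Integration.integrable_add int A(1) W_sets R_sets) (auto simp: W_def indicator_def)
    also have "\<dots> = \<Psi> (W j) (r j) + \<Psi> (R j) (r j)"
      unfolding \<Psi>_def by (intro Bochner_Integration.integral_add int W_sets R_sets)
    finally show ?thesis using ok(2)[of j] ok(3)[OF R_sets R_small, of j] by linarith
  qed
  \<comment> \<open>The sign of x and the modulus of G make the integral of x (r j) * k j equal to
    that of \<bar>x (r j) * G (r j)\<bar> over \<open>W j\<close>. Away from 0 the bound B / t
    becomes B / a.\<close>
  define k where "k j t = indicator (W j) t * (sgn (x (r j) t) * \<bar>G (r j) t\<bar>)" for j t
  have k_meas[measurable]: "k j \<in> borel_measurable M01" for j unfolding k_def by measurable
  have k_le: "\<bar>k j t\<bar> \<le> B / a * indicator (W j) t" for j t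
  proof (cases "t \<in> W j")
    case True
    then have t: "a \<le> t" using W_sub[of j] by auto
    have "\<bar>k j t\<bar> \<le> \<bar>G (r j) t\<bar>" using True by (auto simp: k_def abs_mult sgn_if)
    also have "\<dots> \<le> B / t" using t a by (intro G_le) auto
    also have "\<dots> \<le> B / a" using t a B by (intro divide_left_mono) auto
    finally show ?thesis using True by simp
  qed (simp add: k_def)
  have k_zero: "k j t = 0" if "t \<notin> W j" for j t using that by (simp add: k_def)
  have k_single: "\<exists>i. \<forall>j. j \<noteq> i \<longrightarrow> k j t = 0" for t
    using W_uniq k_zero by metis
  have k_fin: "finite {j. k j t \<noteq> 0}" for t
  proof -
    obtain i where "\<forall>j. j \<noteq> i \<longrightarrow> k j t = 0" using k_single by blast
    then have "{j. k j t \<noteq> 0} \<subseteq> {i}" by auto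
    then show ?thesis by (rule finite_subset) simp
  qed
  \<comment> \<open>At each point at most one term is nonzero; the series serves as a convenient
    form for measurability and for exchanging sum and integral.\<close>
  define g where "g S t = (\<Sum>j. if j \<in> S then k j t else 0)" for S t
  have g_sums: "(\<lambda>j. if j \<in> S then k j t else 0) sums g S t" for S t
    unfolding g_def by (intro summable_sums summable_finite[OF k_fin[of t]]) auto
  have g_meas: "g S \<in> borel_measurable M01" for S
    unfolding g_def by (intro borel_measurable_suminf) simp
  have g_le: "\<bar>g S t\<bar> \<le> B / a * indicator {0..1 - a} t" for S t
  proof -
    obtain i where i: "\<forall>j. j \<noteq> i \<longrightarrow> k j t = 0" using k_single by blast
    have "g S t = (\<Sum>j\<in>{i}. if j \<in> S then k j t else 0)"
      unfolding g_def by (rule suminf_finite) (use i in auto)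
    then have "\<bar>g S t\<bar> \<le> \<bar>k i t\<bar>" by simp
    also have "\<dots> \<le> B / a * indicator (W i) t" by (rule k_le)
    also have "\<dots> \<le> B / a * indicator {0..1 - a} t"
      using W_sub[of i] a B by (intro mult_left_mono) (auto simp: indicator_def)
    finally show ?thesis .
  qed
  have a1: "0 < 1 - a" "1 - a < 1" and Ba: "0 \<le> B / a" using a B by auto
  note fd = fnl_dual[OF g_meas a1 Ba g_le]
  define c where "c i j = (\<integral>t. x (r i) t * k j t \<partial>M01)" for i j
  have xcut: "integrable M01 (\<lambda>t. indicator {0..1 - a} t * \<bar>x n t\<bar>)" for n
    using xX[of n] a by (auto simp: in_CM0_iff intro: locintD)
  have xk_le: "\<bar>x n t * k j t\<bar> \<le> B / a * (indicator (W j) t * \<bar>x n t\<bar>)" for n j t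
    using mult_left_mono[OF k_le[of j t], of "\<bar>x n t\<bar>"] by (simp add: abs_mult mult_ac)
  have xW: "integrable M01 (\<lambda>t. indicator (W j) t * \<bar>x n t\<bar>)" for j n
  proof (rule Bochner_Integration.integrable_bound[OF xcut[of n]])
    show "AE t in M01. norm (indicator (W j) t * \<bar>x n t\<bar>) \<le> norm (indicator {0..1 - a} t * \<bar>x n t\<bar>)"
    proof (rule AE_I2)
      fix t show "norm (indicator (W j) t * \<bar>x n t\<bar>) \<le> norm (indicator {0..1 - a} t * \<bar>x n t\<bar>)"
        using W_sub[of j] a by (cases "t \<in> W j") auto
    qed
  qed measurable
  have xk: "integrable M01 (\<lambda>t. x n t * k j t)" for n j
  proof (rule Bochner_Integration.integrable_bound)
    show "integrable M01 (\<lambda>t. B / a * (indicator (W j) t * \<bar>x n t\<bar>))" by (intro integrable_mult_right xW)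
    show "AE t in M01. norm (x n t * k j t) \<le> norm (B / a * (indicator (W j) t * \<bar>x n t\<bar>))"
      by (rule AE_I2) (metis xk_le abs_ge_self order_trans real_norm_def)
  qed measurable
  have W_sum: "(\<Sum>j<m. indicator (W j) t) \<le> (indicator {0..1 - a} t :: real)" for m t
  proof (cases "\<exists>i<m. t \<in> W i")
    case True
    then obtain i where i: "i < m" "t \<in> W i" by blast
    have "(\<Sum>j<m. indicator (W j) t :: real) = (\<Sum>j\<in>{i}. indicator (W j) t)"
      using i W_uniq by (intro sum.mono_neutral_right) (auto simp: indicator_def)
    then show ?thesis using i W_sub[of i] a by auto
  next
    case False
    then have "(\<Sum>j<m. indicator (W j) t :: real) = 0" by (intro sum.neutral) auto
    then show ?thesis by (simp add: indicator_def)
  qed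
  \<comment> \<open>Disjointness makes the total over all blocks at most one integral over
    [0, 1 - a]. This gives the summable rows and the exchange of sum and integral.\<close>
  have part: "(\<Sum>j<m. \<integral>t. \<bar>x n t * k j t\<bar> \<partial>M01) \<le> B / a * cum (x n) (1 - a)" for n m
  proof -
    have "(\<Sum>j<m. \<integral>t. \<bar>x n t * k j t\<bar> \<partial>M01) \<le> (\<Sum>j<m. \<integral>t. B / a * (indicator (W j) t * \<bar>x n t\<bar>) \<partial>M01)"
      by (intro sum_mono integral_mono integrable_abs xk integrable_mult_right xW xk_le)
    also have "\<dots> = (\<integral>t. (\<Sum>j<m. B / a * (indicator (W j) t * \<bar>x n t\<bar>)) \<partial>M01)"
      by (intro Bochner_Integration.integral_sum[symmetric] integrable_mult_right xW)
    also have "\<dots> \<le> (\<integral>t. B / a * (indicator {0..1 - a} t * \<bar>x n t\<bar>) \<partial>M01)"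
    proof (intro integral_mono Bochner_Integration.integrable_sum integrable_mult_right xW xcut)
      fix t
      have "(\<Sum>j<m. B / a * (indicator (W j) t * \<bar>x n t\<bar>)) = B / a * ((\<Sum>j<m. indicator (W j) t) * \<bar>x n t\<bar>)"
        by (simp only: sum_distrib_left sum_distrib_right)
      also have "\<dots> \<le> B / a * (indicator {0..1 - a} t * \<bar>x n t\<bar>)"
        using B a by (intro mult_left_mono mult_right_mono W_sum) auto
      finally show "(\<Sum>j<m. B / a * (indicator (W j) t * \<bar>x n t\<bar>)) \<le> B / a * (indicator {0..1 - a} t * \<bar>x n t\<bar>)" .
    qed
    also have "\<dots> = B / a * cum (x n) (1 - a)" by (simp add: cum_def)
    finally show ?thesis .
  qed
  have abs_sum: "summable (\<lambda>j. \<integral>t. \<bar>x n t * k j t\<bar> \<partial>M01)" for n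
    by (rule summableI_nonneg_bounded[OF _ part]) (auto intro!: integral_nonneg_AE)
  have c_le: "\<bar>c i j\<bar> \<le> (\<integral>t. \<bar>x (r i) t * k j t\<bar> \<partial>M01)" for i j
    unfolding c_def using integral_abs_bound[of M01 "\<lambda>t. x (r i) t * k j t"] by simp
  have fnl_eq: "fnl (g S) (x (r i)) = (\<Sum>j. if j \<in> S then c i j else 0)" for S i
  proof -
    let ?h = "\<lambda>j t. if j \<in> S then x (r i) t * k j t else 0"
    have h_int: "integrable M01 (?h j)" for j using xk by (cases "j \<in> S") auto
    have h_ae: "AE t in M01. summable (\<lambda>j. norm (?h j t))"
    proof (rule AE_I2)
      fix t show "summable (\<lambda>j. norm (?h j t))" by (rule summable_finite[OF k_fin[of t]]) auto
    qed
    have h_sum: "summable (\<lambda>j. \<integral>t. norm (?h j t) \<partial>M01)"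
    proof (rule summable_comparison_test'[OF abs_sum[of "r i"], of 0])
      fix j
      have "0 \<le> (\<integral>t. \<bar>x (r i) t * k j t\<bar> \<partial>M01)" by (intro integral_nonneg_AE) simp
      then show "norm (\<integral>t. norm (?h j t) \<partial>M01) \<le> (\<integral>t. \<bar>x (r i) t * k j t\<bar> \<partial>M01)"
        by (cases "j \<in> S") simp_all
    qed
    have eq: "x (r i) t * g S t = (\<Sum>j. ?h j t)" for t
    proof -
      have "(\<lambda>j. x (r i) t * (if j \<in> S then k j t else 0)) sums (x (r i) t * g S t)"
        by (rule sums_mult[OF g_sums])
      moreover have "(\<lambda>j. x (r i) t * (if j \<in> S then k j t else 0)) = (\<lambda>j. ?h j t)" by auto
      ultimately show ?thesis by (simp add: sums_iff)
    qed
    have "fnl (g S) (x (r i)) = (\<integral>t. (\<Sum>j. ?h j t) \<partial>M01)"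
      unfolding fnl_def eq using xX by simp
    also have "\<dots> = (\<Sum>j. \<integral>t. ?h j t \<partial>M01)"
      by (rule integral_suminf[OF h_int h_ae h_sum])
    also have "\<dots> = (\<Sum>j. if j \<in> S then c i j else 0)"
      by (intro suminf_cong) (auto simp: c_def)
    finally show ?thesis .
  qed
  have "(\<lambda>i. c i i) \<longlonglongrightarrow> 0"
  proof (rule schur_diagonal[of c])
    show "summable (\<lambda>j. \<bar>c i j\<bar>)" for i
      by (rule summable_comparison_test'[OF abs_sum[of "r i"], of 0]) (simp only: real_norm_def abs_idempotent c_le)
    show "(\<lambda>i. \<Sum>j. if j \<in> S then c i j else 0) \<longlonglongrightarrow> 0" for S
    proof -
      have "(\<lambda>i. fnl (g S) (x i)) \<longlonglongrightarrow> 0" using x fd(3)[of S] by (simp add: weakly_null_def)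
      from LIMSEQ_subseq_LIMSEQ[OF this r_mono] show ?thesis by (simp add: o_def fnl_eq)
    qed
  qed
  then have "\<forall>\<^sub>F i in sequentially. c i i < \<delta> / 2" using \<delta> by (intro order_tendstoD) auto
  then obtain i where "c i i < \<delta> / 2" by (auto simp: eventually_sequentially)
  moreover have "c i i = \<Psi> (W i) (r i)"
  proof -
    have "x (r i) t * k i t = indicator (W i) t * \<bar>x (r i) t * G (r i) t\<bar>" for t
      by (simp add: k_def abs_mult abs_sgn[of "x (r i) t"] mult_ac)
    then show ?thesis by (simp add: c_def \<Psi>_def)
  qed
  ultimately show False using W_big[of i] by linarith
qed

text \<open>Three regions: the tails are small uniformly in n; the set where \<bar>G n\<bar> > e has
  measure tending to 0 and is handled by uniform integrability; on the rest \<bar>x n * G n\<bar>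
  \<le> e * \<bar>x n\<bar>, whose integral is at most e times the uniform bound k of F at 1 -
  a.\<close>

theorem CM0_Dunford_Pettis: "CM0_Dunford_Pettis \<phi>"
  unfolding CM0_Dunford_Pettis_def
proof (intro allI impI)
  fix x y assume x: "weakly_null \<phi> x" and y: "weakly_null_dual \<phi> y"
  interpret finite_measure M01 by (rule finite_M01)
  have xX: "in_CM0 \<phi> (x n)" for n using x by (simp add: weakly_null_def)
  have yX: "y n \<in> CM_dual \<phi>" for n using y by (simp add: weakly_null_dual_def)
  have [measurable]: "x n \<in> borel_measurable M01" for n
    by (rule in_CM0_measurable[OF xX])
  obtain K where K: "0 < K" "\<And>n s. 0 < s \<Longrightarrow> s < 1 \<Longrightarrow> psi s * cum (x n) s \<le> K"
    using weakly_null_bounded[OF x] by blast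
  obtain N where N: "0 < N" "\<And>n. dual_norm \<phi> (y n) \<le> N"
    using weakly_null_dual_bounded[OF y] by blast
  define B where "B = C * \<phi> 1 * N"
  have B: "0 \<le> B" using C_pos nonneg[of 1] N by (simp add: B_def)
  have "\<forall>n. \<exists>G. G \<in> borel_measurable M01 \<and> (\<forall>t. 0 < t \<longrightarrow> \<bar>G t\<bar> \<le> C * \<phi> 1 * dual_norm \<phi> (y n) / t) \<and>
     (\<forall>f. in_CM0 \<phi> f \<longrightarrow> integrable M01 (\<lambda>t. f t * G t) \<and> y n f = (\<integral>t. f t * G t \<partial>M01))"
    using dual_density[OF yX] by blast
  then obtain G where G0: "\<forall>n. G n \<in> borel_measurable M01 \<and> (\<forall>t. 0 < t \<longrightarrow> \<bar>G n t\<bar> \<le> C * \<phi> 1 * dual_norm \<phi> (y n) / t) \<and>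
     (\<forall>f. in_CM0 \<phi> f \<longrightarrow> integrable M01 (\<lambda>t. f t * G n t) \<and> y n f = (\<integral>t. f t * G n t \<partial>M01))"
    by (rule choice[THEN exE])
  have G[measurable]: "G n \<in> borel_measurable M01" for n using G0 by blast
  have Gy: "integrable M01 (\<lambda>t. f t * G n t) \<and> y n f = (\<integral>t. f t * G n t \<partial>M01)" if "in_CM0 \<phi> f" for f n
    using G0 that by blast
  have G_le: "\<bar>G n t\<bar> \<le> B / t" if "0 < t" for n t
  proof -
    have "\<bar>G n t\<bar> \<le> C * \<phi> 1 * dual_norm \<phi> (y n) / t" using G0 that by blast
    also have "\<dots> \<le> B / t"
      unfolding B_def using that C_pos nonneg[of 1] by (intro divide_right_mono mult_left_mono N) auto
    finally show ?thesis .
  qed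
  have xG: "integrable M01 (\<lambda>t. x n t * G n t)" for n using Gy[OF xX] by blast
  show "(\<lambda>n. y n (x n)) \<longlonglongrightarrow> 0"
  proof (rule LIMSEQ_I)
    fix \<epsilon> :: real assume \<epsilon>: "0 < \<epsilon>"
    obtain a where a: "0 < a" "a < 1/2"
      and tail: "\<And>n. (\<integral>t. indicator (- {a..1 - a}) t * \<bar>x n t * G n t\<bar> \<partial>M01) \<le> \<epsilon> / 4"
    proof -
      have "0 < \<epsilon> / 4" using \<epsilon> by simp
      from uniform_tails[OF x y K G Gy this] show thesis using that by blast
    qed
    define k where "k = K / psi (1 - a)"
    have pa: "0 < psi (1 - a)" using a by (intro psi_pos) auto
    have k: "0 \<le> k" "cum (x n) (1 - a) \<le> k" for n
      using K(1) K(2)[of "1 - a" n] a pa by (auto simp: k_def field_simps)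
    \<comment> \<open>Makes e * k at most \<epsilon> / 4; three quarters of \<epsilon> then leave
      the strict inequality.\<close>
    define e where "e = \<epsilon> / 4 / (k + 1)"
    have e: "0 < e" using \<epsilon> k by (simp add: e_def)
    define E where "E = {a..1 - a}"
    have E_sets: "E \<in> sets M01" using a by (auto simp: E_def sets_M01_iff)
    define A where "A n = {t\<in>E. e < \<bar>G n t\<bar>}" for n
    have A_eq: "A n = {t\<in>{a..1 - a}. e < G n t} \<union> {t\<in>{a..1 - a}. e < - G n t}" for n
      by (auto simp: A_def E_def)
    have pos_sets: "{t\<in>{a..1 - a}. e < H t} \<in> sets M01" if [measurable]: "H \<in> borel_measurable M01" for H
    proof -
      have "{t\<in>{a..1 - a}. e < H t} = E \<inter> {t\<in>space M01. e < H t}" using a by (auto simp: E_def space_M01)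
      moreover have "{t\<in>space M01. e < H t} \<in> sets M01" by measurable
      ultimately show ?thesis using E_sets by auto
    qed
    have A_sets: "A n \<in> sets M01" for n
      unfolding A_eq by (intro sets.Un pos_sets) measurable
    have A_lim: "(\<lambda>n. measure M01 (A n)) \<longlonglongrightarrow> 0"
    proof -
      have 1: "(\<lambda>n. measure M01 {t\<in>{a..1 - a}. e < G n t}) \<longlonglongrightarrow> 0"
        by (rule density_null_in_measure[OF y G Gy a(1) e])
      \<comment> \<open>The level set argument is one-sided, so the set where G n < - e is obtained
        from the negated sequence.\<close>
      have ym: "weakly_null_dual \<phi> (\<lambda>n f. - y n f)"
        unfolding weakly_null_dual_def
      proof (intro conjI allI ballI)
        fix n
        show "(\<lambda>f. - y n f) \<in> CM_dual \<phi>"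
          unfolding CM_dual_def
        proof (intro CollectI conjI allI impI)
          show "- y n (\<lambda>t. p * f t + q * h t) = p * - y n f + q * - y n h" if "in_CM0 \<phi> f" "in_CM0 \<phi> h" for f h p q
            using CM_dualD(1)[OF yX that, of n p q] by simp
          show "\<exists>K. \<forall>f. in_CM0 \<phi> f \<longrightarrow> \<bar>- y n f\<bar> \<le> K * CM_norm \<phi> f"
            using CM_dualD(3)[OF yX[of n]] by simp
          show "- y n f = 0" if "\<not> in_CM0 \<phi> f" for f using CM_dualD(2)[OF yX that] by simp
        qed
      next
        fix L assume L: "L \<in> CM_bidual \<phi>"
        have lin: "L (\<lambda>f. p * l1 f + q * l2 f) = p * L l1 + q * L l2" if "l1 \<in> CM_dual \<phi>" "l2 \<in> CM_dual \<phi>" for l1 l2 p q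
          using L that unfolding CM_bidual_def by blast
        have "L (\<lambda>f. - y n f) = - L (y n)" for n
          using lin[OF yX[of n] yX[of n], of "-1" 0] by simp
        moreover have "(\<lambda>n. L (y n)) \<longlonglongrightarrow> 0" using y L by (simp add: weakly_null_dual_def)
        then have "(\<lambda>n. - L (y n)) \<longlonglongrightarrow> - 0" by (rule tendsto_minus)
        ultimately show "(\<lambda>n. L (\<lambda>f. - y n f)) \<longlonglongrightarrow> 0" by simp
      qed
      have 2: "(\<lambda>n. measure M01 {t\<in>{a..1 - a}. e < - G n t}) \<longlonglongrightarrow> 0"
      proof (rule density_null_in_measure[OF ym _ _ a(1) e])
        show "(\<lambda>t. - G n t) \<in> borel_measurable M01" for n by measurable
        show "integrable M01 (\<lambda>t. f t * - G n t) \<and> - y n f = (\<integral>t. f t * - G n t \<partial>M01)" if "in_CM0 \<phi> f" for n f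
          using Gy[OF that, of n] by simp
      qed
      have "(\<lambda>n. measure M01 {t\<in>{a..1 - a}. e < G n t} + measure M01 {t\<in>{a..1 - a}. e < - G n t}) \<longlonglongrightarrow> 0 + 0"
        by (intro tendsto_add 1 2)
      moreover have "measure M01 (A n) \<le> measure M01 {t\<in>{a..1 - a}. e < G n t} + measure M01 {t\<in>{a..1 - a}. e < - G n t}" for n
        unfolding A_eq by (intro measure_Un_le pos_sets) measurable
      ultimately show ?thesis
        by (intro tendsto_sandwich[OF _ _ tendsto_const, of _ "\<lambda>n. measure M01 (A n)"]) (auto intro!: always_eventually)
    qed
    have "(\<lambda>n. \<integral>t. indicator (A n) t * \<bar>x n t * G n t\<bar> \<partial>M01) \<longlonglongrightarrow> 0"
      by (rule uniform_integrability[OF x G G_le B xG a A_sets _ A_lim]) (auto simp: A_def E_def)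
    then have "\<forall>\<^sub>F n in sequentially. (\<integral>t. indicator (A n) t * \<bar>x n t * G n t\<bar> \<partial>M01) < \<epsilon> / 4"
      using \<epsilon> by (intro order_tendstoD) auto
    then obtain no where no: "\<And>n. n \<ge> no \<Longrightarrow> (\<integral>t. indicator (A n) t * \<bar>x n t * G n t\<bar> \<partial>M01) < \<epsilon> / 4"
      by (auto simp: eventually_sequentially)
    show "\<exists>no. \<forall>n\<ge>no. norm (y n (x n) - 0) < \<epsilon>"
    proof (intro exI[of _ no] allI impI)
      fix n assume n: "no \<le> n"
      let ?f = "\<lambda>t. \<bar>x n t * G n t\<bar>"
      have ind: "integrable M01 (\<lambda>t. indicator S t * ?f t)" if "S \<in> sets M01" for S
        using integrable_real_mult_indicator[OF that integrable_abs[OF xG[of n]]] by (simp add: mult.commute)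
      have "(\<lambda>t. indicator (- E) t * ?f t) = (\<lambda>t. ?f t - indicator E t * ?f t)"
        by (auto simp: indicator_def)
      then have i1: "integrable M01 (\<lambda>t. indicator (- E) t * ?f t)"
        using Bochner_Integration.integrable_diff[OF integrable_abs[OF xG[of n]] ind[OF E_sets]] by simp
      have i3: "integrable M01 (\<lambda>t. e * (indicator {0..1 - a} t * \<bar>x n t\<bar>))"
        using xX[of n] a by (intro integrable_mult_right locintD) (auto simp: in_CM0_iff)
      have "\<bar>y n (x n)\<bar> \<le> (\<integral>t. ?f t \<partial>M01)"
        using Gy[OF xX, of n n] integral_abs_bound[of M01 "\<lambda>t. x n t * G n t"] by simp
      also have "\<dots> \<le> (\<integral>t. indicator (- E) t * ?f t + indicator (A n) t * ?f t + e * (indicator {0..1 - a} t * \<bar>x n t\<bar>) \<partial>M01)"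
      proof (rule integral_mono)
        show "integrable M01 ?f" using xG by (rule integrable_abs)
        show "integrable M01 (\<lambda>t. indicator (- E) t * ?f t + indicator (A n) t * ?f t + e * (indicator {0..1 - a} t * \<bar>x n t\<bar>))"
          by (intro Bochner_Integration.integrable_add i1 i3 ind A_sets)
        fix t
        show "?f t \<le> indicator (- E) t * ?f t + indicator (A n) t * ?f t + e * (indicator {0..1 - a} t * \<bar>x n t\<bar>)"
        proof (cases "t \<in> E \<and> t \<notin> A n")
          case True
          then have "\<bar>G n t\<bar> \<le> e" "t \<in> {0..1 - a}" using a by (auto simp: A_def E_def)
          then have "\<bar>x n t\<bar> * \<bar>G n t\<bar> \<le> \<bar>x n t\<bar> * e" by (intro mult_left_mono) auto
          with True \<open>t \<in> {0..1 - a}\<close> show ?thesis by (simp add: abs_mult mult_ac)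
        next
          case False
          have "0 \<le> e * (indicator {0..1 - a} t * \<bar>x n t\<bar>)" using e by (auto simp: indicator_def)
          then show ?thesis using False by (auto simp: indicator_def)
        qed
      qed
      also have "\<dots> = (\<integral>t. indicator (- E) t * ?f t \<partial>M01) + (\<integral>t. indicator (A n) t * ?f t \<partial>M01) + e * cum (x n) (1 - a)"
        unfolding cum_def using i1 i3 ind[OF A_sets[of n]]
        by (simp add: Bochner_Integration.integral_add Bochner_Integration.integrable_add del: integral_mult_right_zero flip: integral_mult_right_zero)
      also have "\<dots> \<le> \<epsilon> / 4 + \<epsilon> / 4 + \<epsilon> / 4"
      proof (intro add_mono)
        show "(\<integral>t. indicator (- E) t * ?f t \<partial>M01) \<le> \<epsilon> / 4" unfolding E_def by (rule tail)
        show "(\<integral>t. indicator (A n) t * ?f t \<partial>M01) \<le> \<epsilon> / 4" using no[OF n] by simp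
        have "e * cum (x n) (1 - a) \<le> e * k" using e k by (intro mult_left_mono) auto
        also have "\<dots> \<le> \<epsilon> / 4" using weighted_frac_le[of "\<epsilon> / 4" k] \<epsilon> k by (simp add: e_def mult.commute)
        finally show "e * cum (x n) (1 - a) \<le> \<epsilon> / 4" .
      qed
      finally have "\<bar>y n (x n)\<bar> \<le> \<epsilon> / 4 + \<epsilon> / 4 + \<epsilon> / 4" .
      then show "norm (y n (x n) - 0) < \<epsilon>" using \<epsilon> by simp
    qed
  qed
qed

end

theorem theorem11:
  fixes \<phi> :: "real \<Rightarrow> real"
  assumes "mono_on {0..1} \<phi>"
    and "concave_on {0..1} \<phi>"
    and "\<phi> 0 = 0"
    and "\<forall>t\<in>{0<..1}. \<phi> t > 0"
    and "(\<phi> \<longlongrightarrow> 0) (at_right 0)"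
    and "q_index0 \<phi> < 1"
  shows "CM0_Dunford_Pettis \<phi>"
proof -
  have mono: "\<phi> s \<le> \<phi> t" if "0 \<le> s" "s \<le> t" "t \<le> 1" for s t
    using assms(1) that by (auto simp: mono_on_def)
  have pos: "0 < \<phi> t" if "0 < t" "t \<le> 1" for t
    using assms(4) that by auto
  \<comment> \<open>s is the convex combination of 0 and t with weight s / t at t, and \<phi> 0 =
    0.\<close>
  have quasi: "\<phi> t / t \<le> \<phi> s / s" if "0 < s" "s \<le> t" "t \<le> 1" for s t
  proof -
    have "(1 - s / t) * \<phi> 0 + s / t * \<phi> t \<le> \<phi> ((1 - s / t) *\<^sub>R 0 + (s / t) *\<^sub>R t)"
      using that by (intro concave_onD[OF assms(2)]) auto
    then show ?thesis using that assms(3) by (simp add: field_simps)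
  qed
  show ?thesis
  proof (rule power_bound_of_q_index0[OF mono pos quasi assms(6)])
    fix D \<alpha> :: real
    assume "0 \<le> \<alpha>" "\<alpha> < 1"
      "\<And>u t. 0 < u \<Longrightarrow> u \<le> t \<Longrightarrow> t \<le> 1 \<Longrightarrow> \<phi> t \<le> D * (t / u) powr \<alpha> * \<phi> u"
    then interpret index_weight \<phi> D \<alpha>
      by (intro index_weight.intro mono pos quasi assms(3,5))
    show ?thesis by (rule CM0_Dunford_Pettis)
  qed
qed

end
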